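(* Let $d\ge 2$, $\alpha>-1$, $r\in\mathbb{N}$, and let $U^d$ be either $\mathbb{R}^d$ or $\mathbb{R}^d_+$. Then there are constants $C_1,C_2>0$ independent of $n$ such that for all integers $n\ge2$ \[ C_1\, n^{-3r/4}(\log n)^{3r(d-1)/4}\;\le\;\mathrm{Int}_n\big(\mathbf{W}^r_{1,\mathbf{w}_r}(U^d)\big)\;\le\;C_2\, n^{-r/2}(\log n)^{(r/2+1)(d-1)}. \]
   Context: For $r\in\mathbb{N}_0$ let $w_r(x)=|x|^{\alpha+r/2}e^{-|x|}$ ($x\in U$, where $U=\mathbb{R}$ or $U=\mathbb{R}_+$ correspondingly) and $\mathbf{w}_r(\mathbf{x})=\prod_{i=1}^d w_r(x_i)$ for $\mathbf{x}\in U^d$; $\mathbf{w}:=\mathbf{w}_0$. The space $L_{1,\mathbf{w}_r}(U^d)$ consists of measurable $f$ with $\|f\|_{L_{1,\mathbf{w}_r}}=\int_{U^d}|f(\mathbf{x})\mathbf{w}_r(\mathbf{x})|\,d\mathbf{x}<\infty$. The weighted Sobolev space of mixed smoothness $W^r_{1,\mathbf{w}_r}(U^d)$ consists of $f\in L_{1,\mathbf{w}_r}(U^d)$ such that the weak partial derivatives $D^{\mathbf{k}}f$ belong to $L_{1,\mathbf{w}_r}(U^d)$ for all $\mathbf{k}\in\mathbb{N}_0^d$ with $|\mathbf{k}|_\infty\le r$, with norm $\sum_{|\mathbf{k}|_\infty\le r}\|D^{\mathbf{k}}f\|_{L_{1,\mathbf{w}_r}}$; its elements are identified with their continuous representatives,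 and $\mathbf{W}^r_{1,\mathbf{w}_r}(U^d)$ is its closed unit ball. For a set $\mathbf{F}$ of continuous functions on $U^d$, $\mathrm{Int}_n(\mathbf{F})=\inf_Q\sup_{f\in\mathbf{F}}\big|\int_{U^d}f(\mathbf{x})\mathbf{w}(\mathbf{x})\,d\mathbf{x}-Qf\big|$, the infimum over all quadratures $Qf=\sum_{i=1}^k\lambda_if(\mathbf{x}_i)$ with $k\le n$, arbitrary nodes $\mathbf{x}_i\in U^d$ (possibly repeated) and real weights $\lambda_i$. *)

theory Defs
  imports "HOL-Analysis.Analysis"
begin

definition wr :: "real \<Rightarrow> nat \<Rightarrow> real \<Rightarrow> real" where
  "wr \<alpha> r x = \<bar>x\<bar> powr (\<alpha> + real r / 2) * exp (- \<bar>x\<bar>)"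

definition wvec :: "real \<Rightarrow> nat \<Rightarrow> real^'d \<Rightarrow> real" where
  "wvec \<alpha> r x = (\<Prod>i\<in>UNIV. wr \<alpha> r (x $ i))"

definition cube :: "real set \<Rightarrow> (real^'d) set" where
  "cube U = {x. \<forall>i. x $ i \<in> U}"

definition pdiff :: "'d \<Rightarrow> (real^'d \<Rightarrow> real) \<Rightarrow> real^'d \<Rightarrow> real" where
  "pdiff i \<phi> x = deriv (\<lambda>t. \<phi> (x + t *\<^sub>R axis i 1)) 0"

fun pdiffs :: "'d list \<Rightarrow> (real^'d \<Rightarrow> real) \<Rightarrow> real^'d \<Rightarrow> real" where
  "pdiffs [] \<phi> = \<phi>"
| "pdiffs (i # is) \<phi> = pdiffs is (pdiff i \<phi>)"

definition test_fun :: "(real^'d) set \<Rightarrow> (real^'d \<Rightarrow> real) \<Rightarrow> bool" where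
  "test_fun \<Omega> \<phi> \<longleftrightarrow>
     compact (closure {x. \<phi> x \<noteq> 0}) \<and> closure {x. \<phi> x \<noteq> 0} \<subseteq> \<Omega> \<and>
     (\<forall>is. continuous_on UNIV (pdiffs is \<phi>) \<and>
        (\<forall>i x. (\<lambda>t. pdiffs is \<phi> (x + t *\<^sub>R axis i 1)) differentiable (at 0)))"

definition locally_integrable_on :: "(real^'d \<Rightarrow> real) \<Rightarrow> (real^'d) set \<Rightarrow> bool" where
  "locally_integrable_on f \<Omega> \<longleftrightarrow>
     (\<forall>K. compact K \<and> K \<subseteq> \<Omega> \<longrightarrow> set_integrable lborel K f)"

text \<open>g is the weak derivative D^k f on the open set Omega (k a multi-index).
  For a smooth test function the order of differentiation is irrelevant, so we
  require the identity for every ordering of the directions.\<close>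
definition has_weak_deriv ::
  "(real^'d) set \<Rightarrow> (real^'d \<Rightarrow> real) \<Rightarrow> ('d \<Rightarrow> nat) \<Rightarrow> (real^'d \<Rightarrow> real) \<Rightarrow> bool" where
  "has_weak_deriv \<Omega> f k g \<longleftrightarrow>
     locally_integrable_on f \<Omega> \<and> locally_integrable_on g \<Omega> \<and>
     (\<forall>\<phi> is. test_fun \<Omega> \<phi> \<and> (\<forall>i. count (mset is) i = k i) \<longrightarrow>
        (LINT x:\<Omega>|lborel. f x * pdiffs is \<phi> x)
          = (-1) ^ (\<Sum>i\<in>UNIV. k i) * (LINT x:\<Omega>|lborel. g x * \<phi> x))"

definition in_L1w :: "real \<Rightarrow> nat \<Rightarrow> real set \<Rightarrow> (real^'d \<Rightarrow> real) \<Rightarrow> bool" where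
  "in_L1w \<alpha> r U f \<longleftrightarrow> f \<in> borel_measurable lborel \<and>
     set_integrable lborel (cube U) (\<lambda>x. f x * wvec \<alpha> r x)"

definition norm_L1w :: "real \<Rightarrow> nat \<Rightarrow> real set \<Rightarrow> (real^'d \<Rightarrow> real) \<Rightarrow> real" where
  "norm_L1w \<alpha> r U f = (LINT x:cube U|lborel. \<bar>f x * wvec \<alpha> r x\<bar>)"

definition multi_idx :: "nat \<Rightarrow> ('d::finite \<Rightarrow> nat) set" where
  "multi_idx r = {k. \<forall>i. k i \<le> r}"

text \<open>Closed unit ball of W^r_{1,w_r}(U^d) (continuous representatives).\<close>
definition sobolev_ball :: "real \<Rightarrow> nat \<Rightarrow> real set \<Rightarrow> (real^'d::finite \<Rightarrow> real) set" where
  "sobolev_ball \<alpha> r U = {f. continuous_on (cube U) f \<and> in_L1w \<alpha> r U f \<and>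
     (\<exists>G. (\<forall>k\<in>multi_idx r. has_weak_deriv (cube U) f k (G k) \<and> in_L1w \<alpha> r U (G k)) \<and>
          (\<Sum>k\<in>multi_idx r. norm_L1w \<alpha> r U (G k)) \<le> 1)}"

definition quad :: "(real \<times> 'a) list \<Rightarrow> ('a \<Rightarrow> real) \<Rightarrow> real" where
  "quad Q f = (\<Sum>p\<leftarrow>Q. fst p * f (snd p))"

text \<open>Optimal quadrature error Int_n(F) for the weight w = w_0 on U^d (in ereal,
  so that an unbounded error is +infinity rather than an arbitrary real).\<close>
definition Int_n :: "real \<Rightarrow> real set \<Rightarrow> nat \<Rightarrow> (real^'d::finite \<Rightarrow> real) set \<Rightarrow> ereal" where
  "Int_n \<alpha> U n F = (INF Q\<in>{Q. length Q \<le> n \<and> (\<forall>p\<in>set Q. snd p \<in> cube U)}.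
      SUP f\<in>F. ereal \<bar>(LINT x:cube U|lborel. f x * wvec \<alpha> 0 x) - quad Q f\<bar>)"

end

theory Submission
  imports Defs
begin

text \<open>Upper bound: on \<open>(0, \<infinity>)\<close> interpolate \<open>f\<close> piecewise at \<open>O(N)\<close> nodes with local spacing \<open>sqrt (x/N)\<close>. The
  error at \<open>x\<close> is an integral of derivatives of \<open>f\<close> against kernels \<open>\<kappa> x t\<close>, and the integral of
  \<open>\<kappa> x t * wr \<alpha> 0 x\<close> over \<open>x\<close> is \<open>O(N powr (- r/2)) * wr \<alpha> r t\<close>. Tensor products of differences of consecutive
  dyadic interpolants therefore have weighted \<open>L\<^sub>1\<close> norm \<open>O(2 powr (- r/2 * (k\<^sub>1 + \<dots> + k\<^sub>d)))\<close>, and integrating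
  the sum of those with \<open>k\<^sub>1 + \<dots> + k\<^sub>d < m\<close> gives a quadrature with \<open>O(2\<^sup>m m\<^sup>d\<^sup>-\<^sup>1)\<close> nodes and error
  \<open>O(2 powr (- r m/2) m\<^sup>d\<^sup>-\<^sup>1)\<close>. Weak derivatives enter only through tensor product test functions, by testing
  \<open>f\<close> against mollified point masses.

  Lower bound: among the unit cubes with integer corner \<open>k\<close>, \<open>\<Prod> k\<^sub>i \<le> N\<close>, of which there are about
  \<open>N (ln N)\<^sup>d\<^sup>-\<^sup>1\<close>, one contains no node. A normalised bump on it has weighted integral at least of order
  \<open>N powr (- r/2)\<close>, which gives the rate \<open>((ln n)\<^sup>d\<^sup>-\<^sup>1 / n) powr (r/2)\<close>, stronger than the one claimed.\<close>

section \<open>Smooth functions of one variable\<close>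

text \<open>The obstacle is that \<open>f\<close> has point values by continuity only, while its
  derivatives are known merely as weak ones. The way around it is Peano's: local interpolation
  reproduces polynomials of degree below \<open>r\<close>, so the mollified error functional has
  \<open>r\<close> vanishing moments and is therefore the \<open>r\<close>-th derivative of a
  compactly supported smooth function. The weak derivative identity moves the derivatives onto
  \<open>f\<close>, and the resulting bounds do not depend on the mollification. Logarithms in the
  upper bound: \<open>n\<close> is of order \<open>2^m * m^(d-1)\<close>, which turns
  \<open>2^(-r*m/2)\<close> into \<open>n^(-r/2)\<close> times \<open>(log n)^(r/2*(d-1))\<close>.
  The further power \<open>d-1\<close> counts the multi-indices \<open>k\<close> of a given sum
  \<open>s\<close>, of which there are at most \<open>(s+1)^(d-1)\<close>. Lower bound: with
  \<open>y = (ln n)^(d-1) / n\<close> the argument yields the rate \<open>y^(r/2)\<close>. The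
  claimed rate is \<open>y^(3*r/4)\<close>, which is at most a constant times that because
  \<open>y\<close> is bounded.\<close>

primrec Ck :: "nat \<Rightarrow> (real \<Rightarrow> real) \<Rightarrow> bool" where
  "Ck 0 f \<longleftrightarrow> True"
| "Ck (Suc n) f \<longleftrightarrow> (\<exists>g. (\<forall>x. (f has_real_derivative g x) (at x)) \<and> Ck n g)"

text \<open>\<open>Ck n\<close> asks for \<open>n\<close> derivatives but not for continuity of the
  last one. Over all \<open>n\<close> this still gives the usual infinitely differentiable
  functions, since each derivative is itself differentiable.\<close>

definition smooth :: "(real \<Rightarrow> real) \<Rightarrow> bool" where
  "smooth f \<longleftrightarrow> (\<forall>n. Ck n f)"

lemma smooth_has_deriv:
  assumes "smooth f" shows "(f has_real_derivative deriv f x) (at x)"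
proof -
  have "Ck 1 f" using assms by (simp add: smooth_def)
  then obtain g where "\<And>x. (f has_real_derivative g x) (at x)" by auto
  then show ?thesis using DERIV_imp_deriv by metis
qed

lemma smooth_deriv: assumes "smooth f" shows "smooth (deriv f)"
  unfolding smooth_def
proof
  fix n
  have "Ck (Suc n) f" using assms by (simp add: smooth_def)
  then obtain g where g: "\<And>x. (f has_real_derivative g x) (at x)" "Ck n g" by auto
  then have "deriv f = g" using DERIV_imp_deriv by blast
  then show "Ck n (deriv f)" using g by simp
qed

lemma smoothI:
  assumes "\<And>x. (f has_real_derivative g x) (at x)" "smooth g"
  shows "smooth f"
  unfolding smooth_def
proof
  fix n show "Ck n f" using assms by (cases n) (auto simp: smooth_def)
qed

lemma smooth_continuous: "smooth f \<Longrightarrow> continuous_on S f"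
  by (meson DERIV_isCont continuous_at_imp_continuous_on smooth_has_deriv)

lemma smooth_higher_deriv: "smooth f \<Longrightarrow> smooth ((deriv ^^ n) f)"
  by (induction n) (auto simp: smooth_deriv)

lemma Ck_Suc: "Ck (Suc n) f \<Longrightarrow> Ck n f"
proof (induction n arbitrary: f)
  case (Suc n)
  then obtain g where g: "\<forall>x. (f has_real_derivative g x) (at x)" "Ck (Suc n) g"
    unfolding Ck.simps(2)[of "Suc n"] by blast
  with Suc.IH[OF g(2)] show ?case unfolding Ck.simps(2)[of n] by blast
qed simp

lemma Ck_const: "Ck n (\<lambda>x. c)"
proof (induction n arbitrary: c)
  case (Suc n)
  have "\<And>x. ((\<lambda>x. c) has_real_derivative 0) (at x)" by simp
  with Suc[of 0] show ?case unfolding Ck.simps by (intro exI[of _ "\<lambda>x. 0"]) simp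
qed simp

lemma Ck_add: "Ck n f \<Longrightarrow> Ck n g \<Longrightarrow> Ck n (\<lambda>x. f x + g x)"
proof (induction n arbitrary: f g)
  case (Suc n)
  obtain f' where f: "\<And>x. (f has_real_derivative f' x) (at x)" "Ck n f'" using Suc by auto
  obtain g' where g: "\<And>x. (g has_real_derivative g' x) (at x)" "Ck n g'" using Suc by auto
  have "\<And>x. ((\<lambda>x. f x + g x) has_real_derivative f' x + g' x) (at x)"
    by (intro DERIV_add f g)
  with Suc.IH[OF f(2) g(2)] show ?case unfolding Ck.simps
    by (intro exI[of _ "\<lambda>x. f' x + g' x"]) blast
qed simp

lemma Ck_mult: "Ck n f \<Longrightarrow> Ck n g \<Longrightarrow> Ck n (\<lambda>x. f x * g x)"
proof (induction n arbitrary: f g)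
  case (Suc n)
  obtain f' where f: "\<And>x. (f has_real_derivative f' x) (at x)" "Ck n f'" using Suc by auto
  obtain g' where g: "\<And>x. (g has_real_derivative g' x) (at x)" "Ck n g'" using Suc by auto
  have "\<And>x. ((\<lambda>x. f x * g x) has_real_derivative f' x * g x + g' x * f x) (at x)"
    by (intro DERIV_mult f g)
  moreover have "Ck n (\<lambda>x. f' x * g x + g' x * f x)"
    by (rule Ck_add; rule Suc.IH)
      (use f(2) g(2) Ck_Suc[OF Suc.prems(1)] Ck_Suc[OF Suc.prems(2)] in auto)
  ultimately show ?case unfolding Ck.simps
    by (intro exI[of _ "\<lambda>x. f' x * g x + g' x * f x"]) blast
qed simp

lemma Ck_affine: "Ck n f \<Longrightarrow> Ck n (\<lambda>x. f (a * x + b))"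
proof (induction n arbitrary: f)
  case (Suc n)
  obtain f' where f: "\<And>x. (f has_real_derivative f' x) (at x)" "Ck n f'" using Suc by auto
  have "\<And>x. ((\<lambda>x. f (a * x + b)) has_real_derivative f' (a * x + b) * a) (at x)"
    by (rule DERIV_chain2[OF f(1)]) (auto intro!: derivative_eq_intros)
  moreover have "Ck n (\<lambda>x. f' (a * x + b) * a)"
    by (rule Ck_mult[OF Suc.IH[OF f(2)] Ck_const])
  ultimately show ?case unfolding Ck.simps
    by (intro exI[of _ "\<lambda>x. f' (a * x + b) * a"]) blast
qed simp

lemma smooth_const: "smooth (\<lambda>x. c)" by (simp add: smooth_def Ck_const)
lemma smooth_add: "smooth f \<Longrightarrow> smooth g \<Longrightarrow> smooth (\<lambda>x. f x + g x)"
  by (simp add: smooth_def Ck_add)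
lemma smooth_mult: "smooth f \<Longrightarrow> smooth g \<Longrightarrow> smooth (\<lambda>x. f x * g x)"
  by (simp add: smooth_def Ck_mult)
lemma smooth_cmult: "smooth f \<Longrightarrow> smooth (\<lambda>x. c * f x)"
  by (intro smooth_mult smooth_const)
lemma smooth_diff: "smooth f \<Longrightarrow> smooth g \<Longrightarrow> smooth (\<lambda>x. f x - g x)"
  using smooth_add[of f "\<lambda>x. (-1) * g x"] smooth_cmult[of g "-1"] by simp
lemma smooth_sum: "(\<And>i. i \<in> I \<Longrightarrow> smooth (f i)) \<Longrightarrow> smooth (\<lambda>x. \<Sum>i\<in>I. f i x)"
  by (induction I rule: infinite_finite_induct) (auto intro: smooth_const smooth_add)
lemma smooth_affine: "smooth f \<Longrightarrow> smooth (\<lambda>x. f (a * x + b))"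
  by (simp add: smooth_def Ck_affine)
lemma smooth_shift: "smooth f \<Longrightarrow> smooth (\<lambda>x. f (x - b))"
  using smooth_affine[of f 1 "-b"] by simp
lemma smooth_reflect: "smooth f \<Longrightarrow> smooth (\<lambda>x. f (- x))"
  using smooth_affine[of f "-1" 0] by simp

section \<open>Higher derivatives of sums, multiples, reflections and shifts\<close>

lemma higher_deriv_add:
  assumes "smooth f" "smooth g"
  shows "(deriv ^^ n) (\<lambda>x. f x + g x) = (\<lambda>x. (deriv ^^ n) f x + (deriv ^^ n) g x)"
proof (induction n)
  case (Suc n)
  show ?case
    unfolding funpow.simps o_def Suc
    by (rule ext, rule DERIV_imp_deriv)
      (intro DERIV_add smooth_has_deriv smooth_higher_deriv assms)
qed simp

lemma higher_deriv_cmult: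
  assumes "smooth f"
  shows "(deriv ^^ n) (\<lambda>x. c * f x) = (\<lambda>x. c * (deriv ^^ n) f x)"
proof (induction n)
  case (Suc n)
  show ?case
    unfolding funpow.simps o_def Suc
    by (rule ext, rule DERIV_imp_deriv)
      (intro DERIV_cmult smooth_has_deriv smooth_higher_deriv assms)
qed simp

lemma higher_deriv_reflect:
  assumes "smooth f"
  shows "(deriv ^^ n) (\<lambda>x. f (- x)) = (\<lambda>x. (-1) ^ n * (deriv ^^ n) f (- x))"
proof (induction n)
  case (Suc n)
  have "((\<lambda>x. (-1) ^ n * (deriv ^^ n) f (- x)) has_real_derivative
      (-1) ^ n * (deriv ((deriv ^^ n) f) (- x) * (-1))) (at x)" for x
    by (intro DERIV_cmult DERIV_chain2[where f = "(deriv ^^ n) f"]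
         smooth_has_deriv smooth_higher_deriv assms) (auto intro!: derivative_eq_intros)
  then show ?case
    unfolding funpow.simps o_def Suc
    by (intro ext DERIV_imp_deriv) (simp add: algebra_simps)
qed simp

lemma higher_deriv_shift:
  assumes "smooth f"
  shows "(deriv ^^ n) (\<lambda>x. f (x - b)) = (\<lambda>x. (deriv ^^ n) f (x - b))"
proof (induction n)
  case (Suc n)
  have "((\<lambda>x. (deriv ^^ n) f (x - b)) has_real_derivative
      deriv ((deriv ^^ n) f) (x - b) * 1) (at x)" for x
    by (intro DERIV_chain2[where f = "(deriv ^^ n) f"]
         smooth_has_deriv smooth_higher_deriv assms) (auto intro!: derivative_eq_intros)
  then show ?case
    unfolding funpow.simps o_def Suc
    by (intro ext DERIV_imp_deriv) simp
qed simp

text \<open>The complement of a closed set is open, so vanishing there is a local property and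
  survives every differentiation.\<close>

lemma higher_deriv_zero_outside:
  assumes "smooth f" "closed K" "\<And>x. x \<notin> K \<Longrightarrow> f x = 0" "x \<notin> K"
  shows "(deriv ^^ n) f x = 0"
  using assms(4)
proof (induction n arbitrary: x)
  case (Suc n)
  have "((\<lambda>x. 0) has_real_derivative 0) (at x)" by simp
  then have "((deriv ^^ n) f has_real_derivative 0) (at x)"
    by (rule has_field_derivative_transform_within_open[where S = "- K"])
      (use Suc assms(2) in \<open>auto simp: open_Compl\<close>)
  then show ?case by (simp add: DERIV_imp_deriv)
qed (use assms in auto)

section \<open>Mollifiers and repeated primitives\<close>

text \<open>For \<open>p = 1\<close> this is the classical function exp(-1/x), extended by 0.
  Allowing a polynomial in 1/x makes the family closed under differentiation: with y = 1/x the chain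
  rule contributes the factor -y^2, so smoothness is an induction over all \<open>p\<close> at
  once.\<close>

definition flat :: "real poly \<Rightarrow> real \<Rightarrow> real" where
  "flat p x = (if 0 < x then poly p (1 / x) * exp (- (1 / x)) else 0)"

lemma poly_exp_tendsto_0: "((\<lambda>y. poly p y * exp (- y)) \<longlongrightarrow> (0::real)) at_top"
proof -
  have "((\<lambda>y. \<Sum>i\<le>degree p. coeff p i * (y ^ i / exp y)) \<longlongrightarrow> (\<Sum>i\<le>degree p. coeff p i * 0)) at_top"
    by (intro tendsto_sum tendsto_mult tendsto_const tendsto_power_div_exp_0)
  then show ?thesis
    by (simp add: poly_altdef sum_distrib_right exp_minus divide_inverse mult.assoc)
qed

lemma flat_has_deriv:
  "(flat p has_real_derivative flat ([:0, 0, 1:] * (p - pderiv p)) x) (at x)"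
proof (cases "x = 0")
  case False
  show ?thesis
  proof (cases "x > 0")
    case True
    have "((\<lambda>x. poly p (1 / x) * exp (- (1 / x))) has_real_derivative
        flat ([:0, 0, 1:] * (p - pderiv p)) x) (at x)"
      using True unfolding flat_def
      by (auto intro!: derivative_eq_intros DERIV_chain2[where f = "poly p", OF poly_DERIV]
            simp: field_simps power2_eq_square)
    then show ?thesis
      by (rule has_field_derivative_transform_within_open[where S = "{0<..}"])
        (use True in \<open>auto simp: flat_def\<close>)
  next
    case neg: False
    have "((\<lambda>x. 0) has_real_derivative 0) (at x)" by simp
    then have "(flat p has_real_derivative 0) (at x)"
      by (rule has_field_derivative_transform_within_open[where S = "{..<0}"])
        (use neg False in \<open>auto simp: flat_def\<close>)
    then show ?thesis using neg by (simp add: flat_def)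
  qed
next
  case True
  \<comment> \<open>With y = 1/h the difference quotient at 0 is y * p(y) * exp(-y), hence the extra
    factor \<open>[:0, 1:]\<close>.\<close>
  have "((\<lambda>h. poly ([:0, 1:] * p) (inverse h) * exp (- inverse h)) \<longlongrightarrow> 0) (at_right 0)"
    by (rule filterlim_compose[OF poly_exp_tendsto_0 filterlim_inverse_at_top_right])
  then have R: "((\<lambda>h. flat p h / h) \<longlongrightarrow> 0) (at_right 0)"
    by (rule Lim_transform_eventually)
      (auto simp: eventually_at_right_less flat_def field_simps eventually_at intro!: exI[of _ 1])
  have L: "((\<lambda>h. flat p h / h) \<longlongrightarrow> 0) (at_left 0)"
    by (rule Lim_transform_eventually[OF tendsto_const])
      (auto simp: flat_def eventually_at intro!: exI[of _ 1])
  have "((\<lambda>h. flat p h / h) \<longlongrightarrow> 0) (at 0)"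
    using L R filterlim_at_split by blast
  then show ?thesis using True
    by (simp add: DERIV_def flat_def)
qed

lemma smooth_flat: "smooth (flat p)"
proof -
  have "Ck n (flat p)" for n
  proof (induction n arbitrary: p)
    case (Suc n)
    then show ?case unfolding Ck.simps using flat_has_deriv by blast
  qed simp
  then show ?thesis by (simp add: smooth_def)
qed

lemma continuous_compact_integrable:
  fixes f :: "'a::euclidean_space \<Rightarrow> real"
  assumes "continuous_on UNIV f" "compact K" "\<And>x. x \<notin> K \<Longrightarrow> f x = 0"
  shows "integrable lborel f"
proof -
  have "integrable lborel (\<lambda>x. indicator K x *\<^sub>R f x)"
    by (rule borel_integrable_compact[OF assms(2) continuous_on_subset[OF assms(1)]]) simp
  moreover have "(\<lambda>x. indicator K x *\<^sub>R f x) = f"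
    using assms(3) by (auto simp: indicator_def fun_eq_iff)
  ultimately show ?thesis by simp
qed

text \<open>The bridge from Lebesgue integrals over the whole space to gauge integrals over an
  interval, where the fundamental theorem of calculus is applied.\<close>

lemma has_integral_of_compact_support:
  fixes f :: "'a::euclidean_space \<Rightarrow> real"
  assumes "continuous_on UNIV f" "compact K" "\<And>x. x \<notin> K \<Longrightarrow> f x = 0"
  shows "(f has_integral (LINT x|lborel. f x)) K"
proof -
  have "(f has_integral (LINT x|lborel. f x)) UNIV"
    using continuous_compact_integrable[OF assms] by (rule has_integral_integral_lborel)
  moreover have "(\<lambda>x. if x \<in> K then f x else 0) = f" using assms(3) by auto
  ultimately show ?thesis using has_integral_restrict_UNIV[of K f] by simp
qed

section \<open>Bumps and mollifiers\<close>

definition bump :: "real \<Rightarrow> real \<Rightarrow> real" where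
  "bump \<epsilon> x = flat 1 (\<epsilon> + x) * flat 1 (\<epsilon> - x)"

text \<open>For \<open>\<epsilon> \<le> 0\<close> the bump vanishes identically and so does the
  mollifier; only the normalisation to integral 1 asks for \<open>\<epsilon> > 0\<close>.\<close>

definition moll :: "real \<Rightarrow> real \<Rightarrow> real" where
  "moll \<epsilon> x = (1 / (LINT x|lborel. bump \<epsilon> x)) * bump \<epsilon> x"

lemma smooth_bump: "smooth (bump \<epsilon>)"
  unfolding bump_def
  using smooth_mult[OF smooth_affine[OF smooth_flat, of 1 1 \<epsilon>] smooth_affine[OF smooth_flat, of 1 "-1" \<epsilon>]]
  by (simp add: algebra_simps)

lemma smooth_moll: "smooth (moll \<epsilon>)"
  unfolding moll_def by (intro smooth_cmult smooth_bump)

lemma bump_nonneg: "bump \<epsilon> x \<ge> 0" by (simp add: bump_def flat_def)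

lemma bump_pos_iff: "bump \<epsilon> x > 0 \<longleftrightarrow> \<bar>x\<bar> < \<epsilon>"
  by (auto simp: bump_def flat_def)

lemma bump_zero: "\<bar>x\<bar> \<ge> \<epsilon> \<Longrightarrow> bump \<epsilon> x = 0"
  by (auto simp: bump_def flat_def)

lemma bump_integral_pos: assumes "\<epsilon> > 0" shows "(LINT x|lborel. bump \<epsilon> x) > 0"
proof -
  have hi: "(bump \<epsilon> has_integral (LINT x|lborel. bump \<epsilon> x)) (cbox (-\<epsilon>) \<epsilon>)"
    by (rule has_integral_of_compact_support)
      (auto intro!: bump_zero smooth_continuous smooth_bump)
  have "(LINT x|lborel. bump \<epsilon> x) \<noteq> 0"
  proof
    assume "(LINT x|lborel. bump \<epsilon> x) = 0"
    then have "bump \<epsilon> 0 = 0"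
      using has_integral_0_cbox_imp_0[of "-\<epsilon>" \<epsilon> "bump \<epsilon>" 0] hi assms
      by (auto simp: bump_nonneg intro: smooth_continuous smooth_bump)
    then show False using bump_pos_iff[of \<epsilon> 0] assms by simp
  qed
  moreover have "(LINT x|lborel. bump \<epsilon> x) \<ge> 0"
    by (intro integral_nonneg_AE) (auto simp: bump_nonneg)
  ultimately show ?thesis by simp
qed

lemma moll_nonneg: "moll \<epsilon> x \<ge> 0"
  unfolding moll_def by (intro mult_nonneg_nonneg) (auto simp: bump_nonneg intro!: integral_nonneg_AE)

lemma moll_zero: "\<bar>x\<bar> \<ge> \<epsilon> \<Longrightarrow> moll \<epsilon> x = 0"
  by (simp add: moll_def bump_zero)

lemma moll_even: "moll \<epsilon> (- x) = moll \<epsilon> x"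
  by (simp add: moll_def bump_def)

lemma moll_integrable: "integrable lborel (moll \<epsilon>)"
  by (rule continuous_compact_integrable[of _ "cbox (-\<epsilon>) \<epsilon>"])
    (auto intro!: moll_zero smooth_continuous smooth_moll)

lemma moll_integral: "\<epsilon> > 0 \<Longrightarrow> (LINT x|lborel. moll \<epsilon> x) = 1"
  unfolding moll_def using bump_integral_pos[of \<epsilon>] by simp

lemma moll_nn_integral:
  assumes "\<epsilon> > 0" shows "(\<integral>\<^sup>+x. ennreal (moll \<epsilon> (x - z)) \<partial>lborel) = 1"
proof -
  have "(\<integral>\<^sup>+x. ennreal (moll \<epsilon> x) \<partial>lborel) = 1"
    using nn_integral_eq_integral[OF moll_integrable[of \<epsilon>]] moll_integral[OF assms] moll_nonneg
    by simp
  then show ?thesis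
    using nn_integral_real_affine[of "\<lambda>x. ennreal (moll \<epsilon> x)" 1 "-z"]
      borel_measurable_continuous_onI[OF smooth_continuous[OF smooth_moll[of \<epsilon>]]]
    by simp
qed

section \<open>Primitives of functions with vanishing moments\<close>

definition prim :: "real \<Rightarrow> (real \<Rightarrow> real) \<Rightarrow> real \<Rightarrow> real" where
  "prim A \<psi> t = integral {A..t} \<psi>"

lemma prim_has_deriv:
  assumes "continuous_on UNIV \<psi>" "\<And>t. t \<le> A \<Longrightarrow> \<psi> t = 0"
  shows "(prim A \<psi> has_real_derivative \<psi> t) (at t)"
proof -
  have *: "prim A \<psi> s = integral {A - n..s} \<psi>" if "n \<ge> 0" for s n :: real
  proof (cases "s \<ge> A")
    case True
    have "integral {A - n..A} \<psi> = integral {A - n..A} (\<lambda>_. 0)"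
      by (rule integral_cong) (use assms(2) in auto)
    then show ?thesis
      using Henstock_Kurzweil_Integration.integral_combine[of "A - n" A s \<psi>] True that
        integrable_continuous_interval[OF continuous_on_subset[OF assms(1)]]
      by (simp add: prim_def)
  next
    case False
    have "integral {A - n..s} \<psi> = integral {A - n..s} (\<lambda>_. 0)"
      by (rule integral_cong) (use assms(2) False in auto)
    then show ?thesis using False by (simp add: prim_def)
  qed
  \<comment> \<open>Since \<open>\<psi>\<close> vanishes up to \<open>A\<close>, the lower limit may
    be moved to the left of \<open>t\<close>; then \<open>t\<close> is interior and the derivative
    is two-sided.\<close>
  define n where "n = \<bar>A - t\<bar> + 1"
  have eq: "prim A \<psi> = (\<lambda>s. integral {A - n..s} \<psi>)"
    using *[of n] by (auto simp: n_def)
  have "((\<lambda>s. integral {A - n..s} \<psi>) has_real_derivative \<psi> t) (at t within {A - n..t + 1})"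
    by (rule integral_has_real_derivative[OF continuous_on_subset[OF assms(1)]])
      (auto simp: n_def)
  then have "(prim A \<psi> has_real_derivative \<psi> t) (at t within {A - n..t + 1})"
    unfolding eq .
  moreover have "at t within {A - n..t + 1} = at t"
    by (rule at_within_interior) (auto simp: n_def)
  ultimately show ?thesis by simp
qed

lemma prim_support:
  assumes "continuous_on UNIV \<psi>" "\<And>t. t \<notin> {A..B} \<Longrightarrow> \<psi> t = 0"
    "(\<psi> has_integral 0) {A..B}" "t \<notin> {A..B}"
  shows "prim A \<psi> t = 0"
proof (cases "t < A")
  case False
  then have "t > B" "t \<ge> A" using assms(4) by auto
  have "(\<psi> has_integral 0) {A..t}"
    by (rule has_integral_on_superset[OF assms(3)]) (use \<open>t > B\<close> assms(2) in auto)
  then show ?thesis by (simp add: prim_def integral_unique)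
qed (simp add: prim_def)

text \<open>A support condition speaks of \<open>t < A\<close> only. Continuity adds the endpoint,
  as \<open>prim_has_deriv\<close> requires.\<close>

lemma vanishes_at_left_end:
  assumes "continuous_on UNIV (\<psi> :: real \<Rightarrow> real)" "\<And>t. t < A \<Longrightarrow> \<psi> t = 0" "t \<le> A"
  shows "\<psi> t = 0"
proof -
  have "closed {t. \<psi> t = 0}" using assms(1) by (intro closed_Collect_eq) auto
  then have "closure {..<A} \<subseteq> {t. \<psi> t = 0}" using assms(2) by (intro closure_minimal) auto
  then show ?thesis using assms(3) by auto
qed

text \<open>The zeroth moment being 0, the primitive returns to 0 at \<open>B\<close>. Integration
  by parts then has no boundary terms, and \<open>m + 1\<close> times the \<open>m\<close>-th moment
  of the primitive is minus the moment of \<open>\<psi>\<close> of order \<open>m + 1\<close>: one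
  vanishing moment is spent per integration.\<close>

lemma prim_step:
  assumes "smooth \<psi>" "\<And>t. t \<notin> {A..B} \<Longrightarrow> \<psi> t = 0" "A \<le> B"
    "\<And>m. m < Suc n \<Longrightarrow> ((\<lambda>t. t ^ m * \<psi> t) has_integral 0) {A..B}"
  shows "smooth (prim A \<psi>)" "deriv (prim A \<psi>) = \<psi>" "\<And>t. t \<notin> {A..B} \<Longrightarrow> prim A \<psi> t = 0"
    "\<And>m. m < n \<Longrightarrow> ((\<lambda>t. t ^ m * prim A \<psi> t) has_integral 0) {A..B}"
proof -
  note ct = smooth_continuous[OF assms(1)]
  have dv: "(prim A \<psi> has_real_derivative \<psi> t) (at t)" for t
    by (rule prim_has_deriv[OF ct vanishes_at_left_end[OF ct]]) (use assms(2) in auto)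
  show "smooth (prim A \<psi>)" using dv assms(1) by (rule smoothI)
  show "deriv (prim A \<psi>) = \<psi>" using DERIV_imp_deriv[OF dv] by auto
  have I0: "(\<psi> has_integral 0) {A..B}" using assms(4)[of 0] by simp
  then show "prim A \<psi> t = 0" if "t \<notin> {A..B}" for t
    using prim_support[OF ct assms(2) _ that] by blast
  have vA: "prim A \<psi> A = 0" by (simp add: prim_def)
  have vB: "prim A \<psi> B = 0" using I0 by (simp add: prim_def integral_unique)
  show "((\<lambda>t. t ^ m * prim A \<psi> t) has_integral 0) {A..B}" if "m < n" for m
  proof -
    have "((\<lambda>t. real (Suc m) * t ^ m * prim A \<psi> t + \<psi> t * t ^ Suc m) has_integral
        (B ^ Suc m * prim A \<psi> B - A ^ Suc m * prim A \<psi> A)) {A..B}"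
    proof (rule fundamental_theorem_of_calculus[OF assms(3)])
      fix t
      have "((\<lambda>t. t ^ Suc m * prim A \<psi> t) has_real_derivative
          (real (Suc m) * t ^ m * prim A \<psi> t + \<psi> t * t ^ Suc m)) (at t)"
        using DERIV_mult[OF DERIV_pow[of "Suc m" t] dv[of t]] by simp
      then show "((\<lambda>t. t ^ Suc m * prim A \<psi> t) has_vector_derivative
          (real (Suc m) * t ^ m * prim A \<psi> t + \<psi> t * t ^ Suc m)) (at t within {A..B})"
        using has_real_derivative_iff_has_vector_derivative has_vector_derivative_at_within by blast
    qed
    from has_integral_diff[OF this assms(4)[of "Suc m"]] that
    have "((\<lambda>t. real (Suc m) * (t ^ m * prim A \<psi> t)) has_integral 0) {A..B}"
      using vA vB by (simp add: algebra_simps)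
    from has_integral_mult_right[OF this, of "1 / real (Suc m)"]
    show ?thesis by (simp add: field_simps del: of_nat_Suc)
  qed
qed

text \<open>Iterates \<open>prim_step\<close>. Estimating the integrand on \<open>[A, t]\<close> by
  its bound at \<open>t\<close> gives one further power of \<open>t - A\<close> per integration,
  with the same constant.\<close>

lemma repeated_primitive:
  assumes "smooth \<psi>" "\<And>t. t \<notin> {A..B} \<Longrightarrow> \<psi> t = 0" "A \<le> B" "M \<ge> 0"
    "\<And>m. m < n \<Longrightarrow> ((\<lambda>t. t ^ m * \<psi> t) has_integral 0) {A..B}"
    "\<And>t. t \<in> {A..B} \<Longrightarrow> \<bar>\<psi> t\<bar> \<le> M * (t - A) ^ q"
  shows "\<exists>u. smooth u \<and> (\<forall>t. t \<notin> {A..B} \<longrightarrow> u t = 0) \<and> (deriv ^^ n) u = \<psi> \<and>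
    (\<forall>t\<in>{A..B}. \<bar>u t\<bar> \<le> M * (t - A) ^ (q + n))"
  using assms
proof (induction n arbitrary: \<psi> q)
  case (Suc n)
  have v: "smooth (prim A \<psi>)" "deriv (prim A \<psi>) = \<psi>"
    by (rule prim_step[OF Suc.prems(1,2,3,5)]; assumption)+
  have v0: "prim A \<psi> t = 0" if "t \<notin> {A..B}" for t
    by (rule prim_step(3)[OF Suc.prems(1,2,3,5) that])
  have vm: "((\<lambda>t. t ^ m * prim A \<psi> t) has_integral 0) {A..B}" if "m < n" for m
    by (rule prim_step(4)[OF Suc.prems(1,2,3,5) that])
  have bd: "\<bar>prim A \<psi> t\<bar> \<le> M * (t - A) ^ Suc q" if "t \<in> {A..B}" for t
  proof -
    have "norm (integral {A..t} \<psi>) \<le> integral {A..t} (\<lambda>s. M * (t - A) ^ q)"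
    proof (rule integral_norm_bound_integral)
      show "\<psi> integrable_on {A..t}"
        by (intro integrable_continuous_interval smooth_continuous Suc.prems)
      fix s assume s: "s \<in> {A..t}"
      have "M * (s - A) ^ q \<le> M * (t - A) ^ q"
        using s Suc.prems(4) by (intro mult_left_mono power_mono) auto
      then show "norm (\<psi> s) \<le> M * (t - A) ^ q" using Suc.prems(6)[of s] s that by auto
    qed auto
    then show ?thesis using that by (simp add: prim_def mult_ac)
  qed
  obtain u where u: "smooth u" "\<forall>t. t \<notin> {A..B} \<longrightarrow> u t = 0" "(deriv ^^ n) u = prim A \<psi>"
    "\<forall>t\<in>{A..B}. \<bar>u t\<bar> \<le> M * (t - A) ^ (Suc q + n)"
    using Suc.IH[OF v(1) v0 Suc.prems(3,4) vm bd] by blast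
  have "(deriv ^^ Suc n) u = \<psi>" using u(3) v(2) by simp
  then show ?case using u by (intro exI[of _ u]) auto
qed auto

text \<open>Mollified point masses have unbounded maxima but bounded \<open>L1\<close> norms as the
  mollification shrinks. The first integration converts the \<open>L1\<close> bound into a uniform
  one, and the other \<open>n\<close> integrations each gain a power of
  \<open>t - A\<close>.\<close>

lemma repeated_primitive_L1:
  assumes "smooth \<psi>" "\<And>t. t \<notin> {A..B} \<Longrightarrow> \<psi> t = 0" "A \<le> B"
    "\<And>m. m < Suc n \<Longrightarrow> ((\<lambda>t. t ^ m * \<psi> t) has_integral 0) {A..B}"
    "integral {A..B} (\<lambda>t. \<bar>\<psi> t\<bar>) \<le> M"
  shows "\<exists>u. smooth u \<and> (\<forall>t. t \<notin> {A..B} \<longrightarrow> u t = 0) \<and> (deriv ^^ Suc n) u = \<psi> \<and>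
    (\<forall>t\<in>{A..B}. \<bar>u t\<bar> \<le> M * (t - A) ^ n)"
proof -
  have v: "smooth (prim A \<psi>)" "deriv (prim A \<psi>) = \<psi>"
    by (rule prim_step[OF assms(1-4)]; assumption)+
  have v0: "prim A \<psi> t = 0" if "t \<notin> {A..B}" for t
    by (rule prim_step(3)[OF assms(1-4) that])
  have vm: "((\<lambda>t. t ^ m * prim A \<psi> t) has_integral 0) {A..B}" if "m < n" for m
    by (rule prim_step(4)[OF assms(1-4) that])
  have ia: "(\<lambda>t. \<bar>\<psi> t\<bar>) integrable_on {a..b}" for a b
    by (intro integrable_continuous_interval continuous_intros smooth_continuous assms)
  have M: "M \<ge> 0" using integral_nonneg[OF ia[of A B]] assms(5) by simp
  have bd: "\<bar>prim A \<psi> t\<bar> \<le> M * (t - A) ^ 0" if "t \<in> {A..B}" for t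
  proof -
    have "norm (integral {A..t} \<psi>) \<le> integral {A..t} (\<lambda>s. \<bar>\<psi> s\<bar>)"
      by (rule integral_norm_bound_integral)
        (auto intro!: integrable_continuous_interval smooth_continuous assms ia)
    also have "\<dots> \<le> integral {A..B} (\<lambda>s. \<bar>\<psi> s\<bar>)"
      by (rule integral_subset_le) (use that ia in auto)
    finally show ?thesis using assms(5) by (simp add: prim_def)
  qed
  obtain u where u: "smooth u" "\<forall>t. t \<notin> {A..B} \<longrightarrow> u t = 0" "(deriv ^^ n) u = prim A \<psi>"
    "\<forall>t\<in>{A..B}. \<bar>u t\<bar> \<le> M * (t - A) ^ (0 + n)"
    using repeated_primitive[OF v(1) v0 assms(3) M vm bd] by blast
  have "(deriv ^^ Suc n) u = \<psi>" using u(3) v(2) by simp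
  then show ?thesis using u by (intro exI[of _ u]) auto
qed

section \<open>Representable point functionals\<close>

definition cc_smooth :: "real set \<Rightarrow> (real \<Rightarrow> real) \<Rightarrow> bool" where
  "cc_smooth U u \<longleftrightarrow> smooth u \<and> (\<exists>K. compact K \<and> K \<subseteq> U \<and> (\<forall>t. t \<notin> K \<longrightarrow> u t = 0))"

lemma cc_smooth_zero: "cc_smooth U (\<lambda>x. 0)"
  unfolding cc_smooth_def using smooth_const[of 0] by blast

lemma cc_smooth_add: assumes "cc_smooth U u" "cc_smooth U v" shows "cc_smooth U (\<lambda>x. u x + v x)"
proof -
  obtain K L where K: "compact K" "K \<subseteq> U" "\<forall>t. t \<notin> K \<longrightarrow> u t = 0"
    and L: "compact L" "L \<subseteq> U" "\<forall>t. t \<notin> L \<longrightarrow> v t = 0" using assms by (auto simp: cc_smooth_def)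
  then show ?thesis unfolding cc_smooth_def
    using assms by (auto intro!: exI[of _ "K \<union> L"] smooth_add simp: cc_smooth_def)
qed

lemma cc_smooth_cmult: assumes "cc_smooth U u" shows "cc_smooth U (\<lambda>x. c * u x)"
  using assms unfolding cc_smooth_def by (metis mult_zero_right smooth_cmult)

lemma cc_smooth_reflect: assumes "cc_smooth U u" shows "cc_smooth (uminus ` U) (\<lambda>x. u (- x))"
proof -
  obtain K where K: "compact K" "K \<subseteq> U" "\<forall>t. t \<notin> K \<longrightarrow> u t = 0" using assms by (auto simp: cc_smooth_def)
  have "compact (uminus ` K)" using K(1) by (intro compact_continuous_image continuous_intros)
  moreover have "t \<notin> uminus ` K \<Longrightarrow> - t \<notin> K" for t by force
  ultimately show ?thesis unfolding cc_smooth_def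
    using assms K by (intro conjI exI[of _ "uminus ` K"] smooth_reflect) (auto simp: cc_smooth_def)
qed

lemma cc_smooth_mono: "cc_smooth U u \<Longrightarrow> U \<subseteq> V \<Longrightarrow> cc_smooth V u"
  unfolding cc_smooth_def by blast

text \<open>\<open>\<Psi> \<epsilon>\<close> is a combination of mollified point masses. Writing it as a sum of derivatives of test
  functions bounded by \<open>\<kappa>\<close> turns the point functional into an integral of \<open>f, f', \<dots>, f\<^sup>(\<^sup>r\<^sup>)\<close>
  against kernels bounded by \<open>\<kappa>\<close>, a form that also makes sense for weak derivatives.\<close>
definition representable :: "real set \<Rightarrow> nat \<Rightarrow> (real \<Rightarrow> real \<Rightarrow> real) \<Rightarrow> (real \<Rightarrow> real) \<Rightarrow> bool" where
  "representable U r \<Psi> \<kappa> \<longleftrightarrow> (\<exists>\<epsilon>0>0. \<forall>\<epsilon>. 0 < \<epsilon> \<and> \<epsilon> < \<epsilon>0 \<longrightarrow>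
     (\<exists>u. (\<forall>j\<le>r. cc_smooth U (u j) \<and> (\<forall>t. \<bar>u j t\<bar> \<le> \<kappa> t)) \<and>
          (\<forall>t. \<Psi> \<epsilon> t = (\<Sum>j\<le>r. (-1) ^ j * (deriv ^^ j) (u j) t))))"

lemma representable_mono:
  assumes "representable U r \<Psi> \<kappa>" "U \<subseteq> V" "\<And>t. \<kappa> t \<le> \<kappa>' t"
  shows "representable V r \<Psi> \<kappa>'"
  using assms unfolding representable_def by (meson cc_smooth_mono order_trans)

lemma representable_zero: "(\<And>t. \<kappa> t \<ge> 0) \<Longrightarrow> representable U r (\<lambda>\<epsilon> t. 0) \<kappa>"
  unfolding representable_def
  using higher_deriv_cmult[OF smooth_const, of _ 0 0]
  by (intro exI[of _ 1] conjI allI impI exI[of _ "\<lambda>j t. 0"]) (auto simp: cc_smooth_zero)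

lemma representable_add:
  assumes "representable U r \<Psi>1 \<kappa>1" "representable U r \<Psi>2 \<kappa>2"
  shows "representable U r (\<lambda>\<epsilon> t. \<Psi>1 \<epsilon> t + \<Psi>2 \<epsilon> t) (\<lambda>t. \<kappa>1 t + \<kappa>2 t)"
proof -
  obtain e1 where e1: "e1 > 0" "\<And>\<epsilon>. 0 < \<epsilon> \<Longrightarrow> \<epsilon> < e1 \<Longrightarrow>
     (\<exists>u. (\<forall>j\<le>r. cc_smooth U (u j) \<and> (\<forall>t. \<bar>u j t\<bar> \<le> \<kappa>1 t)) \<and>
          (\<forall>t. \<Psi>1 \<epsilon> t = (\<Sum>j\<le>r. (-1) ^ j * (deriv ^^ j) (u j) t)))"
    using assms(1) unfolding representable_def by blast
  obtain e2 where e2: "e2 > 0" "\<And>\<epsilon>. 0 < \<epsilon> \<Longrightarrow> \<epsilon> < e2 \<Longrightarrow>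
     (\<exists>u. (\<forall>j\<le>r. cc_smooth U (u j) \<and> (\<forall>t. \<bar>u j t\<bar> \<le> \<kappa>2 t)) \<and>
          (\<forall>t. \<Psi>2 \<epsilon> t = (\<Sum>j\<le>r. (-1) ^ j * (deriv ^^ j) (u j) t)))"
    using assms(2) unfolding representable_def by blast
  show ?thesis unfolding representable_def
  proof (intro exI[of _ "min e1 e2"] conjI allI impI)
    fix \<epsilon> assume \<epsilon>: "0 < \<epsilon> \<and> \<epsilon> < min e1 e2"
    obtain u where u: "\<And>j. j \<le> r \<Longrightarrow> cc_smooth U (u j)" "\<And>j t. j \<le> r \<Longrightarrow> \<bar>u j t\<bar> \<le> \<kappa>1 t"
      "\<And>t. \<Psi>1 \<epsilon> t = (\<Sum>j\<le>r. (-1) ^ j * (deriv ^^ j) (u j) t)"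
      using e1(2)[of \<epsilon>] \<epsilon> by auto
    obtain v where v: "\<And>j. j \<le> r \<Longrightarrow> cc_smooth U (v j)" "\<And>j t. j \<le> r \<Longrightarrow> \<bar>v j t\<bar> \<le> \<kappa>2 t"
      "\<And>t. \<Psi>2 \<epsilon> t = (\<Sum>j\<le>r. (-1) ^ j * (deriv ^^ j) (v j) t)"
      using e2(2)[of \<epsilon>] \<epsilon> by auto
    have "(deriv ^^ j) (\<lambda>x. u j x + v j x) t = (deriv ^^ j) (u j) t + (deriv ^^ j) (v j) t"
      if "j \<le> r" for j t
      using higher_deriv_add[of "u j" "v j" j] u(1)[OF that] v(1)[OF that] by (simp add: cc_smooth_def)
    then have "\<Psi>1 \<epsilon> t + \<Psi>2 \<epsilon> t = (\<Sum>j\<le>r. (-1) ^ j * (deriv ^^ j) (\<lambda>x. u j x + v j x) t)" for t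
      unfolding u(3) v(3) sum.distrib[symmetric] by (intro sum.cong) (auto simp: algebra_simps)
    moreover have "\<bar>u j t + v j t\<bar> \<le> \<kappa>1 t + \<kappa>2 t" if "j \<le> r" for j t
      using u(2)[OF that, of t] v(2)[OF that, of t] by linarith
    ultimately show "\<exists>w. (\<forall>j\<le>r. cc_smooth U (w j) \<and> (\<forall>t. \<bar>w j t\<bar> \<le> \<kappa>1 t + \<kappa>2 t)) \<and>
          (\<forall>t. \<Psi>1 \<epsilon> t + \<Psi>2 \<epsilon> t = (\<Sum>j\<le>r. (-1) ^ j * (deriv ^^ j) (w j) t))"
      using u(1) v(1) by (intro exI[of _ "\<lambda>j x. u j x + v j x"]) (auto intro: cc_smooth_add)
  qed (use e1 e2 in auto)
qed

lemma representable_cmult: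
  assumes "representable U r \<Psi> \<kappa>"
  shows "representable U r (\<lambda>\<epsilon> t. c * \<Psi> \<epsilon> t) (\<lambda>t. \<bar>c\<bar> * \<kappa> t)"
proof -
  obtain e where e: "e > 0" "\<And>\<epsilon>. 0 < \<epsilon> \<Longrightarrow> \<epsilon> < e \<Longrightarrow>
     (\<exists>u. (\<forall>j\<le>r. cc_smooth U (u j) \<and> (\<forall>t. \<bar>u j t\<bar> \<le> \<kappa> t)) \<and>
          (\<forall>t. \<Psi> \<epsilon> t = (\<Sum>j\<le>r. (-1) ^ j * (deriv ^^ j) (u j) t)))"
    using assms(1) unfolding representable_def by blast
  show ?thesis unfolding representable_def
  proof (intro exI[of _ e] conjI allI impI)
    fix \<epsilon> assume \<epsilon>: "0 < \<epsilon> \<and> \<epsilon> < e"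
    obtain u where u: "\<And>j. j \<le> r \<Longrightarrow> cc_smooth U (u j)" "\<And>j t. j \<le> r \<Longrightarrow> \<bar>u j t\<bar> \<le> \<kappa> t"
      "\<And>t. \<Psi> \<epsilon> t = (\<Sum>j\<le>r. (-1) ^ j * (deriv ^^ j) (u j) t)"
      using e(2)[of \<epsilon>] \<epsilon> by auto
    have "(deriv ^^ j) (\<lambda>x. c * u j x) t = c * (deriv ^^ j) (u j) t" if "j \<le> r" for j t
      using higher_deriv_cmult[of "u j" j c] u(1)[OF that] by (simp add: cc_smooth_def)
    then have "c * \<Psi> \<epsilon> t = (\<Sum>j\<le>r. (-1) ^ j * (deriv ^^ j) (\<lambda>x. c * u j x) t)" for t
      unfolding u(3) sum_distrib_left by (intro sum.cong) (auto simp: algebra_simps)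
    moreover have "\<bar>c * u j t\<bar> \<le> \<bar>c\<bar> * \<kappa> t" if "j \<le> r" for j t
      unfolding abs_mult by (intro mult_left_mono u that) auto
    ultimately show "\<exists>w. (\<forall>j\<le>r. cc_smooth U (w j) \<and> (\<forall>t. \<bar>w j t\<bar> \<le> \<bar>c\<bar> * \<kappa> t)) \<and>
          (\<forall>t. c * \<Psi> \<epsilon> t = (\<Sum>j\<le>r. (-1) ^ j * (deriv ^^ j) (w j) t))"
      using u(1) by (intro exI[of _ "\<lambda>j x. c * u j x"]) (auto intro: cc_smooth_cmult)
  qed (use e in auto)
qed

lemma representable_diff:
  assumes "representable U r \<Psi>1 \<kappa>1" "representable U r \<Psi>2 \<kappa>2"
  shows "representable U r (\<lambda>\<epsilon> t. \<Psi>1 \<epsilon> t - \<Psi>2 \<epsilon> t) (\<lambda>t. \<kappa>1 t + \<kappa>2 t)"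
  using representable_add[OF assms(1) representable_cmult[OF assms(2), of "-1"]] by simp

lemma representable_sum:
  assumes "\<And>i. i \<in> I \<Longrightarrow> representable U r (\<Psi> i) (\<kappa> i)"
  shows "representable U r (\<lambda>\<epsilon> t. \<Sum>i\<in>I. \<Psi> i \<epsilon> t) (\<lambda>t. \<Sum>i\<in>I. \<kappa> i t)"
  using assms
  by (induction I rule: infinite_finite_induct) (auto intro: representable_zero representable_add)

lemma representable_reflect:
  assumes "representable U r \<Psi> \<kappa>"
  shows "representable (uminus ` U) r (\<lambda>\<epsilon> t. \<Psi> \<epsilon> (- t)) (\<lambda>t. \<kappa> (- t))"
proof -
  obtain e where e: "e > 0" "\<And>\<epsilon>. 0 < \<epsilon> \<Longrightarrow> \<epsilon> < e \<Longrightarrow>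
     (\<exists>u. (\<forall>j\<le>r. cc_smooth U (u j) \<and> (\<forall>t. \<bar>u j t\<bar> \<le> \<kappa> t)) \<and>
          (\<forall>t. \<Psi> \<epsilon> t = (\<Sum>j\<le>r. (-1) ^ j * (deriv ^^ j) (u j) t)))"
    using assms(1) unfolding representable_def by blast
  show ?thesis unfolding representable_def
  proof (intro exI[of _ e] conjI allI impI)
    fix \<epsilon> assume \<epsilon>: "0 < \<epsilon> \<and> \<epsilon> < e"
    obtain u where u: "\<And>j. j \<le> r \<Longrightarrow> cc_smooth U (u j)" "\<And>j t. j \<le> r \<Longrightarrow> \<bar>u j t\<bar> \<le> \<kappa> t"
      "\<And>t. \<Psi> \<epsilon> t = (\<Sum>j\<le>r. (-1) ^ j * (deriv ^^ j) (u j) t)"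
      using e(2)[of \<epsilon>] \<epsilon> by auto
    \<comment> \<open>The sign compensates the one that \<open>j\<close> differentiations of a
      reflected function produce.\<close>
    define v where "v j = (\<lambda>x. (-1) ^ j * u j (- x))" for j
    have "(deriv ^^ j) (v j) t = (deriv ^^ j) (u j) (- t)" if "j \<le> r" for j t
    proof -
      have s: "smooth (u j)" using u(1)[OF that] by (simp add: cc_smooth_def)
      show ?thesis
        unfolding v_def higher_deriv_cmult[OF smooth_reflect[OF s]] higher_deriv_reflect[OF s]
        by (simp flip: mult.assoc power_mult_distrib)
    qed
    then have "\<Psi> \<epsilon> (- t) = (\<Sum>j\<le>r. (-1) ^ j * (deriv ^^ j) (v j) t)" for t
      unfolding u(3) by (intro sum.cong) auto
    moreover have "\<bar>v j t\<bar> \<le> \<kappa> (- t)" if "j \<le> r" for j t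
      using u(2)[OF that] by (simp add: v_def abs_mult power_abs)
    moreover have "cc_smooth (uminus ` U) (v j)" if "j \<le> r" for j
      unfolding v_def using u(1)[OF that] by (intro cc_smooth_cmult cc_smooth_reflect)
    ultimately show "\<exists>w. (\<forall>j\<le>r. cc_smooth (uminus ` U) (w j) \<and> (\<forall>t. \<bar>w j t\<bar> \<le> \<kappa> (- t))) \<and>
          (\<forall>t. \<Psi> \<epsilon> (- t) = (\<Sum>j\<le>r. (-1) ^ j * (deriv ^^ j) (w j) t))"
      by (intro exI[of _ v]) auto
  qed (use e in auto)
qed

section \<open>Functionals that annihilate polynomials\<close>

lemma moll_moment:
  assumes "A \<le> z - \<epsilon>" "z + \<epsilon> \<le> B"
  shows "((\<lambda>t. t ^ m * moll \<epsilon> (t - z)) has_integral (LINT s|lborel. (s + z) ^ m * moll \<epsilon> s)) {A..B}"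
proof -
  have "((\<lambda>t. t ^ m * moll \<epsilon> (t - z)) has_integral (LINT t|lborel. t ^ m * moll \<epsilon> (t - z))) {A..B}"
    by (rule has_integral_of_compact_support)
      (use assms in \<open>auto intro!: continuous_intros smooth_continuous[OF smooth_shift[OF smooth_moll]] moll_zero\<close>)
  also have "(LINT t|lborel. t ^ m * moll \<epsilon> (t - z)) = (LINT s|lborel. (s + z) ^ m * moll \<epsilon> s)"
    using lborel_integral_real_affine[of 1 "\<lambda>t. t ^ m * moll \<epsilon> (t - z)" z] by (simp add: add.commute)
  finally show ?thesis .
qed

lemma moll_pow_integrable: "integrable lborel (\<lambda>s. (s + z) ^ m * moll \<epsilon> s)"
  by (rule continuous_compact_integrable[of _ "cbox (-\<epsilon>) \<epsilon>"])
    (auto intro!: moll_zero smooth_continuous[OF smooth_moll] continuous_intros)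

text \<open>Peano's kernel theorem: a combination of point masses that annihilates polynomials of
  degree below \<open>r\<close> is an \<open>r\<close>-fold derivative of a function supported near
  the points. The moments are required for all shifts \<open>s\<close> because a moment of the
  mollified masses averages the shifted ones. The margin \<open>\<eta>\<close> contains every
  admissible mollification, which makes the bound independent of it.\<close>

lemma representable_local:
  fixes \<mu> z :: "'j \<Rightarrow> real"
  assumes "finite J" "r \<ge> 1" "0 < \<eta>" "\<eta> < a" "a \<le> b"
    and z: "\<And>j. j \<in> J \<Longrightarrow> z j \<in> {a..b}"
    and mom: "\<And>m s. m < r \<Longrightarrow> (\<Sum>j\<in>J. \<mu> j * (s + z j) ^ m) = 0"
    and M: "(\<Sum>j\<in>J. \<bar>\<mu> j\<bar>) \<le> M"
  shows "representable {0<..} r (\<lambda>\<epsilon> t. \<Sum>j\<in>J. \<mu> j * moll \<epsilon> (t - z j))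
    (\<lambda>t. M * (t - (a - \<eta>)) ^ (r - 1) * indicator {a - \<eta>..b + \<eta>} t)"
  unfolding representable_def
proof (intro exI[of _ \<eta>] conjI allI impI)
  fix \<epsilon> assume "0 < \<epsilon> \<and> \<epsilon> < \<eta>"
  then have \<epsilon>: "0 < \<epsilon>" "\<epsilon> < \<eta>" by auto
  define \<psi> where "\<psi> t = (\<Sum>j\<in>J. \<mu> j * moll \<epsilon> (t - z j))" for t
  obtain n where n: "r = Suc n" using \<open>r \<ge> 1\<close> by (cases r) auto
  have M0: "M \<ge> 0" using M by (meson abs_ge_zero order_trans sum_nonneg)
  have s: "smooth \<psi>" unfolding \<psi>_def by (intro smooth_sum smooth_cmult smooth_shift smooth_moll)
  have sup: "\<psi> t = 0" if "t \<notin> {a - \<epsilon>..b + \<epsilon>}" for t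
    unfolding \<psi>_def
  proof (rule sum.neutral, rule ballI)
    fix j assume "j \<in> J"
    then have "\<bar>t - z j\<bar> \<ge> \<epsilon>" using z[of j] that by auto
    then show "\<mu> j * moll \<epsilon> (t - z j) = 0" by (simp add: moll_zero)
  qed
  have mz: "((\<lambda>t. t ^ m * \<psi> t) has_integral 0) {a - \<epsilon>..b + \<epsilon>}" if "m < Suc n" for m
  proof -
    have "((\<lambda>t. \<Sum>j\<in>J. \<mu> j * (t ^ m * moll \<epsilon> (t - z j))) has_integral
        (\<Sum>j\<in>J. \<mu> j * (LINT s|lborel. (s + z j) ^ m * moll \<epsilon> s))) {a - \<epsilon>..b + \<epsilon>}"
      by (intro has_integral_sum assms(1) has_integral_mult_right moll_moment) (use z in force)+
    also have "(\<Sum>j\<in>J. \<mu> j * (LINT s|lborel. (s + z j) ^ m * moll \<epsilon> s))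
       = (LINT s|lborel. (\<Sum>j\<in>J. \<mu> j * ((s + z j) ^ m * moll \<epsilon> s)))"
      by (simp add: Bochner_Integration.integral_sum moll_pow_integrable)
    also have "(\<lambda>s. \<Sum>j\<in>J. \<mu> j * ((s + z j) ^ m * moll \<epsilon> s)) =
        (\<lambda>s. (\<Sum>j\<in>J. \<mu> j * (s + z j) ^ m) * moll \<epsilon> s)"
      by (simp add: sum_distrib_right mult.assoc)
    also have "\<dots> = (\<lambda>s. 0)" using mom that n by simp
    finally show ?thesis by (simp add: \<psi>_def sum_distrib_left mult_ac)
  qed
  have L1: "integral {a - \<epsilon>..b + \<epsilon>} (\<lambda>t. \<bar>\<psi> t\<bar>) \<le> M"
  proof -
    have h: "((\<lambda>t. moll \<epsilon> (t - z j)) has_integral 1) {a - \<epsilon>..b + \<epsilon>}" if "j \<in> J" for j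
      using moll_moment[of "a - \<epsilon>" "z j" \<epsilon> "b + \<epsilon>" 0] z[OF that] moll_integral[OF \<epsilon>(1)] by simp
    have "((\<lambda>t. \<Sum>j\<in>J. \<bar>\<mu> j\<bar> * moll \<epsilon> (t - z j)) has_integral (\<Sum>j\<in>J. \<bar>\<mu> j\<bar> * 1)) {a - \<epsilon>..b + \<epsilon>}"
      by (intro has_integral_sum assms(1) has_integral_mult_right h)
    then have i: "(\<lambda>t. \<Sum>j\<in>J. \<bar>\<mu> j\<bar> * moll \<epsilon> (t - z j)) integrable_on {a - \<epsilon>..b + \<epsilon>}"
      "integral {a - \<epsilon>..b + \<epsilon>} (\<lambda>t. \<Sum>j\<in>J. \<bar>\<mu> j\<bar> * moll \<epsilon> (t - z j)) = (\<Sum>j\<in>J. \<bar>\<mu> j\<bar>)"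
      by (auto simp: integral_unique)
    have "integral {a - \<epsilon>..b + \<epsilon>} (\<lambda>t. \<bar>\<psi> t\<bar>) \<le>
        integral {a - \<epsilon>..b + \<epsilon>} (\<lambda>t. \<Sum>j\<in>J. \<bar>\<mu> j\<bar> * moll \<epsilon> (t - z j))"
    proof (rule integral_le[OF _ i(1)])
      show "(\<lambda>t. \<bar>\<psi> t\<bar>) integrable_on {a - \<epsilon>..b + \<epsilon>}"
        by (intro integrable_continuous_interval continuous_intros smooth_continuous s)
      show "\<bar>\<psi> t\<bar> \<le> (\<Sum>j\<in>J. \<bar>\<mu> j\<bar> * moll \<epsilon> (t - z j))" for t
        unfolding \<psi>_def by (rule order_trans[OF sum_abs]) (simp add: abs_mult moll_nonneg)
    qed
    then show ?thesis using i(2) M by simp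
  qed
  obtain u where u: "smooth u" "\<forall>t. t \<notin> {a - \<epsilon>..b + \<epsilon>} \<longrightarrow> u t = 0" "(deriv ^^ Suc n) u = \<psi>"
    "\<forall>t\<in>{a - \<epsilon>..b + \<epsilon>}. \<bar>u t\<bar> \<le> M * (t - (a - \<epsilon>)) ^ n"
    using repeated_primitive_L1[OF s sup _ mz L1] \<epsilon> assms(5) by auto
  \<comment> \<open>Only the component of order \<open>r\<close> is used; its sign cancels the one
    in \<open>representable\<close>.\<close>
  define v where "v j = (if j = r then (\<lambda>t. (-1) ^ r * u t) else (\<lambda>t. 0))" for j
  have "cc_smooth {0<..} u" unfolding cc_smooth_def
    using u(1,2) \<epsilon> assms(3-5) by (intro conjI exI[of _ "{a - \<epsilon>..b + \<epsilon>}"]) auto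
  then have c: "cc_smooth {0<..} (v j)" for j by (auto simp: v_def intro: cc_smooth_cmult cc_smooth_zero)
  have ub: "\<bar>u t\<bar> \<le> M * (t - (a - \<eta>)) ^ (r - 1) * indicator {a - \<eta>..b + \<eta>} t" for t
  proof (cases "t \<in> {a - \<epsilon>..b + \<epsilon>}")
    case True
    then have "M * (t - (a - \<epsilon>)) ^ n \<le> M * (t - (a - \<eta>)) ^ n"
      using \<epsilon> M0 by (intro mult_left_mono power_mono) auto
    then show ?thesis using True u(4) \<epsilon> n by (force simp: indicator_def)
  next
    case False
    then show ?thesis using u(2) M0 by (auto simp: indicator_def)
  qed
  have d: "(-1) ^ j * (deriv ^^ j) (v j) t = (if j = r then \<psi> t else 0)" for j t
  proof (cases "j = r")
    case True
    then show ?thesis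
      using higher_deriv_cmult[OF u(1), of r "(-1) ^ r"] u(3) n
      by (simp add: v_def del: funpow.simps flip: mult.assoc power_mult_distrib)
  qed (use higher_deriv_cmult[OF smooth_const, of _ 0 0] in \<open>auto simp: v_def\<close>)
  show "\<exists>u. (\<forall>j\<le>r. cc_smooth {0<..} (u j) \<and>
          (\<forall>t. \<bar>u j t\<bar> \<le> M * (t - (a - \<eta>)) ^ (r - 1) * indicator {a - \<eta>..b + \<eta>} t)) \<and>
      (\<forall>t. (\<Sum>j\<in>J. \<mu> j * moll \<epsilon> (t - z j)) = (\<Sum>j\<le>r. (-1) ^ j * (deriv ^^ j) (u j) t))"
  proof (intro exI[of _ v] conjI allI impI)
    show "\<bar>v j t\<bar> \<le> M * (t - (a - \<eta>)) ^ (r - 1) * indicator {a - \<eta>..b + \<eta>} t" for j t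
      using ub[of t] by (auto simp: v_def abs_mult power_abs)
    show "(\<Sum>j\<in>J. \<mu> j * moll \<epsilon> (t - z j)) = (\<Sum>j\<le>r. (-1) ^ j * (deriv ^^ j) (v j) t)" for t
      unfolding d by (simp add: \<psi>_def)
  qed (rule c)
qed (use assms in auto)

text \<open>A point value is the integral of \<open>f\<close> against a fixed bump minus an integral of \<open>f'\<close>.\<close>
lemma representable_point:
  assumes "r \<ge> 1"
  shows "\<exists>K>0. \<forall>z>0. representable {0<..} r (\<lambda>\<epsilon> t. moll \<epsilon> (t - z))
    (\<lambda>t. K * indicator {t. z \<le> 2 * t \<and> \<bar>z - t\<bar> \<le> 1} t)"
proof -
  obtain B where B: "\<And>x. \<bar>moll (1/2) x\<bar> \<le> B"
  proof -
    have "bounded (moll (1/2) ` {-(1/2)..1/2})"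
      by (intro compact_imp_bounded compact_continuous_image smooth_continuous smooth_moll) auto
    then obtain B where "\<And>x. x \<in> {-(1/2)..1/2} \<Longrightarrow> \<bar>moll (1/2) x\<bar> \<le> B"
      unfolding bounded_iff by (metis imageI real_norm_def)
    moreover have "\<bar>moll (1/2) x\<bar> \<le> \<bar>B\<bar>" if "x \<notin> {-(1/2)..1/2}" for x
      using moll_zero[of "1/2" x] that by auto
    ultimately show ?thesis using that[of "\<bar>B\<bar>"] by (meson abs_ge_self order_trans)
  qed
  \<comment> \<open>\<open>B\<close> bounds the averaging bump, and 2, the total mass of two unit
    masses, bounds the primitive of their difference.\<close>
  define K where "K = max B 2"
  have "representable {0<..} r (\<lambda>\<epsilon> t. moll \<epsilon> (t - z)) (\<lambda>t. K * indicator {t. z \<le> 2 * t \<and> \<bar>z - t\<bar> \<le> 1} t)"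
    if z: "z > 0" for z
    unfolding representable_def
  proof (intro exI[of _ "min (z/2) 1"] conjI allI impI)
    fix \<epsilon> assume "0 < \<epsilon> \<and> \<epsilon> < min (z/2) 1"
    then have \<epsilon>: "0 < \<epsilon>" "\<epsilon> < z/2" "\<epsilon> < 1" by auto
    \<comment> \<open>The averaging bump is placed to the right of \<open>z\<close>, so that it
      cannot leave the half line.\<close>
    define g where "g = (\<lambda>t. moll (1/2) (t - (z + 1/2)))"
    define \<psi> where "\<psi> t = g t - moll \<epsilon> (t - z)" for t
    have sg: "smooth g" unfolding g_def by (intro smooth_shift smooth_moll)
    have s: "smooth \<psi>" unfolding \<psi>_def by (intro smooth_diff sg smooth_shift smooth_moll)
    have g0: "g t = 0" if "t \<notin> {z..z+1}" for t
      unfolding g_def by (rule moll_zero) (use that in auto)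
    have p0: "\<psi> t = 0" if "t \<notin> {z - \<epsilon>..z + 1}" for t
    proof -
      have "moll \<epsilon> (t - z) = 0" by (rule moll_zero) (use that \<epsilon> in auto)
      then show ?thesis using g0[of t] that \<epsilon> by (auto simp: \<psi>_def)
    qed
    have ig: "(g has_integral 1) {z - \<epsilon>..z + 1}"
      using moll_moment[of "z - \<epsilon>" "z + 1/2" "1/2" "z + 1" 0] \<epsilon> moll_integral[of "1/2"]
      by (simp add: g_def)
    have im: "((\<lambda>t. moll \<epsilon> (t - z)) has_integral 1) {z - \<epsilon>..z + 1}"
      using moll_moment[of "z - \<epsilon>" "z" \<epsilon> "z + 1" 0] \<epsilon> moll_integral[OF \<epsilon>(1)] by simp
    have mz: "((\<lambda>t. t ^ m * \<psi> t) has_integral 0) {z - \<epsilon>..z + 1}" if "m < Suc 0" for m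
      using that has_integral_diff[OF ig im] by (simp add: \<psi>_def)
    have L1: "integral {z - \<epsilon>..z + 1} (\<lambda>t. \<bar>\<psi> t\<bar>) \<le> 2"
    proof -
      note ia = has_integral_add[OF ig im]
      have "integral {z - \<epsilon>..z + 1} (\<lambda>t. \<bar>\<psi> t\<bar>) \<le> integral {z - \<epsilon>..z + 1} (\<lambda>t. g t + moll \<epsilon> (t - z))"
      proof (rule integral_le)
        show "(\<lambda>t. \<bar>\<psi> t\<bar>) integrable_on {z - \<epsilon>..z + 1}"
          by (intro integrable_continuous_interval continuous_intros smooth_continuous s)
        show "\<bar>\<psi> t\<bar> \<le> g t + moll \<epsilon> (t - z)" for t
          using moll_nonneg[of \<epsilon> "t - z"] moll_nonneg[of "1/2" "t - (z + 1/2)"]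
          by (auto simp: \<psi>_def g_def)
      qed (use ia in auto)
      then show ?thesis using integral_unique[OF ia] by simp
    qed
    obtain u where u: "smooth u" "\<forall>t. t \<notin> {z - \<epsilon>..z + 1} \<longrightarrow> u t = 0" "(deriv ^^ Suc 0) u = \<psi>"
      "\<forall>t\<in>{z - \<epsilon>..z + 1}. \<bar>u t\<bar> \<le> 2 * (t - (z - \<epsilon>)) ^ 0"
      using repeated_primitive_L1[of \<psi> "z - \<epsilon>" "z + 1" 0 2, OF s p0 _ mz L1] \<epsilon> by auto
    define v where "v j = (if j = 0 then g else if j = 1 then u else (\<lambda>t. 0))" for j :: nat
    have "cc_smooth {0<..} u" unfolding cc_smooth_def
      using u(1,2) \<epsilon> by (intro conjI exI[of _ "{z - \<epsilon>..z + 1}"]) auto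
    moreover have "cc_smooth {0<..} g" unfolding cc_smooth_def
      using g0 sg z by (intro conjI exI[of _ "{z..z + 1}"]) auto
    ultimately have c: "cc_smooth {0<..} (v j)" for j by (auto simp: v_def intro: cc_smooth_zero)
    have vb: "\<bar>v j t\<bar> \<le> K * indicator {t. z \<le> 2 * t \<and> \<bar>z - t\<bar> \<le> 1} t" for j t
    proof (cases "t \<in> {z - \<epsilon>..z + 1}")
      case True
      then have "indicator {t. z \<le> 2 * t \<and> \<bar>z - t\<bar> \<le> 1} t = (1::real)" using \<epsilon> by (auto simp: indicator_def)
      moreover have "\<bar>v j t\<bar> \<le> K"
        using B[of "t - (z + 1/2)"] bspec[OF u(4) True] True by (auto simp: v_def K_def g_def)
      ultimately show ?thesis by simp
    next
      case False
      then show ?thesis using u(2) g0[of t] \<epsilon> by (auto simp: v_def K_def)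
    qed
    have d: "(-1) ^ j * (deriv ^^ j) (v j) t = (if j = 0 then g t else 0) + (if j = 1 then - \<psi> t else 0)" for j t
      using u(3) higher_deriv_cmult[OF smooth_const, of j 0 0] by (auto simp: v_def)
    show "\<exists>u. (\<forall>j\<le>r. cc_smooth {0<..} (u j) \<and>
            (\<forall>t. \<bar>u j t\<bar> \<le> K * indicator {t. z \<le> 2 * t \<and> \<bar>z - t\<bar> \<le> 1} t)) \<and>
        (\<forall>t. moll \<epsilon> (t - z) = (\<Sum>j\<le>r. (-1) ^ j * (deriv ^^ j) (u j) t))"
      by (intro exI[of _ v] conjI allI impI c vb, unfold d sum.distrib)
        (use assms in \<open>simp add: \<psi>_def\<close>)
  qed (use z in auto)
  then show ?thesis by (intro exI[of _ K]) (auto simp: K_def)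
qed

section \<open>Piecewise Lagrange interpolation\<close>

text \<open>The nodes 1/r, ..., 1 leave out 0: the first cell begins at the boundary point 0, which
  does not belong to \<open>{0<..}\<close>.\<close>

definition lag_node :: "nat \<Rightarrow> nat \<Rightarrow> real" where
  "lag_node r j = (real j + 1) / real r"

definition lag :: "nat \<Rightarrow> nat \<Rightarrow> real \<Rightarrow> real" where
  "lag r j s = (\<Prod>i\<in>{..<r} - {j}. (s - lag_node r i) / (lag_node r j - lag_node r i))"

lemma lag_node_eq_iff: "r \<ge> 1 \<Longrightarrow> lag_node r i = lag_node r j \<longleftrightarrow> i = j"
  by (simp add: lag_node_def)

lemma lag_node_bounds: "j < r \<Longrightarrow> 1 / real r \<le> lag_node r j \<and> lag_node r j \<le> 1"
  by (simp add: lag_node_def field_simps)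

lemma lag_at_node:
  assumes "i < r" "j < r" shows "lag r j (lag_node r i) = (if i = j then 1 else 0)"
proof (cases "i = j")
  case True
  have "lag r j (lag_node r j) = (\<Prod>i\<in>{..<r} - {j}. 1)"
    unfolding lag_def by (rule prod.cong) (use lag_node_eq_iff assms in auto)
  then show ?thesis using True by simp
next
  case False
  then show ?thesis using assms unfolding lag_def by (auto intro!: prod_zero)
qed

lemma lag_eq_poly: "\<exists>p. degree p \<le> r - 1 \<and> (\<forall>s. poly p s = lag r j s)" if "j < r"
proof (intro exI conjI allI)
  let ?p = "\<Prod>i\<in>{..<r} - {j}. smult (1 / (lag_node r j - lag_node r i)) [:- lag_node r i, 1:]"
  have "degree ?p \<le> sum (\<lambda>i. 1) ({..<r} - {j})"
  proof (rule order_trans[OF degree_prod_sum_le sum_mono])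
    fix i show "(degree \<circ> (\<lambda>i. smult (1 / (lag_node r j - lag_node r i)) [:- lag_node r i, 1:])) i \<le> 1"
      unfolding o_def by (rule order_trans[OF degree_smult_le]) simp
  qed auto
  then show "degree ?p \<le> r - 1" using that by simp
  show "poly ?p s = lag r j s" for s
    unfolding lag_def poly_prod by (rule prod.cong) (auto simp: diff_divide_distrib)
qed

text \<open>The difference of the two sides is a polynomial in \<open>s\<close> of degree below
  \<open>r\<close> that has the \<open>r\<close> distinct nodes as roots.\<close>

lemma lagrange_interpolation:
  fixes p :: "real poly"
  assumes "degree p < r"
  shows "(\<Sum>j<r. lag r j s * poly p (lag_node r j)) = poly p s"
proof -
  obtain L where L: "\<And>j. j < r \<Longrightarrow> degree (L j) \<le> r - 1" "\<And>j s. j < r \<Longrightarrow> poly (L j) s = lag r j s"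
  proof -
    have "\<forall>j. \<exists>p. j < r \<longrightarrow> degree p \<le> r - 1 \<and> (\<forall>s. poly p s = lag r j s)"
      using lag_eq_poly by blast
    from choice[OF this] show ?thesis using that by blast
  qed
  define q where "q = (\<Sum>j<r. smult (poly p (lag_node r j)) (L j)) - p"
  have "degree (\<Sum>j<r. smult (poly p (lag_node r j)) (L j)) \<le> r - 1"
    by (intro degree_sum_le) (use L(1) in \<open>auto intro: order_trans[OF degree_smult_le]\<close>)
  then have dq: "degree q < r" using assms unfolding q_def
    by (intro degree_diff_less) auto
  have "poly q (lag_node r i) = 0" if "i < r" for i
  proof -
    have "poly q (lag_node r i) = (\<Sum>j<r. poly p (lag_node r j) * (if i = j then 1 else 0)) - poly p (lag_node r i)"
      using L(2) that by (simp add: q_def poly_sum lag_at_node)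
    then show ?thesis using that by (simp add: if_distrib cong: if_cong)
  qed
  then have sub: "lag_node r ` {..<r} \<subseteq> {x. poly q x = 0}" by auto
  have "q = 0"
  proof (rule ccontr)
    assume "q \<noteq> 0"
    have "card (lag_node r ` {..<r}) = r"
      using assms lag_node_eq_iff[of r] by (subst card_image) (auto simp: inj_on_def)
    moreover have "card (lag_node r ` {..<r}) \<le> card {x. poly q x = 0}"
      by (intro card_mono poly_roots_finite sub \<open>q \<noteq> 0\<close>)
    moreover have "card {x. poly q x = 0} \<le> degree q" by (rule card_poly_roots_bound[OF \<open>q \<noteq> 0\<close>])
    ultimately show False using dq by simp
  qed
  then have "poly q s = 0" by simp
  then show ?thesis using L(2) by (simp add: q_def poly_sum mult.commute)
qed

lemma lag_moment:
  assumes "m < r"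
  shows "(\<Sum>j<r. lag r j s * (a + h * lag_node r j) ^ m) = (a + h * s) ^ m"
proof -
  have "degree ([:a, h:] ^ m) \<le> degree [:a, h:] * m" by (rule degree_power_le)
  also have "\<dots> \<le> m" by simp
  finally have "degree ([:a, h:] ^ m) < r" using assms by linarith
  from lagrange_interpolation[OF this, of s] show ?thesis
    by (simp add: poly_power mult.commute)
qed

text \<open>On \<open>[0, 1]\<close> each numerator is at most 1, and distinct nodes are at least
  \<open>1 / r\<close> apart.\<close>

lemma lag_bound:
  assumes "s \<in> {0..1}" "j < r" shows "\<bar>lag r j s\<bar> \<le> real r ^ (r - 1)"
proof -
  have "\<bar>lag r j s\<bar> = (\<Prod>i\<in>{..<r} - {j}. \<bar>(s - lag_node r i) / (lag_node r j - lag_node r i)\<bar>)"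
    unfolding lag_def by (rule abs_prod)
  also have "\<dots> \<le> (\<Prod>i\<in>{..<r} - {j}. real r)"
  proof (intro prod_mono conjI)
    fix i assume i: "i \<in> {..<r} - {j}"
    have n: "0 \<le> lag_node r i" "lag_node r i \<le> 1" using lag_node_bounds[of i r] i
      by (auto simp: lag_node_def)
    have 1: "\<bar>s - lag_node r i\<bar> \<le> 1" using n assms by auto
    have "lag_node r j - lag_node r i = (real j - real i) / real r"
      by (simp add: lag_node_def diff_divide_distrib add_divide_distrib)
    moreover have "\<bar>real j - real i\<bar> \<ge> 1" using i by auto
    ultimately have 2: "\<bar>lag_node r j - lag_node r i\<bar> \<ge> 1 / real r"
      using assms by (simp add: divide_right_mono)
    have "\<bar>(s - lag_node r i) / (lag_node r j - lag_node r i)\<bar> \<le> 1 / (1 / real r)"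
      unfolding abs_divide by (rule frac_le) (use 1 2 assms in auto)
    then show "\<bar>(s - lag_node r i) / (lag_node r j - lag_node r i)\<bar> \<le> real r" by simp
  qed auto
  also have "\<dots> = real r ^ (r - 1)" using assms by simp
  finally show ?thesis .
qed

lemma lag_measurable [measurable]: "lag r j \<in> borel_measurable borel"
  unfolding lag_def by measurable

text \<open>The cells \<open>[i\<^sup>2/N, (i+1)\<^sup>2/N]\<close>, \<open>i < N\<close>, have length comparable to \<open>sqrt (x/N)\<close> at \<open>x\<close>, which is the
  spacing that balances the loss \<open>x\<^sup>r\<^sup>/\<^sup>2\<close> of weight against \<open>r\<close> orders of smoothness. Beyond \<open>N\<close> the
  interpolant is \<open>0\<close>.\<close>
definition cell :: "real \<Rightarrow> real \<Rightarrow> real" where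
  "cell N x = real_of_int \<lfloor>sqrt (N * x)\<rfloor>"

definition interp_node :: "nat \<Rightarrow> real \<Rightarrow> real \<Rightarrow> nat \<Rightarrow> real" where
  "interp_node r N i j = i\<^sup>2 / N + (2 * i + 1) / N * lag_node r j"

definition lagrange_coef :: "nat \<Rightarrow> real \<Rightarrow> real \<Rightarrow> nat \<Rightarrow> real" where
  "lagrange_coef r N x j = (if 0 < x \<and> x < N then lag r j ((x - (cell N x)\<^sup>2 / N) / ((2 * cell N x + 1) / N)) else 0)"

text \<open>Indexing by the node instead of by \<open>j\<close> makes the coefficients of different
  levels functions of the same argument, so that they can be subtracted.\<close>

definition interp_coef :: "nat \<Rightarrow> real \<Rightarrow> real \<Rightarrow> real \<Rightarrow> real" where
  "interp_coef r N x z = (\<Sum>j<r. if z = interp_node r N (cell N x) j then lagrange_coef r N x j else 0)"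

definition interp_nodes :: "nat \<Rightarrow> nat \<Rightarrow> real set" where
  "interp_nodes r N = (\<lambda>(i, j). interp_node r (real N) (real i) j) ` ({..<N} \<times> {..<r})"

lemma cell_measurable [measurable]: "cell N \<in> borel_measurable borel"
  unfolding cell_def by measurable

lemma lagrange_coef_measurable [measurable]: "(\<lambda>x. lagrange_coef r N x j) \<in> borel_measurable borel"
  unfolding lagrange_coef_def by measurable

lemma interp_coef_measurable [measurable]: "(\<lambda>x. interp_coef r N x z) \<in> borel_measurable borel"
proof -
  have [measurable]: "(\<lambda>x. interp_node r N (cell N x) j) \<in> borel_measurable borel" for j
    unfolding interp_node_def by measurable
  show ?thesis unfolding interp_coef_def by measurable
qed

lemma cell_props:
  assumes "N \<ge> 1" "0 < x"
  shows "cell N x \<ge> 0" "(cell N x)\<^sup>2 / N \<le> x" "x < (cell N x + 1)\<^sup>2 / N" "\<exists>i::nat. cell N x = real i"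
    "x < N \<Longrightarrow> cell N x < N" "x < real n \<Longrightarrow> N = real n \<Longrightarrow> \<exists>i<n. cell N x = real i"
proof -
  have nn: "sqrt (N * x) \<ge> 0" using assms by simp
  show c0: "cell N x \<ge> 0" unfolding cell_def using nn by simp
  have le: "cell N x \<le> sqrt (N * x)" "sqrt (N * x) < cell N x + 1" unfolding cell_def by linarith+
  have "(cell N x)\<^sup>2 \<le> (sqrt (N * x))\<^sup>2" using le c0 by (intro power_mono)
  then show "(cell N x)\<^sup>2 / N \<le> x" using assms by (simp add: field_simps)
  have "(sqrt (N * x))\<^sup>2 < (cell N x + 1)\<^sup>2" using le nn by (intro power_strict_mono) auto
  then show "x < (cell N x + 1)\<^sup>2 / N" using assms by (simp add: field_simps)
  show ex: "\<exists>i::nat. cell N x = real i"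
    by (rule exI[of _ "nat \<lfloor>sqrt (N * x)\<rfloor>"]) (use nn in \<open>simp add: cell_def\<close>)
  show lt: "cell N x < N" if "x < N" 
  proof -
    have "sqrt (N * x) < sqrt (N * N)" using that assms by (intro real_sqrt_less_mono) simp
    then show ?thesis using le assms by simp
  qed
  show "\<exists>i<n. cell N x = real i" if "x < real n" "N = real n"
    using lt ex that by auto
qed

lemma interp_coef_sum:
  assumes "N \<ge> 1" "finite Z" "x > 0" "interp_nodes r N \<subseteq> Z"
  shows "(\<Sum>z\<in>Z. interp_coef r (real N) x z * g z) = (\<Sum>j<r. lagrange_coef r (real N) x j * g (interp_node r (real N) (cell (real N) x) j))"
proof (cases "x < real N")
  case True
  obtain i where i: "i < N" "cell (real N) x = real i"
    using cell_props(6)[of "real N" x N] True assms by auto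
  then have mem: "interp_node r (real N) (cell (real N) x) j \<in> Z" if "j < r" for j
    using that assms(4) by (auto simp: interp_nodes_def)
  have "(\<Sum>z\<in>Z. interp_coef r (real N) x z * g z) =
      (\<Sum>j<r. \<Sum>z\<in>Z. (if z = interp_node r (real N) (cell (real N) x) j then lagrange_coef r (real N) x j else 0) * g z)"
    unfolding interp_coef_def sum_distrib_right by (rule sum.swap)
  also have "\<dots> = (\<Sum>j<r. lagrange_coef r (real N) x j * g (interp_node r (real N) (cell (real N) x) j))"
  proof (rule sum.cong[OF refl])
    fix j assume j: "j \<in> {..<r}"
    let ?p = "interp_node r (real N) (cell (real N) x) j"
    have "(\<Sum>z\<in>Z. (if z = ?p then lagrange_coef r (real N) x j else 0) * g z) =
        (\<Sum>z\<in>Z. if z = ?p then lagrange_coef r (real N) x j * g ?p else 0)"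
      by (rule sum.cong) auto
    also have "\<dots> = lagrange_coef r (real N) x j * g ?p" using mem j assms(2) by simp
    finally show "(\<Sum>z\<in>Z. (if z = ?p then lagrange_coef r (real N) x j else 0) * g z) = lagrange_coef r (real N) x j * g ?p" .
  qed
  finally show ?thesis .
next
  case False
  then have "(\<lambda>j. lagrange_coef r (real N) x j) = (\<lambda>j. 0)" by (auto simp: lagrange_coef_def)
  then show ?thesis by (simp add: interp_coef_def cong: if_cong)
qed

lemma card_interp_nodes: "finite (interp_nodes r N)" "card (interp_nodes r N) \<le> r * N"
proof -
  show "finite (interp_nodes r N)" by (simp add: interp_nodes_def)
  have "card (interp_nodes r N) \<le> card ({..<N} \<times> {..<r})" unfolding interp_nodes_def by (rule card_image_le) simp
  then show "card (interp_nodes r N) \<le> r * N" by (simp add: mult.commute)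
qed

lemma cell_length: "(i + 1)\<^sup>2 / N = i\<^sup>2 / N + (2 * i + 1) / (N::real)"
  by (simp add: power2_eq_square add_divide_distrib[symmetric] algebra_simps)

lemma interp_node_bounds:
  assumes "N \<ge> 1" "i \<ge> 0" "j < r"
  shows "i\<^sup>2 / N \<le> interp_node r N i j" "interp_node r N i j \<le> (i + 1)\<^sup>2 / N" "interp_node r N i j \<ge> 1 / (real r * N)"
proof -
  note b = lag_node_bounds[OF assms(3)]
  have b0: "lag_node r j \<ge> 0" using assms by (simp add: lag_node_def)
  show "i\<^sup>2 / N \<le> interp_node r N i j" using assms b0 by (simp add: interp_node_def)
  have "(2 * i + 1) / N * lag_node r j \<le> (2 * i + 1) / N * 1"
    using assms b by (intro mult_left_mono) auto
  then show "interp_node r N i j \<le> (i + 1)\<^sup>2 / N" unfolding interp_node_def cell_length by simp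
  have "1 / N * (1 / real r) \<le> (2 * i + 1) / N * lag_node r j"
    using assms b b0 by (intro mult_mono divide_right_mono) auto
  moreover have "i\<^sup>2 / N \<ge> 0" using assms by simp
  ultimately show "interp_node r N i j \<ge> 1 / (real r * N)" unfolding interp_node_def by (simp add: mult.commute)
qed

lemma interp_nodes_pos: assumes "z \<in> interp_nodes r N" shows "z > 0"
proof -
  obtain i j where ij: "i < N" "j < r" "z = interp_node r (real N) (real i) j" using assms by (auto simp: interp_nodes_def)
  have "0 < 1 / (real r * real N)" using ij by simp
  then show ?thesis using interp_node_bounds(3)[of "real N" "real i" j r] ij by linarith
qed

lemma interp_coef_zero: assumes "N \<ge> 1" "z \<notin> interp_nodes r N" shows "interp_coef r (real N) x z = 0"
proof (cases "0 < x \<and> x < real N")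
  case True
  obtain i where i: "i < N" "cell (real N) x = real i"
    using cell_props(6)[of "real N" x N] True assms by auto
  then show ?thesis using assms unfolding interp_coef_def interp_nodes_def by (force intro: sum.neutral)
next
  case False
  then have "(\<lambda>j. lagrange_coef r (real N) x j) = (\<lambda>j. 0)" by (auto simp: lagrange_coef_def)
  then show ?thesis by (simp add: interp_coef_def cong: if_cong)
qed

lemma lagrange_coef_bound: assumes "N \<ge> 1" "j < r" shows "\<bar>lagrange_coef r N x j\<bar> \<le> real r ^ (r - 1)"
proof (cases "0 < x \<and> x < N")
  case True
  define i where "i = cell N x"
  have i: "i \<ge> 0" "i\<^sup>2 / N \<le> x" "x < (i + 1)\<^sup>2 / N"
    using cell_props[of N x] True assms by (auto simp: i_def)
  have p: "(2 * i + 1) / N > 0" using i assms by simp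
  have "x - i\<^sup>2 / N \<le> (2 * i + 1) / N"
    using i(3) unfolding cell_length by simp
  then have "(x - i\<^sup>2 / N) / ((2 * i + 1) / N) \<in> {0..1}"
    using i p by (simp add: pos_divide_le_eq del: divide_divide_eq_left divide_divide_eq_right)
  from lag_bound[OF this assms(2)] True show ?thesis by (simp add: lagrange_coef_def i_def)
qed (auto simp: lagrange_coef_def)

lemma lagrange_coef_moment:
  assumes "N \<ge> 1" "0 < x" "x < N" "m < r"
  shows "(\<Sum>j<r. lagrange_coef r N x j * (c + interp_node r N (cell N x) j) ^ m) = (c + x) ^ m"
proof -
  define i where "i = cell N x"
  have p: "(2 * i + 1) / N \<noteq> 0" using cell_props(1)[of N x] assms by (auto simp: i_def)
  show ?thesis
    using lag_moment[OF assms(4), of "(x - i\<^sup>2 / N) / ((2 * i + 1) / N)" "c + i\<^sup>2 / N" "(2 * i + 1) / N"] assms p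
    by (simp add: lagrange_coef_def interp_node_def flip: i_def add: add.assoc)
qed

section \<open>Kernels of the interpolation error\<close>

text \<open>The three regimes are the first cell, the remaining cells, and the tail \<open>x \<ge> N\<close> where nothing is
  interpolated.\<close>
definition err_kernel :: "nat \<Rightarrow> real \<Rightarrow> real \<Rightarrow> real \<Rightarrow> real \<Rightarrow> real" where
  "err_kernel r K N x t = (if 0 < x \<and> 0 < t then
     (if x < 1 / N then (if x \<le> 2 * real r * t \<and> t \<le> 2 / N then K * t ^ (r - 1) else 0)
      else if x < N then (if x \<le> 8 * t \<and> t \<le> 8 * x \<and> \<bar>x - t\<bar> \<le> 4 \<and> \<bar>x - t\<bar> \<le> 6 * sqrt (t / N)
        then K * sqrt (t / N) ^ (r - 1) else 0)
      else (if x \<le> 2 * t \<and> \<bar>x - t\<bar> \<le> 1 then K else 0)) else 0)"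

text \<open>At \<open>N = 1\<close> nothing is subtracted, so no moments vanish and the kernel is
  merely bounded. The range of \<open>t\<close> comes from the nodes in \<open>[1/r, 1]\<close>,
  which \<open>representable_point\<close> spreads between half the node and the node plus
  1.\<close>

definition coarse_kernel :: "nat \<Rightarrow> real \<Rightarrow> real \<Rightarrow> real \<Rightarrow> real" where
  "coarse_kernel r K x t = (if 0 < x \<and> x < 1 \<and> 1 / (2 * real r) \<le> t \<and> t \<le> 2 then K else 0)"

lemma err_kernel_measurable [measurable]:
  "(\<lambda>p. err_kernel r K N (fst p) (snd p)) \<in> borel_measurable (borel \<Otimes>\<^sub>M borel)"
  unfolding err_kernel_def by measurable

lemma coarse_kernel_measurable [measurable]:
  "(\<lambda>p. coarse_kernel r K (fst p) (snd p)) \<in> borel_measurable (borel \<Otimes>\<^sub>M borel)"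
  unfolding coarse_kernel_def by measurable

lemma err_kernel_nonneg: "K \<ge> 0 \<Longrightarrow> N \<ge> 1 \<Longrightarrow> err_kernel r K N x t \<ge> 0"
  by (auto simp: err_kernel_def intro!: mult_nonneg_nonneg zero_le_power)

lemma coarse_kernel_nonneg: "K \<ge> 0 \<Longrightarrow> coarse_kernel r K x t \<ge> 0"
  by (auto simp: coarse_kernel_def)

text \<open>For \<open>x < N\<close> the value at \<open>x\<close> minus its interpolant has
  vanishing moments below \<open>r\<close>, and \<open>representable_local\<close> applies on a
  slightly enlarged cell. For \<open>x \<ge> N\<close> the error is the bare point value, which
  \<open>representable_point\<close> handles.\<close>

lemma representable_interpolation_error:
  assumes "r \<ge> 1"
  shows "\<exists>K>0. \<forall>N\<ge>1. \<forall>x>0. representable {0<..} r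
    (\<lambda>\<epsilon> t. moll \<epsilon> (t - x) - (\<Sum>j<r. lagrange_coef r N x j * moll \<epsilon> (t - interp_node r N (cell N x) j))) (err_kernel r K N x)"
proof -
  obtain K0 where K0: "K0 > 0" and pt: "\<And>z. z > 0 \<Longrightarrow> representable {0<..} r (\<lambda>\<epsilon> t. moll \<epsilon> (t - z))
    (\<lambda>t. K0 * indicator {t. z \<le> 2 * t \<and> \<bar>z - t\<bar> \<le> 1} t)"
    using representable_point[OF assms] by blast
  \<comment> \<open>\<open>M\<close> bounds the total mass of the error functional. The 6 in
    \<open>K\<close> is the constant in the bound \<open>6 * sqrt (t / N)\<close> for the length of
    an enlarged cell.\<close>
  define M where "M = 1 + real r * real r ^ (r - 1)"
  define K where "K = K0 + M * 6 ^ (r - 1)"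
  have M1: "M \<ge> 1" by (simp add: M_def)
  have KM: "K \<ge> M * 6 ^ (r - 1)" "K \<ge> K0" "K > 0" using K0 M1 by (auto simp: K_def intro: add_pos_nonneg)
  have KM': "K \<ge> M"
  proof -
    have "M * 1 \<le> M * 6 ^ (r - 1)" using M1 by (intro mult_left_mono) auto
    then show ?thesis using KM by simp
  qed
  have "representable {0<..} r
    (\<lambda>\<epsilon> t. moll \<epsilon> (t - x) - (\<Sum>j<r. lagrange_coef r N x j * moll \<epsilon> (t - interp_node r N (cell N x) j))) (err_kernel r K N x)"
    if N: "N \<ge> 1" and x: "x > 0" for N x
  proof (cases "x < N")
    case False
    then have p0: "lagrange_coef r N x = (\<lambda>j. 0)" by (auto simp: lagrange_coef_def)
    have "\<not> x < 1 / N" using False N by (simp add: field_simps) (smt (verit) mult_le_cancel_left1)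
    show ?thesis unfolding p0
    proof (simp, rule representable_mono[OF pt[OF x]])
      show "K0 * indicator {t. x \<le> 2 * t \<and> \<bar>x - t\<bar> \<le> 1} t \<le> err_kernel r K N x t" for t
        using False \<open>\<not> x < 1 / N\<close> x KM by (auto simp: err_kernel_def indicator_def)
    qed simp
  next
    case True
    define i where "i = cell N x"
    have i: "i \<ge> 0" "i\<^sup>2 / N \<le> x" "x < (i + 1)\<^sup>2 / N" "i < N"
      using cell_props[of N x] True N x by (auto simp: i_def)
    obtain i' :: nat where i': "i = real i'" using cell_props(4)[of N x] N x by (auto simp: i_def)
    \<comment> \<open>The index \<open>r\<close> stands for the point \<open>x\<close> itself, the
      smaller indices for the nodes of its cell.\<close>
    define J where "J = insert r {..<r}"
    define \<mu> where "\<mu> j = (if j = r then 1 else - lagrange_coef r N x j)" for j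
    define z where "z j = (if j = r then x else interp_node r N i j)" for j
    have sumJ: "(\<Sum>j\<in>J. \<mu> j * g (z j)) = g x - (\<Sum>j<r. lagrange_coef r N x j * g (interp_node r N i j))" for g
    proof -
      have "(\<Sum>j\<in>J. \<mu> j * g (z j)) = g x + (\<Sum>j<r. \<mu> j * g (z j))"
        unfolding J_def by (subst sum.insert) (auto simp: \<mu>_def z_def)
      also have "(\<Sum>j<r. \<mu> j * g (z j)) = (\<Sum>j<r. - (lagrange_coef r N x j * g (interp_node r N i j)))"
        by (rule sum.cong) (auto simp: \<mu>_def z_def)
      finally show ?thesis by (simp add: sum_negf)
    qed
    have Mb: "(\<Sum>j\<in>J. \<bar>\<mu> j\<bar>) \<le> M"
    proof -
      have "(\<Sum>j\<in>J. \<bar>\<mu> j\<bar>) = 1 + (\<Sum>j<r. \<bar>\<mu> j\<bar>)"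
        unfolding J_def by (subst sum.insert) (auto simp: \<mu>_def)
      also have "(\<Sum>j<r. \<bar>\<mu> j\<bar>) \<le> (\<Sum>j<r. real r ^ (r - 1))"
        by (rule sum_mono) (use lagrange_coef_bound[OF N] in \<open>auto simp: \<mu>_def\<close>)
      finally show ?thesis by (simp add: M_def)
    qed
    have mom: "(\<Sum>j\<in>J. \<mu> j * (s + z j) ^ m) = 0" if "m < r" for m s
      using sumJ[of "\<lambda>y. (s + y) ^ m"] lagrange_coef_moment[OF N x True that, of s] by (simp add: i_def)
    note pb = interp_node_bounds[of N i _ r, OF N i(1)]
    have loc: "representable {0<..} r (\<lambda>\<epsilon> t. moll \<epsilon> (t - x) - (\<Sum>j<r. lagrange_coef r N x j * moll \<epsilon> (t - interp_node r N i j)))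
      (\<lambda>t. M * (t - (a - \<eta>)) ^ (r - 1) * indicator {a - \<eta>..b + \<eta>} t)"
      if "0 < \<eta>" "\<eta> < a" "a \<le> b" "\<And>j. j \<in> J \<Longrightarrow> z j \<in> {a..b}" for a b \<eta>
    proof -
      have "representable {0<..} r (\<lambda>\<epsilon> t. \<Sum>j\<in>J. \<mu> j * moll \<epsilon> (t - z j))
        (\<lambda>t. M * (t - (a - \<eta>)) ^ (r - 1) * indicator {a - \<eta>..b + \<eta>} t)"
        by (rule representable_local[OF _ assms that mom Mb]) (simp add: J_def)
      then show ?thesis using sumJ[of "\<lambda>y. moll _ (_ - y)"] by simp
    qed
    show ?thesis
    proof (cases "x < 1 / N")
      case x1: True
      have i0: "i = 0"
      proof -
        have "i\<^sup>2 / N < 1 / N" using i x1 by linarith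
        then have "i\<^sup>2 < 1\<^sup>2" using N by (simp add: field_simps)
        then have "i < 1" by (rule power_less_imp_less_base) simp
        then show ?thesis using i' by simp
      qed
      \<comment> \<open>The first cell touches 0, so no fixed margin fits to its left. The support
        starts instead at half of \<open>a\<close>, the leftmost among \<open>x\<close> and the
        nodes, and \<open>x \<le> r * a\<close> keeps \<open>x\<close> bounded by a multiple of
        \<open>t\<close>.\<close>
      define a where "a = min x (1 / (real r * N))"
      have a: "0 < a" "a \<le> x" "a \<le> 1 / (real r * N)" using x N assms by (auto simp: a_def)
      have rN: "1 / (real r * N) \<le> 1 / N" using N assms by (intro divide_left_mono) auto
      have xa: "x \<le> real r * a"
      proof (cases "a = x")
        case True then show ?thesis using x assms by simp
      next
        case False
        then have "a = 1 / (real r * N)" by (auto simp: a_def min_def split: if_splits)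
        then show ?thesis using x1 assms by simp
      qed
      have mem: "z j \<in> {a..1 / N}" if "j \<in> J" for j
      proof (cases "j = r")
        case False
        then have "j < r" using that by (auto simp: J_def)
        from pb[OF this] show ?thesis using a False i0 by (auto simp: z_def)
      qed (use a x1 in \<open>auto simp: z_def\<close>)
      have "representable {0<..} r (\<lambda>\<epsilon> t. moll \<epsilon> (t - x) - (\<Sum>j<r. lagrange_coef r N x j * moll \<epsilon> (t - interp_node r N i j)))
        (\<lambda>t. M * (t - (a - a/2)) ^ (r - 1) * indicator {a - a/2..1 / N + a/2} t)"
        by (rule loc) (use a rN mem in auto)
      then show ?thesis unfolding i_def[symmetric]
      proof (rule representable_mono)
        fix t
        show "M * (t - (a - a/2)) ^ (r - 1) * indicator {a - a/2..1 / N + a/2} t \<le> err_kernel r K N x t"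
        proof (cases "t \<in> {a - a/2..1 / N + a/2}")
          case True
          then have t: "t \<ge> a / 2" "t \<le> 2 / N" "t > 0" using a rN by auto
          have "x \<le> 2 * real r * t"
          proof -
            have "real r * a \<le> real r * (2 * t)" using t by (intro mult_left_mono) auto
            then show ?thesis using xa by simp
          qed
          moreover have "M * (t - (a - a/2)) ^ (r - 1) \<le> K * t ^ (r - 1)"
            by (rule mult_mono[OF KM' power_mono]) (use t a M1 KM in auto)
          ultimately show ?thesis using True t x x1 by (simp add: err_kernel_def)
        qed (use err_kernel_nonneg[of K N] KM N in auto)
      qed simp
    next
      case x1: False
      have i1: "i \<ge> 1"
      proof -
        have "1 / N < (i + 1)\<^sup>2 / N" using i x1 by linarith
        then have "i \<noteq> 0" using N by (auto simp: field_simps)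
        then show ?thesis using i' by simp
      qed
      \<comment> \<open>At most half the left endpoint of the cell because \<open>i \<ge> 1\<close>;
        the enlarged cell therefore stays comparable to \<open>x\<close>, and its length grows by
        only \<open>1 / N\<close>.\<close>
      define \<eta> where "\<eta> = 1 / (2 * N)"
      have ii: "i\<^sup>2 \<ge> i" "i\<^sup>2 \<ge> 1" using i1 by (auto simp: power2_eq_square mult_ge1_I)
      have \<eta>: "0 < \<eta>" "\<eta> \<le> i\<^sup>2 / (2 * N)" using N ii by (auto simp: \<eta>_def divide_right_mono)
      have half: "i\<^sup>2 / N - \<eta> \<ge> i\<^sup>2 / (2 * N)" "\<eta> < i\<^sup>2 / N"
        using \<eta> by (auto simp: field_simps)
      have mem: "z j \<in> {i\<^sup>2 / N..(i + 1)\<^sup>2 / N}" if "j \<in> J" for j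
      proof (cases "j = r")
        case False
        then have "j < r" using that by (auto simp: J_def)
        from pb[OF this] show ?thesis using False by (auto simp: z_def)
      qed (use i in \<open>auto simp: z_def\<close>)
      have "representable {0<..} r (\<lambda>\<epsilon> t. moll \<epsilon> (t - x) - (\<Sum>j<r. lagrange_coef r N x j * moll \<epsilon> (t - interp_node r N i j)))
        (\<lambda>t. M * (t - (i\<^sup>2 / N - \<eta>)) ^ (r - 1) * indicator {i\<^sup>2 / N - \<eta>..(i + 1)\<^sup>2 / N + \<eta>} t)"
        by (rule loc) (use \<eta> half mem i N in \<open>auto simp: divide_right_mono\<close>)
      then show ?thesis unfolding i_def[symmetric]
      proof (rule representable_mono)
        fix t
        show "M * (t - (i\<^sup>2 / N - \<eta>)) ^ (r - 1) * indicator {i\<^sup>2 / N - \<eta>..(i + 1)\<^sup>2 / N + \<eta>} t \<le> err_kernel r K N x t"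
        proof (cases "t \<in> {i\<^sup>2 / N - \<eta>..(i + 1)\<^sup>2 / N + \<eta>}")
          case True
          have tl: "t \<ge> i\<^sup>2 / (2 * N)" using True half by auto
          have t0: "t > 0"
          proof -
            have "i\<^sup>2 / (2 * N) > 0" using i1 N by auto
            then show ?thesis using tl by linarith
          qed
          have len: "(i + 1)\<^sup>2 / N + \<eta> - (i\<^sup>2 / N - \<eta>) = (2 * i + 2) / N"
            unfolding cell_length \<eta>_def using N by (simp add: field_simps)
          have h4: "(2 * i + 2) / N \<le> 4 * i / N" using i1 N by (intro divide_right_mono) auto
          have "i\<^sup>2 \<le> 2 * (N * t)" using tl N by (simp add: field_simps)
          then have "i \<le> sqrt (2 * (N * t))" using real_le_rsqrt by blast
          then have "4 * i / N \<le> 4 * sqrt (2 * (N * t)) / N" using N by (intro divide_right_mono) auto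
          also have "\<dots> = 4 * sqrt 2 * (sqrt (N * t) / N)" by (simp add: real_sqrt_mult)
          also have "sqrt (N * t) / N = sqrt (t / N)"
            using N t0 by (simp add: real_sqrt_mult real_sqrt_divide field_simps)
          also have "4 * sqrt 2 * sqrt (t / N) \<le> 6 * sqrt (t / N)"
          proof (rule mult_right_mono)
            have "sqrt 2 \<le> sqrt ((3/2)\<^sup>2)" by (intro real_sqrt_le_mono) (simp add: power2_eq_square)
            then show "4 * sqrt 2 \<le> (6::real)" by simp
          qed (use t0 N in auto)
          finally have h6: "4 * i / N \<le> 6 * sqrt (t / N)" .
          have d: "\<bar>x - t\<bar> \<le> (2 * i + 2) / N" using True i \<eta> len by (auto simp: abs_le_iff)
          have "(2 * i + 2) / N \<le> 4" using i N by (simp add: field_simps)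
          have i4: "(i + 1)\<^sup>2 / N \<le> 4 * (i\<^sup>2 / N)"
          proof -
            have "(i + 1)\<^sup>2 \<le> (2 * i)\<^sup>2" using i1 by (intro power_mono) auto
            then have "(i + 1)\<^sup>2 / N \<le> (2 * i)\<^sup>2 / N" using N by (intro divide_right_mono) auto
            then show ?thesis by (simp add: power_mult_distrib)
          qed
          have x8: "x \<le> 8 * t"
          proof -
            have "8 * (i\<^sup>2 / (2 * N)) = 4 * (i\<^sup>2 / N)" by simp
            then show ?thesis using i tl i4 by linarith
          qed
          have t8: "t \<le> 8 * x"
          proof -
            have "\<eta> \<le> i\<^sup>2 / N" using half by simp
            then show ?thesis using True i i4 by auto
          qed
          have "(t - (i\<^sup>2 / N - \<eta>)) ^ (r - 1) \<le> (6 * sqrt (t / N)) ^ (r - 1)"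
            by (rule power_mono) (use True len h4 h6 in auto)
          then have "M * (t - (i\<^sup>2 / N - \<eta>)) ^ (r - 1) \<le> M * (6 ^ (r - 1) * sqrt (t / N) ^ (r - 1))"
            using M1 by (intro mult_left_mono) (auto simp: power_mult_distrib)
          also have "\<dots> \<le> K * sqrt (t / N) ^ (r - 1)"
            unfolding mult.assoc[symmetric] using KM t0 N by (intro mult_right_mono) auto
          finally show ?thesis using True x x1 \<open>x < N\<close> t0 x8 t8 d h4 h6 \<open>(2 * i + 2) / N \<le> 4\<close>
            by (auto simp: err_kernel_def)
        qed (use err_kernel_nonneg[of K N] KM N in auto)
      qed simp
    qed
  qed
  then show ?thesis using KM by blast
qed

text \<open>No cancellation is used: the \<open>r\<close> node values are represented one by one and
  their bounds added.\<close>

lemma representable_coarsest_interpolation: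
  assumes "r \<ge> 1"
  shows "\<exists>K>0. \<forall>x>0. representable {0<..} r
    (\<lambda>\<epsilon> t. (\<Sum>j<r. lagrange_coef r 1 x j * moll \<epsilon> (t - interp_node r 1 (cell 1 x) j))) (coarse_kernel r K x)"
proof -
  obtain K0 where K0: "K0 > 0" and pt: "\<And>z. z > 0 \<Longrightarrow> representable {0<..} r (\<lambda>\<epsilon> t. moll \<epsilon> (t - z))
    (\<lambda>t. K0 * indicator {t. z \<le> 2 * t \<and> \<bar>z - t\<bar> \<le> 1} t)"
    using representable_point[OF assms] by blast
  define B where "B = real r ^ (r - 1)"
  define K where "K = real r * (B * K0)"
  have K: "K > 0" "B > 0" using K0 assms by (auto simp: K_def B_def)
  have "representable {0<..} r
    (\<lambda>\<epsilon> t. (\<Sum>j<r. lagrange_coef r 1 x j * moll \<epsilon> (t - interp_node r 1 (cell 1 x) j))) (coarse_kernel r K x)"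
    if x: "x > 0" for x
  proof -
    have c0: "cell 1 x \<ge> 0" using cell_props(1)[of 1 x] x by simp
    have pz: "interp_node r 1 (cell 1 x) j > 0" if "j < r" for j
    proof -
      have "0 < 1 / (real r * 1)" using assms by simp
      then show ?thesis using interp_node_bounds(3)[of 1 "cell 1 x" j r] c0 that by linarith
    qed
    have "representable {0<..} r (\<lambda>\<epsilon> t. (\<Sum>j<r. lagrange_coef r 1 x j * moll \<epsilon> (t - interp_node r 1 (cell 1 x) j)))
      (\<lambda>t. \<Sum>j<r. \<bar>lagrange_coef r 1 x j\<bar> * (K0 * indicator {t. interp_node r 1 (cell 1 x) j \<le> 2 * t \<and> \<bar>interp_node r 1 (cell 1 x) j - t\<bar> \<le> 1} t))"
      by (intro representable_sum representable_cmult pt pz) simp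
    then show ?thesis
    proof (rule representable_mono)
      fix t
      have *: "\<bar>lagrange_coef r 1 x j\<bar> * (K0 * indicator {t. interp_node r 1 (cell 1 x) j \<le> 2 * t \<and> \<bar>interp_node r 1 (cell 1 x) j - t\<bar> \<le> 1} t)
          \<le> (if 0 < x \<and> x < 1 \<and> 1 / (2 * real r) \<le> t \<and> t \<le> 2 then B * K0 else 0)"
        if j: "j < r" for j
      proof (cases "x < 1")
        case False
        then show ?thesis by (simp add: lagrange_coef_def)
      next
        case True
        have "cell 1 x = 0" using cell_props(6)[of 1 x 1] True x by auto
        then have b: "1 / real r \<le> interp_node r 1 (cell 1 x) j" "interp_node r 1 (cell 1 x) j \<le> 1"
          using interp_node_bounds[of 1 0 j r] j by auto
        show ?thesis
        proof (cases "interp_node r 1 (cell 1 x) j \<le> 2 * t \<and> \<bar>interp_node r 1 (cell 1 x) j - t\<bar> \<le> 1")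
          case in_range: True
          have "1 / (2 * real r) \<le> t"
          proof -
            have "1 / (2 * real r) = (1 / real r) / 2" by simp
            also have "(1 / real r) / 2 \<le> t" by (rule order_trans[OF divide_right_mono[OF b(1)]]) (use in_range in auto)
            finally show ?thesis .
          qed
          moreover have "\<bar>lagrange_coef r 1 x j\<bar> * K0 \<le> B * K0"
            using lagrange_coef_bound[of 1 j r x] j K0 by (intro mult_right_mono) (auto simp: B_def)
          ultimately show ?thesis using in_range b True x by auto
        qed (use K0 K in auto)
      qed
      have "(\<Sum>j<r. \<bar>lagrange_coef r 1 x j\<bar> * (K0 * indicator {t. interp_node r 1 (cell 1 x) j \<le> 2 * t \<and> \<bar>interp_node r 1 (cell 1 x) j - t\<bar> \<le> 1} t))
         \<le> (\<Sum>j<r. if 0 < x \<and> x < 1 \<and> 1 / (2 * real r) \<le> t \<and> t \<le> 2 then B * K0 else 0)"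
        by (rule sum_mono) (use * in auto)
      also have "\<dots> = coarse_kernel r K x t" by (simp add: coarse_kernel_def K_def)
      finally show "(\<Sum>j<r. \<bar>lagrange_coef r 1 x j\<bar> * (K0 * indicator {t. interp_node r 1 (cell 1 x) j \<le> 2 * t \<and> \<bar>interp_node r 1 (cell 1 x) j - t\<bar> \<le> 1} t))
         \<le> coarse_kernel r K x t" .
    qed simp
  qed
  then show ?thesis using K by blast
qed

section \<open>Weighted integrals of the kernels\<close>

text \<open>With both ratios \<open>x / t\<close> and \<open>t / x\<close> at most \<open>c\<close>,
  one of them serves for each sign of \<open>\<beta>\<close>; the exponent
  \<open>\<bar>\<beta>\<bar>\<close> covers both cases.\<close>

lemma powr_le_powr_ratio:
  fixes x t :: real
  assumes "0 < x" "0 < t" "x \<le> c * t" "t \<le> c * x"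
  shows "x powr \<beta> \<le> c powr \<bar>\<beta>\<bar> * t powr \<beta>"
proof -
  have c: "c > 0" using assms by (smt (verit) mult_nonpos_nonneg)
  have "x powr \<beta> = (x / t) powr \<beta> * t powr \<beta>" using assms by (simp add: powr_divide)
  also have "(x / t) powr \<beta> \<le> c powr \<bar>\<beta>\<bar>"
  proof (cases "\<beta> \<ge> 0")
    case True
    then show ?thesis using assms c by (simp add: powr_mono2 field_simps)
  next
    case False
    have "(x / t) powr \<beta> = (t / x) powr (- \<beta>)" using assms by (simp add: powr_divide powr_minus field_simps)
    also have "\<dots> \<le> c powr (- \<beta>)" using assms False by (intro powr_mono2) (auto simp: field_simps)
    finally show ?thesis using False by simp
  qed
  finally show ?thesis using assms by (simp add: mult_right_mono)
qed

lemma wr_nonneg: "wr \<alpha> r x \<ge> 0" by (simp add: wr_def)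

lemma wr_measurable [measurable]: "wr \<alpha> r \<in> borel_measurable borel"
  unfolding wr_def by measurable

lemma wr_eq_sqrt: assumes "t > 0" shows "wr \<alpha> r t = t powr \<alpha> * sqrt t ^ r * exp (- t)"
proof -
  have "t powr (real r / 2) = (t powr (1/2)) powr real r" by (simp add: powr_powr)
  also have "\<dots> = sqrt t ^ r" using assms by (simp add: powr_half_sqrt powr_realpow)
  finally show ?thesis using assms by (simp add: wr_def powr_add)
qed

text \<open>The bounded ratio controls the power and the bounded distance controls the exponential,
  so both kinds of closeness are asked for.\<close>

lemma wr_zero_compare:
  assumes "0 < x" "0 < t" "x \<le> 8 * t" "t \<le> 8 * x" "\<bar>x - t\<bar> \<le> 4"
  shows "wr \<alpha> 0 x \<le> 8 powr \<bar>\<alpha>\<bar> * exp 4 * wr \<alpha> 0 t"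
proof -
  have "wr \<alpha> 0 x = x powr \<alpha> * exp (- x)" using assms by (simp add: wr_def)
  also have "\<dots> \<le> (8 powr \<bar>\<alpha>\<bar> * t powr \<alpha>) * (exp 4 * exp (- t))"
    unfolding mult_exp_exp
    by (intro mult_mono powr_le_powr_ratio) (use assms in auto)
  also have "\<dots> = 8 powr \<bar>\<alpha>\<bar> * exp 4 * wr \<alpha> 0 t" using assms by (simp add: wr_def mult_ac)
  finally show ?thesis .
qed

text \<open>Here \<open>\<alpha> > -1\<close> makes the power integrable at 0.\<close>

lemma nn_integral_powr_initial:
  assumes "\<alpha> > -1" "c \<ge> 0"
  shows "(\<integral>\<^sup>+x. ennreal (indicator {0..c} x * x powr \<alpha>) \<partial>lborel) = ennreal (c powr (\<alpha> + 1) / (\<alpha> + 1))"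
proof -
  have "((\<lambda>x. x powr \<alpha>) has_integral (c powr (\<alpha> + 1) / (\<alpha> + 1))) {0..c}"
    by (rule has_integral_powr_from_0[OF assms])
  then have "((\<lambda>x. if x \<in> {0..c} then x powr \<alpha> else 0) has_integral (c powr (\<alpha> + 1) / (\<alpha> + 1))) UNIV"
    unfolding has_integral_restrict_UNIV .
  also have "(\<lambda>x. if x \<in> {0..c} then x powr \<alpha> else 0) = (\<lambda>x. indicator {0..c} x * x powr \<alpha>)"
    by (auto simp: indicator_def)
  finally show ?thesis by (intro nn_integral_has_integral_lborel) auto
qed

lemma nn_integral_scaled_powr:
  assumes "\<alpha> > -1" "c \<ge> 0"
  shows "(\<integral>\<^sup>+x. ennreal b * ennreal (indicator {0..c} x * x powr \<alpha>) \<partial>lborel) =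
    ennreal b * ennreal (c powr (\<alpha> + 1) / (\<alpha> + 1))"
proof -
  have "(\<lambda>x. ennreal (indicator {0..c} x * x powr \<alpha>)) \<in> borel_measurable lborel" by measurable
  from nn_integral_cmult[OF this] show ?thesis unfolding nn_integral_powr_initial[OF assms] .
qed

lemma nn_integral_const_interval:
  assumes "c \<ge> 0" "a \<le> b"
  shows "(\<integral>\<^sup>+x. ennreal (c * indicator {a..b} x) \<partial>lborel) = ennreal (c * (b - a))"
proof -
  have "(\<integral>\<^sup>+x. ennreal (c * indicator {a..b} x) \<partial>lborel) = (\<integral>\<^sup>+x. ennreal c * indicator {a..b} x \<partial>lborel)"
    by (intro nn_integral_cong) (auto simp: indicator_def)
  also have "\<dots> = ennreal c * emeasure lborel {a..b}" by (subst nn_integral_cmult_indicator) auto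
  finally show ?thesis using assms by (simp add: ennreal_mult)
qed

text \<open>Every regime yields the factor (t/N)^(r/2), which \<open>wr \<alpha> r\<close> absorbs
  up to \<open>N^(-r/2)\<close>. In an inner cell the kernel has size sqrt(t/N)^(r-1) over a length
  of order sqrt(t/N). In the first cell the integral is of order t^r * t^\<alpha>, and half of t^r
  is bounded by a power of 2/N. In the tail t is at least N/2, so that (t/N)^(r/2) is bounded
  below.\<close>

lemma nn_integral_err_kernel:
  assumes "r \<ge> 1" "\<alpha> > -1" "K > 0"
  shows "\<exists>C>0. \<forall>N\<ge>1. \<forall>t>0. (\<integral>\<^sup>+x. ennreal (err_kernel r K N x t * wr \<alpha> 0 x) \<partial>lborel)
     \<le> ennreal (C * (1 / sqrt N) ^ r * wr \<alpha> r t)"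
proof -
  define D where "D = 8 powr \<bar>\<alpha>\<bar> * exp 4"
  have D: "D > 0" by (simp add: D_def)
  define C1 where "C1 = K * (2 * real r) powr (\<alpha> + 1) / (\<alpha> + 1) * sqrt 2 ^ r * exp 2"
  define C2 where "C2 = K * D * 12"
  define C3 where "C3 = K * D * 2 * sqrt 2 ^ r"
  have C: "C1 \<ge> 0" "C2 > 0" "C3 \<ge> 0" using assms D by (auto simp: C1_def C2_def C3_def)
  have "(\<integral>\<^sup>+x. ennreal (err_kernel r K N x t * wr \<alpha> 0 x) \<partial>lborel) \<le> ennreal ((C1 + C2 + C3) * (1 / sqrt N) ^ r * wr \<alpha> r t)"
    if N: "N \<ge> 1" and t: "t > 0" for N t
  proof -
    define w where "w = wr \<alpha> 0 t"
    have w: "w \<ge> 0" "w = t powr \<alpha> * exp (- t)" using t by (auto simp: w_def wr_nonneg wr_def)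
    have wrt: "wr \<alpha> r t = w * sqrt t ^ r" using wr_eq_sqrt[OF t] w by simp
    \<comment> \<open>\<open>c1\<close>, \<open>c2\<close> and \<open>c3\<close> majorise the first
      cell, the other cells and the tail; in the last two the weight at \<open>x\<close> is already
      replaced by the one at \<open>t\<close>.\<close>
    define c1 where "c1 = (if t \<le> 2 / N then K * t ^ (r - 1) else 0)"
    define c2 where "c2 = K * sqrt (t / N) ^ (r - 1) * (D * w)"
    define c3 where "c3 = (if t \<ge> N / 2 then K * (D * w) else 0)"
    define s where "s = 6 * sqrt (t / N)"
    have c: "c1 \<ge> 0" "c2 \<ge> 0" "c3 \<ge> 0" "s \<ge> 0" using assms t N w D by (auto simp: c1_def c2_def c3_def s_def)
    have pw: "ennreal (err_kernel r K N x t * wr \<alpha> 0 x) \<le> ennreal c1 * ennreal (indicator {0..2 * real r * t} x * x powr \<alpha>)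
       + ennreal (c2 * indicator {t - s..t + s} x) + ennreal (c3 * indicator {t - 1..t + 1} x)" for x
    proof -
      have "err_kernel r K N x t * wr \<alpha> 0 x \<le> c1 * (indicator {0..2 * real r * t} x * x powr \<alpha>)
       + c2 * indicator {t - s..t + s} x + c3 * indicator {t - 1..t + 1} x" (is "_ \<le> ?a + ?b + ?c")
      proof -
        have nn: "?a \<ge> 0" "?b \<ge> 0" "?c \<ge> 0" using c by auto
        show ?thesis
        proof (cases "x > 0")
          case False
          then show ?thesis using nn by (simp add: err_kernel_def)
        next
          case x: True
          consider "x < 1 / N" | "\<not> x < 1 / N" "x < N" | "\<not> x < 1 / N" "\<not> x < N" by blast
          then show ?thesis
          proof cases
            case 1
            show ?thesis
            proof (cases "x \<le> 2 * real r * t \<and> t \<le> 2 / N")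
              case True
              have "wr \<alpha> 0 x \<le> x powr \<alpha> * 1" unfolding wr_def using x by (intro mult_mono) auto
              then have "K * t ^ (r - 1) * wr \<alpha> 0 x \<le> K * t ^ (r - 1) * x powr \<alpha>"
                using assms t by (intro mult_left_mono) auto
              then have "err_kernel r K N x t * wr \<alpha> 0 x \<le> ?a" using True 1 x t by (simp add: err_kernel_def c1_def)
              then show ?thesis using nn by linarith
            next
              case False
              have "err_kernel r K N x t = 0" unfolding err_kernel_def if_not_P[OF False] using 1 by simp
              then show ?thesis using nn by simp
            qed
          next
            case 2
            show ?thesis
            proof (cases "x \<le> 8 * t \<and> t \<le> 8 * x \<and> \<bar>x - t\<bar> \<le> 4 \<and> \<bar>x - t\<bar> \<le> 6 * sqrt (t / N)")
              case True
              have "wr \<alpha> 0 x \<le> D * w" unfolding D_def w_def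
                by (rule wr_zero_compare[OF x t]) (use True in blast)+
              then have "K * sqrt (t / N) ^ (r - 1) * wr \<alpha> 0 x \<le> K * sqrt (t / N) ^ (r - 1) * (D * w)"
                using assms t N by (intro mult_left_mono) auto
              moreover have "x \<in> {t - s..t + s}" using True by (auto simp: s_def)
              ultimately have "err_kernel r K N x t * wr \<alpha> 0 x \<le> ?b" using True 2 x t by (simp add: err_kernel_def c2_def)
              then show ?thesis using nn by linarith
            next
              case False
              have "err_kernel r K N x t = 0" unfolding err_kernel_def if_not_P[OF False] using 2 by simp
              then show ?thesis using nn by simp
            qed
          next
            case 3
            show ?thesis
            proof (cases "x \<le> 2 * t \<and> \<bar>x - t\<bar> \<le> 1")
              case True
              have "wr \<alpha> 0 x \<le> D * w" unfolding D_def w_def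
                by (rule wr_zero_compare) (use True 3 x t N in auto)
              then have "K * wr \<alpha> 0 x \<le> K * (D * w)" using assms by (intro mult_left_mono) auto
              moreover have "x \<in> {t - 1..t + 1}" "t \<ge> N / 2" using True 3 by auto
              ultimately have "err_kernel r K N x t * wr \<alpha> 0 x \<le> ?c" using True 3 x t by (simp add: err_kernel_def c3_def)
              then show ?thesis using nn by linarith
            next
              case False
              have "err_kernel r K N x t = 0" unfolding err_kernel_def if_not_P[OF False] using 3 by simp
              then show ?thesis using nn by simp
            qed
          qed
        qed
      qed
      then have "ennreal (err_kernel r K N x t * wr \<alpha> 0 x) \<le> ennreal (c1 * (indicator {0..2 * real r * t} x * x powr \<alpha>)
       + c2 * indicator {t - s..t + s} x + c3 * indicator {t - 1..t + 1} x)" by (rule ennreal_leI)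
      then show ?thesis using c by (simp add: ennreal_plus ennreal_mult)
    qed
    have i1: "(\<integral>\<^sup>+x. ennreal c1 * ennreal (indicator {0..2 * real r * t} x * x powr \<alpha>) \<partial>lborel)
        \<le> ennreal (C1 * (1 / sqrt N) ^ r * wr \<alpha> r t)"
    proof (cases "t \<le> 2 / N")
      case True
      have "(\<integral>\<^sup>+x. ennreal c1 * ennreal (indicator {0..2 * real r * t} x * x powr \<alpha>) \<partial>lborel)
          = ennreal c1 * ennreal ((2 * real r * t) powr (\<alpha> + 1) / (\<alpha> + 1))"
        by (rule nn_integral_scaled_powr) (use t assms in auto)
      also have "\<dots> = ennreal (c1 * ((2 * real r * t) powr (\<alpha> + 1) / (\<alpha> + 1)))"
        by (rule ennreal_mult[symmetric]) (use c assms in auto)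
      also have "c1 * ((2 * real r * t) powr (\<alpha> + 1) / (\<alpha> + 1)) \<le> C1 * (1 / sqrt N) ^ r * wr \<alpha> r t"
      proof -
        define E where "E = K * (2 * real r) powr (\<alpha> + 1) / (\<alpha> + 1)"
        have E: "E \<ge> 0" using assms by (simp add: E_def)
        have "c1 * ((2 * real r * t) powr (\<alpha> + 1) / (\<alpha> + 1)) = E * (t ^ (r - 1) * t * t powr \<alpha>)"
          using True t assms by (simp add: c1_def E_def powr_mult powr_add)
        also have "t ^ (r - 1) * t = t ^ r" using assms by (cases r) auto
        \<comment> \<open>One factor pays for the power of \<open>N\<close>, the other becomes part
          of the weight \<open>wr \<alpha> r\<close>.\<close>
        also have "t ^ r = sqrt t ^ r * sqrt t ^ r" using t by (simp flip: power_mult_distrib)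
        finally have eq: "c1 * ((2 * real r * t) powr (\<alpha> + 1) / (\<alpha> + 1)) = E * (sqrt t ^ r * (sqrt t ^ r * t powr \<alpha>))"
          by (simp add: mult_ac)
        have "sqrt t \<le> sqrt 2 * (1 / sqrt N)" using True by (simp flip: real_sqrt_divide)
        then have "sqrt t ^ r \<le> (sqrt 2 * (1 / sqrt N)) ^ r" using t by (intro power_mono) auto
        then have a: "sqrt t ^ r \<le> sqrt 2 ^ r * (1 / sqrt N) ^ r" by (simp only: power_mult_distrib)
        have "2 / N \<le> 2" using N by (simp add: field_simps)
        then have "t \<le> 2" using True by linarith
        then have "1 \<le> exp 2 * exp (- t)" by (simp add: mult_exp_exp)
        then have b: "sqrt t ^ r * t powr \<alpha> * 1 \<le> sqrt t ^ r * t powr \<alpha> * (exp 2 * exp (- t))"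
          using t by (intro mult_left_mono) auto
        have "E * (sqrt t ^ r * (sqrt t ^ r * t powr \<alpha>)) \<le> E * ((sqrt 2 ^ r * (1 / sqrt N) ^ r) * (sqrt t ^ r * t powr \<alpha> * (exp 2 * exp (- t))))"
          by (rule mult_left_mono[OF mult_mono[OF a b[unfolded mult_1_right]] E]) (use t N in auto)
        then show ?thesis unfolding eq C1_def E_def[symmetric] wr_eq_sqrt[OF t] by (simp add: mult_ac)
      qed
      finally show ?thesis by (simp add: ennreal_leI)
    qed (simp add: c1_def)
    have i2: "(\<integral>\<^sup>+x. ennreal (c2 * indicator {t - s..t + s} x) \<partial>lborel) = ennreal (C2 * (1 / sqrt N) ^ r * wr \<alpha> r t)"
    proof -
      have "c2 * (t + s - (t - s)) = K * D * 12 * (sqrt (t / N) ^ (r - 1) * sqrt (t / N)) * w"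
        by (simp add: c2_def s_def)
      also have "sqrt (t / N) ^ (r - 1) * sqrt (t / N) = sqrt (t / N) ^ r" using assms by (cases r) auto
      also have "sqrt (t / N) = (1 / sqrt N) * sqrt t" by (simp add: real_sqrt_divide)
      finally have "c2 * (t + s - (t - s)) = C2 * (1 / sqrt N) ^ r * wr \<alpha> r t"
        unfolding wrt C2_def power_mult_distrib by (simp only: mult_ac)
      then show ?thesis using nn_integral_const_interval[of c2 "t - s" "t + s"] c by simp
    qed
    have i3: "(\<integral>\<^sup>+x. ennreal (c3 * indicator {t - 1..t + 1} x) \<partial>lborel) \<le> ennreal (C3 * (1 / sqrt N) ^ r * wr \<alpha> r t)"
    proof -
      have "c3 * 2 \<le> C3 * (1 / sqrt N) ^ r * wr \<alpha> r t"
      proof (cases "t \<ge> N / 2")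
        case True
        have "sqrt N \<le> sqrt 2 * sqrt t" using True by (simp flip: real_sqrt_mult)
        then have "1 \<le> sqrt 2 * (1 / sqrt N) * sqrt t" using N by (simp add: field_simps)
        then have "1 ^ r \<le> (sqrt 2 * (1 / sqrt N) * sqrt t) ^ r" by (intro power_mono) auto
        then have "1 \<le> sqrt 2 ^ r * (1 / sqrt N) ^ r * sqrt t ^ r" by (simp only: power_mult_distrib power_one)
        then have "(K * D * 2 * w) * 1 \<le> (K * D * 2 * w) * (sqrt 2 ^ r * (1 / sqrt N) ^ r * sqrt t ^ r)"
          using assms D w by (intro mult_left_mono) auto
        then show ?thesis using True unfolding c3_def C3_def wrt by (simp add: mult_ac)
      next
        case False
        then show ?thesis using C N by (simp add: c3_def wr_nonneg)
      qed
      then show ?thesis using nn_integral_const_interval[of c3 "t - 1" "t + 1"] c by (simp add: ennreal_leI)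
    qed
    have "(\<integral>\<^sup>+x. ennreal (err_kernel r K N x t * wr \<alpha> 0 x) \<partial>lborel)
      \<le> (\<integral>\<^sup>+x. ennreal c1 * ennreal (indicator {0..2 * real r * t} x * x powr \<alpha>)
       + ennreal (c2 * indicator {t - s..t + s} x) + ennreal (c3 * indicator {t - 1..t + 1} x) \<partial>lborel)"
      by (rule nn_integral_mono) (rule pw)
    also have "\<dots> = (\<integral>\<^sup>+x. ennreal c1 * ennreal (indicator {0..2 * real r * t} x * x powr \<alpha>) \<partial>lborel)
       + (\<integral>\<^sup>+x. ennreal (c2 * indicator {t - s..t + s} x) \<partial>lborel) + (\<integral>\<^sup>+x. ennreal (c3 * indicator {t - 1..t + 1} x) \<partial>lborel)"
      by (subst nn_integral_add; (subst nn_integral_add)?) auto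
    also have "\<dots> \<le> ennreal (C1 * (1 / sqrt N) ^ r * wr \<alpha> r t) + ennreal (C2 * (1 / sqrt N) ^ r * wr \<alpha> r t)
       + ennreal (C3 * (1 / sqrt N) ^ r * wr \<alpha> r t)"
      by (intro add_mono i1 i3) (simp add: i2)
    also have "\<dots> = ennreal ((C1 + C2 + C3) * (1 / sqrt N) ^ r * wr \<alpha> r t)"
      using C N by (simp add: wr_nonneg distrib_right flip: ennreal_plus)
    finally show ?thesis .
  qed
  then show ?thesis using C by (intro exI[of _ "C1 + C2 + C3"]) auto
qed

text \<open>No decay is involved: \<open>t\<close> is confined to a compact part of the open half
  line, where \<open>wr \<alpha> r\<close> is bounded below.\<close>

lemma nn_integral_coarse_kernel:
  assumes "r \<ge> 1" "\<alpha> > -1" "K > 0"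
  shows "\<exists>C>0. \<forall>t>0. (\<integral>\<^sup>+x. ennreal (coarse_kernel r K x t * wr \<alpha> 0 x) \<partial>lborel) \<le> ennreal (C * wr \<alpha> r t)"
proof -
  define E where "E = (2 * real r) powr \<bar>\<alpha> + real r / 2\<bar> * exp 2"
  define C where "C = K / (\<alpha> + 1) * E"
  have E: "E > 0" using assms by (simp add: E_def)
  have C: "C > 0" using assms E by (simp add: C_def)
  have "(\<integral>\<^sup>+x. ennreal (coarse_kernel r K x t * wr \<alpha> 0 x) \<partial>lborel) \<le> ennreal (C * wr \<alpha> r t)" if t: "t > 0" for t
  proof (cases "1 / (2 * real r) \<le> t \<and> t \<le> 2")
    case False
    then have "coarse_kernel r K x t = 0" for x by (auto simp: coarse_kernel_def)
    then show ?thesis by simp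
  next
    case True
    have "(\<integral>\<^sup>+x. ennreal (coarse_kernel r K x t * wr \<alpha> 0 x) \<partial>lborel)
      \<le> (\<integral>\<^sup>+x. ennreal K * ennreal (indicator {0..1} x * x powr \<alpha>) \<partial>lborel)"
    proof (rule nn_integral_mono)
      fix x
      have "coarse_kernel r K x t * wr \<alpha> 0 x \<le> K * (indicator {0..1} x * x powr \<alpha>)"
      proof (cases "0 < x \<and> x < 1")
        case True
        then have "wr \<alpha> 0 x \<le> x powr \<alpha> * 1" unfolding wr_def by (intro mult_mono) auto
        then show ?thesis using True assms by (simp add: coarse_kernel_def)
      qed (use assms in \<open>auto simp: coarse_kernel_def indicator_def\<close>)
      then show "ennreal (coarse_kernel r K x t * wr \<alpha> 0 x) \<le> ennreal K * ennreal (indicator {0..1} x * x powr \<alpha>)"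
        using assms by (simp add: ennreal_leI flip: ennreal_mult)
    qed
    also have "\<dots> = ennreal K * ennreal (1 / (\<alpha> + 1))"
      using nn_integral_scaled_powr[OF assms(2), of 1] by simp
    also have "\<dots> = ennreal (K / (\<alpha> + 1) * 1)" using assms by (simp flip: ennreal_mult)
    also have "\<dots> \<le> ennreal (K / (\<alpha> + 1) * (E * wr \<alpha> r t))"
    proof (intro ennreal_leI mult_left_mono)
      have "t \<le> 2 * real r * 1" "1 \<le> 2 * real r * t" using True assms by (auto simp: field_simps)
      then have "1 powr (\<alpha> + real r / 2) \<le> (2 * real r) powr \<bar>\<alpha> + real r / 2\<bar> * t powr (\<alpha> + real r / 2)"
        using t by (intro powr_le_powr_ratio) auto
      moreover have "1 \<le> exp 2 * exp (- t)" using True by (simp add: mult_exp_exp)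
      ultimately have "1 * 1 \<le> ((2 * real r) powr \<bar>\<alpha> + real r / 2\<bar> * t powr (\<alpha> + real r / 2)) * (exp 2 * exp (- t))"
        by (intro mult_mono) auto
      then show "1 \<le> E * wr \<alpha> r t" using t by (simp add: E_def wr_def mult_ac)
    qed (use assms in auto)
    finally show ?thesis by (simp add: C_def mult.assoc)
  qed
  then show ?thesis using C by blast
qed

text \<open>Each half line contributes the Gamma integral at \<open>\<alpha> + 1\<close>.\<close>

lemma nn_integral_wr_finite:
  assumes "\<alpha> > -1"
  shows "(\<integral>\<^sup>+x. ennreal (wr \<alpha> 0 x) \<partial>lborel) < \<infinity>"
proof -
  define f where "f x = (if x \<in> {0..} then x powr (\<alpha> + 1 - 1) / exp x else 0)" for x :: real
  have [measurable]: "f \<in> borel_measurable borel" unfolding f_def by measurable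
  have "(f has_integral Gamma (\<alpha> + 1)) UNIV"
    unfolding f_def has_integral_restrict_UNIV using assms by (intro Gamma_integral_real) simp
  moreover have "f x \<ge> 0" for x by (simp add: f_def)
  ultimately have 1: "(\<integral>\<^sup>+x. ennreal (f x) \<partial>lborel) = ennreal (Gamma (\<alpha> + 1))"
    by (intro nn_integral_has_integral_lborel) auto
  then have 2: "(\<integral>\<^sup>+x. ennreal (f (- x)) \<partial>lborel) = ennreal (Gamma (\<alpha> + 1))"
    using nn_integral_real_affine[of "\<lambda>x. ennreal (f x)" "-1" 0] by simp
  have "(\<integral>\<^sup>+x. ennreal (wr \<alpha> 0 x) \<partial>lborel) \<le> (\<integral>\<^sup>+x. ennreal (f x) + ennreal (f (- x)) \<partial>lborel)"
  proof (rule nn_integral_mono)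
    fix x
    have f: "f y = y powr \<alpha> * exp (- y)" if "y \<ge> 0" for y
      using that by (simp add: f_def exp_minus field_simps)
    have fn: "f y \<ge> 0" for y by (simp add: f_def)
    have "wr \<alpha> 0 x = f \<bar>x\<bar>" by (simp add: f wr_def)
    also have "\<dots> \<le> f x + f (- x)" using fn[of x] fn[of "- x"] by (simp add: abs_if)
    finally have "wr \<alpha> 0 x \<le> f x + f (- x)" .
    then show "ennreal (wr \<alpha> 0 x) \<le> ennreal (f x) + ennreal (f (- x))"
      by (simp add: ennreal_leI f_def flip: ennreal_plus)
  qed
  also have "\<dots> = ennreal (Gamma (\<alpha> + 1)) + ennreal (Gamma (\<alpha> + 1))"
    by (subst nn_integral_add) (auto simp: 1 2)
  also have "\<dots> < \<infinity>" by simp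
  finally show ?thesis .
qed

section \<open>The one-dimensional sampling family\<close>

text \<open>\<open>c k x z\<close> is the coefficient of \<open>f z\<close> in the value at \<open>x\<close> of the difference of two consecutive
  interpolants. The point \<open>x = 0\<close> can be left out because \<open>wr \<alpha> r 0 = 0\<close>, as \<open>0 powr a = 0\<close>.\<close>
locale sampling_family =
  fixes \<alpha> :: real and r :: nat and U :: "real set"
    and c \<kappa> :: "nat \<Rightarrow> real \<Rightarrow> real \<Rightarrow> real" and Z :: "nat \<Rightarrow> real set" and C q :: real
  assumes open_U: "open U" and C_pos: "C > 0"
    and finite_Z: "\<And>k. finite (Z k)" and Z_sub: "\<And>k. Z k \<subseteq> U"
    and card_Z: "\<And>k. real (card (Z k)) \<le> C * 2 ^ k"
    and c_meas: "\<And>k z. (\<lambda>x. c k x z) \<in> borel_measurable borel"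
    and c_bound: "\<And>k x z. \<bar>c k x z\<bar> \<le> C"
    and c_zero: "\<And>k x z. x \<in> U \<Longrightarrow> x \<noteq> 0 \<Longrightarrow> z \<notin> Z k \<Longrightarrow> c k x z = 0"
    and \<kappa>_meas: "\<And>k. (\<lambda>p. \<kappa> k (fst p) (snd p)) \<in> borel_measurable (borel \<Otimes>\<^sub>M borel)"
    and \<kappa>_nonneg: "\<And>k x t. \<kappa> k x t \<ge> 0"
    and c_representable: "\<And>k x. x \<in> U \<Longrightarrow> x \<noteq> 0 \<Longrightarrow>
      representable U r (\<lambda>\<epsilon> t. \<Sum>z\<in>Z k. c k x z * moll \<epsilon> (t - z)) (\<kappa> k x)"
    and \<kappa>_integral: "\<And>k t. t \<in> U \<Longrightarrow>
      (\<integral>\<^sup>+x. ennreal (\<kappa> k x t * wr \<alpha> 0 x) \<partial>lborel) \<le> ennreal (C * q ^ k * wr \<alpha> r t)"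
    and c_abs_sum: "\<And>x K. x \<in> U \<Longrightarrow> x \<noteq> 0 \<Longrightarrow> (\<Sum>z\<in>(\<Union>k\<le>K. Z k). \<bar>\<Sum>k\<le>K. c k x z\<bar>) \<le> C"
    and c_sum_one: "\<And>x. x \<in> U \<Longrightarrow> x \<noteq> 0 \<Longrightarrow>
      \<forall>\<^sub>F K in sequentially. (\<Sum>z\<in>(\<Union>k\<le>K. Z k). \<Sum>k\<le>K. c k x z) = 1"
    and c_local: "\<And>x \<delta>. x \<in> U \<Longrightarrow> x \<noteq> 0 \<Longrightarrow> \<delta> > 0 \<Longrightarrow>
      \<forall>\<^sub>F K in sequentially. \<forall>z. (\<Sum>k\<le>K. c k x z) \<noteq> 0 \<longrightarrow> \<bar>z - x\<bar> < \<delta>"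
    and wr_finite: "(\<integral>\<^sup>+x. ennreal (wr \<alpha> 0 x) \<partial>lborel) < \<infinity>"
    and q_bounds: "0 < q" "q < 1"

text \<open>On the negative half line the rule is the mirror image. Since all nodes are positive, a
  nonzero coefficient forces \<open>z\<close> to lie on the same side of 0 as
  \<open>x\<close>.\<close>

definition sym_interp_coef :: "nat \<Rightarrow> nat \<Rightarrow> real \<Rightarrow> real \<Rightarrow> real" where
  "sym_interp_coef r k x z = interp_coef r (2 ^ k) \<bar>x\<bar> (sgn x * z)"

definition diff_coef :: "nat \<Rightarrow> nat \<Rightarrow> real \<Rightarrow> real \<Rightarrow> real" where
  "diff_coef r k x z = sym_interp_coef r k x z - (if k = 0 then 0 else sym_interp_coef r (k - 1) x z)"

text \<open>Membership in \<open>U\<close> discards the mirrored nodes when \<open>U\<close> is the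
  half line. At \<open>k = 0\<close> truncated subtraction makes the two alternatives
  coincide.\<close>

definition diff_nodes :: "nat \<Rightarrow> real set \<Rightarrow> nat \<Rightarrow> real set" where
  "diff_nodes r U k = {z \<in> U. \<bar>z\<bar> \<in> interp_nodes r (2 ^ k) \<or> \<bar>z\<bar> \<in> interp_nodes r (2 ^ (k - 1))}"

text \<open>A difference of consecutive interpolants is a difference of two interpolation errors, so
  their kernels add. Level 0 is a full interpolant and takes the coarse kernel.\<close>

definition diff_kernel :: "nat \<Rightarrow> real \<Rightarrow> nat \<Rightarrow> real \<Rightarrow> real \<Rightarrow> real" where
  "diff_kernel r K k x t = (if k = 0 then coarse_kernel r K \<bar>x\<bar> \<bar>t\<bar>
     else err_kernel r K (2 ^ (k - 1)) \<bar>x\<bar> \<bar>t\<bar> + err_kernel r K (2 ^ k) \<bar>x\<bar> \<bar>t\<bar>)"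

lemma diff_coef_telescope: "(\<Sum>k\<le>K. diff_coef r k x z) = sym_interp_coef r K x z"
  by (induction K) (auto simp: diff_coef_def)

lemma sym_interp_coef_sum:
  assumes "finite Z" "x \<noteq> 0" "\<And>z. z \<in> interp_nodes r (2 ^ k) \<Longrightarrow> sgn x * z \<in> Z"
  shows "(\<Sum>z\<in>Z. sym_interp_coef r k x z * g z) =
    (\<Sum>j<r. lagrange_coef r (2 ^ k) \<bar>x\<bar> j * g (sgn x * interp_node r (2 ^ k) (cell (2 ^ k) \<bar>x\<bar>) j))"
proof (cases "x > 0")
  case True
  then have "interp_nodes r (2 ^ k) \<subseteq> Z" using assms(3) by auto
  from interp_coef_sum[OF _ assms(1) True this, of g] True show ?thesis by (simp add: sym_interp_coef_def)
next
  case False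
  then have x: "x < 0" using assms by simp
  have sub: "interp_nodes r (2 ^ k) \<subseteq> uminus ` Z" using assms(3) x by force
  have "(\<Sum>z\<in>Z. sym_interp_coef r k x z * g z) = (\<Sum>z\<in>uminus ` Z. interp_coef r (2 ^ k) \<bar>x\<bar> z * g (- z))"
    using x by (subst sum.reindex) (auto simp: sym_interp_coef_def)
  also have "\<dots> = (\<Sum>j<r. lagrange_coef r (2 ^ k) \<bar>x\<bar> j * g (- interp_node r (2 ^ k) (cell (2 ^ k) \<bar>x\<bar>) j))"
    using interp_coef_sum[OF _ _ _ sub, of "\<bar>x\<bar>" "\<lambda>z. g (- z)"] x assms(1) by simp
  finally show ?thesis using x by simp
qed

lemma sym_interp_coef_measurable [measurable]: "(\<lambda>x. sym_interp_coef r k x z) \<in> borel_measurable borel"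
proof -
  have "(\<lambda>x. sym_interp_coef r k x z) = (\<lambda>x. if x > 0 then interp_coef r (2 ^ k) \<bar>x\<bar> z else
      if x < 0 then interp_coef r (2 ^ k) \<bar>x\<bar> (- z) else 0)"
    by (auto simp: sym_interp_coef_def interp_coef_def lagrange_coef_def fun_eq_iff intro!: sum.neutral)
  moreover have [measurable]: "(\<lambda>x. interp_coef r (2 ^ k) \<bar>x\<bar> y) \<in> borel_measurable borel" for y
    by (rule measurable_compose[of abs, OF _ interp_coef_measurable]) simp
  ultimately show ?thesis by simp
qed

lemma sym_interp_coef_abs_sum:
  assumes "finite Z" "x \<noteq> 0" "\<And>z. z \<in> interp_nodes r (2 ^ k) \<Longrightarrow> sgn x * z \<in> Z"
  shows "(\<Sum>z\<in>Z. \<bar>sym_interp_coef r k x z\<bar>) \<le> real r * real r ^ (r - 1)"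
proof -
  \<comment> \<open>With the signs of the coefficients in the role of \<open>g\<close>,
    \<open>sym_interp_coef_sum\<close> also evaluates the sum of absolute values.\<close>
  have "(\<Sum>z\<in>Z. \<bar>sym_interp_coef r k x z\<bar>) = (\<Sum>z\<in>Z. sym_interp_coef r k x z * sgn (sym_interp_coef r k x z))"
    by (simp add: abs_sgn)
  also have "\<dots> = (\<Sum>j<r. lagrange_coef r (2 ^ k) \<bar>x\<bar> j * sgn (sym_interp_coef r k x (sgn x * interp_node r (2 ^ k) (cell (2 ^ k) \<bar>x\<bar>) j)))"
    by (rule sym_interp_coef_sum[OF assms])
  also have "\<dots> \<le> (\<Sum>j<r. real r ^ (r - 1))"
  proof (rule sum_mono)
    fix j assume j: "j \<in> {..<r}"
    have "lagrange_coef r (2 ^ k) \<bar>x\<bar> j * sgn s \<le> \<bar>lagrange_coef r (2 ^ k) \<bar>x\<bar> j\<bar>" for s :: real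
      by (auto simp: sgn_if abs_if)
    also have "\<bar>lagrange_coef r (2 ^ k) \<bar>x\<bar> j\<bar> \<le> real r ^ (r - 1)" using lagrange_coef_bound[of "2 ^ k" j r] j by simp
    finally show "lagrange_coef r (2 ^ k) \<bar>x\<bar> j * sgn (sym_interp_coef r k x (sgn x * interp_node r (2 ^ k) (cell (2 ^ k) \<bar>x\<bar>) j)) \<le> real r ^ (r - 1)" .
  qed
  finally show ?thesis by simp
qed

lemma sym_interp_coef_bound: "\<bar>sym_interp_coef r k x z\<bar> \<le> real r * real r ^ (r - 1)"
proof -
  have "\<bar>sym_interp_coef r k x z\<bar> \<le> (\<Sum>j<r. real r ^ (r - 1))"
    unfolding sym_interp_coef_def interp_coef_def
    by (rule order_trans[OF sum_abs sum_mono]) (use lagrange_coef_bound[of "2 ^ k" _ r] in auto)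
  then show ?thesis by simp
qed

lemma interp_coef_nonzero: "interp_coef r N x z \<noteq> 0 \<Longrightarrow> \<exists>j<r. z = interp_node r N (cell N x) j \<and> 0 < x \<and> x < N"
  unfolding interp_coef_def
  by (rule ccontr, erule notE, rule sum.neutral) (auto simp: lagrange_coef_def)

lemma sym_interp_coef_zero:
  assumes "z \<in> U \<Longrightarrow> \<bar>z\<bar> \<notin> interp_nodes r (2 ^ k)" "x \<in> U" "x \<noteq> 0" "U = UNIV \<or> U = {0<..}"
  shows "sym_interp_coef r k x z = 0"
proof (rule ccontr)
  assume "sym_interp_coef r k x z \<noteq> 0"
  then have "sgn x * z \<in> interp_nodes r (2 ^ k)" unfolding sym_interp_coef_def
    using interp_coef_zero[of "2 ^ k" "sgn x * z" r "\<bar>x\<bar>"] by (metis one_le_numeral one_le_power of_nat_numeral of_nat_power)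
  moreover from interp_nodes_pos[OF this] have "\<bar>z\<bar> = sgn x * z" using assms(3) by (auto simp: sgn_if split: if_splits)
  moreover have "z \<in> U" using interp_nodes_pos[OF calculation(1)] assms(2-4) by (auto simp: sgn_if split: if_splits)
  ultimately show False using assms(1) by simp
qed

lemma sgn_times_interp_nodes:
  assumes "z \<in> interp_nodes r N" "x \<in> U" "x \<noteq> 0" "U = UNIV \<or> U = {0<..}"
  shows "sgn x * z \<in> U" "\<bar>sgn x * z\<bar> = z"
  using interp_nodes_pos[OF assms(1)] assms(2-4) by (auto simp: abs_mult)

text \<open>A node with nonzero coefficient shares the cell of \<open>\<bar>x\<bar>\<close>, up to
  reflection, and the index of that cell is at most sqrt(N * \<bar>x\<bar>), which bounds its
  length.\<close>

lemma sym_interp_coef_local: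
  assumes "sym_interp_coef r k x z \<noteq> 0"
  shows "\<bar>z - x\<bar> \<le> 2 * sqrt (\<bar>x\<bar> / 2 ^ k) + 1 / 2 ^ k"
proof -
  define N where "N = (2::real) ^ k"
  have N: "N \<ge> 1" by (simp add: N_def)
  obtain j where j: "j < r" "sgn x * z = interp_node r N (cell N \<bar>x\<bar>) j" "0 < \<bar>x\<bar>" "\<bar>x\<bar> < N"
    using interp_coef_nonzero assms unfolding sym_interp_coef_def N_def by blast
  define i where "i = cell N \<bar>x\<bar>"
  note cp = cell_props(1-3)[OF N j(3)]
  have "i\<^sup>2 / N \<le> sgn x * z" "sgn x * z \<le> (i + 1)\<^sup>2 / N"
    using interp_node_bounds[OF N cp(1) j(1)] j(2) by (auto simp: i_def)
  then have "\<bar>sgn x * z - \<bar>x\<bar>\<bar> \<le> (2 * i + 1) / N"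
    using cp(2,3) cell_length[of i N] unfolding i_def[symmetric] by (simp add: abs_le_iff)
  moreover have "\<bar>sgn x * z - \<bar>x\<bar>\<bar> = \<bar>z - x\<bar>" using j(3) by (auto simp: sgn_if abs_if)
  moreover have "i \<le> sqrt (N * \<bar>x\<bar>)" unfolding i_def cell_def by linarith
  then have "(2 * i + 1) / N \<le> (2 * sqrt (N * \<bar>x\<bar>) + 1) / N" using N by (intro divide_right_mono) auto
  moreover have "sqrt (N * \<bar>x\<bar>) / N = sqrt (\<bar>x\<bar> / N)"
    using N j(3) by (simp add: real_sqrt_mult real_sqrt_divide field_simps)
  ultimately show ?thesis unfolding N_def[symmetric] by (simp add: add_divide_distrib)
qed

lemma finite_diff_nodes: "finite (diff_nodes r U k)"
proof (rule finite_subset)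
  show "diff_nodes r U k \<subseteq> (interp_nodes r (2 ^ k) \<union> interp_nodes r (2 ^ (k - 1))) \<union> uminus ` (interp_nodes r (2 ^ k) \<union> interp_nodes r (2 ^ (k - 1)))"
    unfolding diff_nodes_def by (force simp: abs_if split: if_splits)
qed (simp add: card_interp_nodes)

text \<open>The 4 accounts for two levels and two signs.\<close>

lemma card_diff_nodes: "real (card (diff_nodes r U k)) \<le> 4 * real r * 2 ^ k"
proof -
  let ?P = "interp_nodes r (2 ^ k) \<union> interp_nodes r (2 ^ (k - 1))"
  have f: "finite ?P" by (simp add: card_interp_nodes)
  have "card (diff_nodes r U k) \<le> card (?P \<union> uminus ` ?P)"
    unfolding diff_nodes_def by (rule card_mono) (use f in \<open>force simp: abs_if split: if_splits\<close>)+
  also have "\<dots> \<le> card ?P + card ?P"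
    by (rule order_trans[OF card_Un_le]) (intro add_mono card_image_le f order_refl)
  also have "card ?P \<le> r * 2 ^ k + r * 2 ^ (k - 1)"
    by (rule order_trans[OF card_Un_le]) (intro add_mono card_interp_nodes)
  also have "r * 2 ^ (k - 1) \<le> r * 2 ^ k" by (intro mult_left_mono power_increasing) auto
  finally have "card (diff_nodes r U k) \<le> 4 * r * 2 ^ k" by simp
  then have "real (card (diff_nodes r U k)) \<le> real (4 * r * 2 ^ k)" using of_nat_mono by blast
  then show ?thesis by simp
qed

text \<open>Everything is done at \<open>\<bar>x\<bar>\<close> on the half line, where the error
  estimates live, and then transported by reflection if \<open>x < 0\<close>. The evenness of
  \<open>moll\<close> matches the reflected nodes with a reflected argument.\<close>

lemma representable_diff_coef:
  assumes U: "U = UNIV \<or> U = {0<..}" and x: "x \<in> U" "x \<noteq> 0"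
    and E: "\<And>N x. N \<ge> 1 \<Longrightarrow> x > 0 \<Longrightarrow> representable {0<..} r
    (\<lambda>\<epsilon> t. moll \<epsilon> (t - x) - (\<Sum>j<r. lagrange_coef r N x j * moll \<epsilon> (t - interp_node r N (cell N x) j))) (err_kernel r K1 N x)"
    and L: "\<And>x. x > 0 \<Longrightarrow> representable {0<..} r
    (\<lambda>\<epsilon> t. (\<Sum>j<r. lagrange_coef r 1 x j * moll \<epsilon> (t - interp_node r 1 (cell 1 x) j))) (coarse_kernel r K2 x)"
    and K: "K1 \<le> K" "K2 \<le> K" "K1 > 0" "K2 > 0"
  shows "representable U r (\<lambda>\<epsilon> t. \<Sum>z\<in>diff_nodes r U k. diff_coef r k x z * moll \<epsilon> (t - z)) (diff_kernel r K k x)"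
proof -
  define P where "P k \<epsilon> t = (\<Sum>j<r. lagrange_coef r (2 ^ k) \<bar>x\<bar> j * moll \<epsilon> (t - interp_node r (2 ^ k) (cell (2 ^ k) \<bar>x\<bar>) j))" for k \<epsilon> t
  have x0: "\<bar>x\<bar> > 0" using x by simp
  have s: "sgn x = 1 \<or> sgn x = -1" using x by (auto simp: sgn_if)
  have sum1: "(\<Sum>z\<in>diff_nodes r U k. sym_interp_coef r k' x z * moll \<epsilon> (t - z)) = P k' \<epsilon> (sgn x * t)"
    if "k' = k \<or> k' = k - 1" for k' \<epsilon> t
  proof -
    have mem: "sgn x * z \<in> diff_nodes r U k" if "z \<in> interp_nodes r (2 ^ k')" for z
      using sgn_times_interp_nodes[OF that x U] that \<open>k' = k \<or> k' = k - 1\<close> by (auto simp: diff_nodes_def)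
    have "moll \<epsilon> (t - sgn x * y) = moll \<epsilon> (sgn x * t - y)" for y
      using s moll_even[of \<epsilon> "t + y"] by (auto simp: algebra_simps)
    moreover have "(\<Sum>z\<in>diff_nodes r U k. sym_interp_coef r k' x z * moll \<epsilon> (t - z)) =
      (\<Sum>j<r. lagrange_coef r (2 ^ k') \<bar>x\<bar> j * moll \<epsilon> (t - sgn x * interp_node r (2 ^ k') (cell (2 ^ k') \<bar>x\<bar>) j))"
      by (rule sym_interp_coef_sum[OF finite_diff_nodes x(2) mem])
    ultimately show ?thesis unfolding P_def by simp
  qed
  define \<Psi> where "\<Psi> \<epsilon> t = (if k = 0 then P 0 \<epsilon> t else P k \<epsilon> t - P (k - 1) \<epsilon> t)" for \<epsilon> t
  have eq: "(\<lambda>\<epsilon> t. \<Sum>z\<in>diff_nodes r U k. diff_coef r k x z * moll \<epsilon> (t - z)) = (\<lambda>\<epsilon> t. \<Psi> \<epsilon> (sgn x * t))"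
  proof (intro ext)
    fix \<epsilon> t
    have "(\<Sum>z\<in>diff_nodes r U k. diff_coef r k x z * moll \<epsilon> (t - z)) =
      (\<Sum>z\<in>diff_nodes r U k. sym_interp_coef r k x z * moll \<epsilon> (t - z)) -
      (if k = 0 then 0 else (\<Sum>z\<in>diff_nodes r U k. sym_interp_coef r (k - 1) x z * moll \<epsilon> (t - z)))"
      by (simp add: diff_coef_def left_diff_distrib sum_subtractf)
    then show "(\<Sum>z\<in>diff_nodes r U k. diff_coef r k x z * moll \<epsilon> (t - z)) = \<Psi> \<epsilon> (sgn x * t)"
      using sum1[of k] sum1[of "k - 1"] by (auto simp: \<Psi>_def)
  qed
  \<comment> \<open>The kernel vanishes for \<open>t \<le> 0\<close> and is linear in its constant,
    so passing to \<open>\<bar>t\<bar>\<close> and to the larger \<open>K\<close> only increases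
    it.\<close>
  have kEm: "err_kernel r K1 N y t \<le> err_kernel r K N y \<bar>t\<bar>" if "N \<ge> 1" for N y t
  proof -
    have sc: "err_kernel r B N y s = B * err_kernel r 1 N y s" for B s by (simp add: err_kernel_def)
    have "err_kernel r 1 N y t \<le> err_kernel r 1 N y \<bar>t\<bar>"
      using err_kernel_nonneg[of 1 N r y "\<bar>t\<bar>"] that by (cases "t > 0") (auto simp: err_kernel_def[of r 1 N y t])
    then have "K1 * err_kernel r 1 N y t \<le> K * err_kernel r 1 N y \<bar>t\<bar>"
      using K that err_kernel_nonneg[of 1 N r y t] by (intro mult_mono) auto
    then show ?thesis by (simp add: sc[of K1] sc[of K])
  qed
  have pos: "representable {0<..} r \<Psi> (\<lambda>t. diff_kernel r K k \<bar>x\<bar> t)"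
  proof (cases "k = 0")
    case True
    have "representable {0<..} r (\<lambda>\<epsilon> t. P 0 \<epsilon> t) (coarse_kernel r K2 \<bar>x\<bar>)" unfolding P_def using L[OF x0] by simp
    then have "representable {0<..} r \<Psi> (coarse_kernel r K2 \<bar>x\<bar>)" using True by (simp add: \<Psi>_def[abs_def])
    then show ?thesis
    proof (rule representable_mono)
      show "coarse_kernel r K2 \<bar>x\<bar> t \<le> diff_kernel r K k \<bar>x\<bar> t" for t
      proof (cases "t \<ge> 0")
        case False
        have "0 \<le> 1 / (2 * real r)" by simp
        then have "\<not> 1 / (2 * real r) \<le> t" using False by linarith
        then have "coarse_kernel r K2 \<bar>x\<bar> t = 0" by (simp add: coarse_kernel_def)
        then show ?thesis using True K by (simp add: diff_kernel_def coarse_kernel_nonneg)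
      qed (use True K x0 in \<open>auto simp: diff_kernel_def coarse_kernel_def\<close>)
    qed simp
  next
    case False
    \<comment> \<open>The mass at \<open>\<bar>x\<bar>\<close> is added and subtracted, which
      exhibits the difference of interpolants as a difference of errors.\<close>
    have "representable {0<..} r (\<lambda>\<epsilon> t. (moll \<epsilon> (t - \<bar>x\<bar>) - P (k - 1) \<epsilon> t) - (moll \<epsilon> (t - \<bar>x\<bar>) - P k \<epsilon> t))
       (\<lambda>t. err_kernel r K1 (2 ^ (k - 1)) \<bar>x\<bar> t + err_kernel r K1 (2 ^ k) \<bar>x\<bar> t)"
      unfolding P_def by (intro representable_diff E x0) auto
    also have "(\<lambda>\<epsilon> t. (moll \<epsilon> (t - \<bar>x\<bar>) - P (k - 1) \<epsilon> t) - (moll \<epsilon> (t - \<bar>x\<bar>) - P k \<epsilon> t)) = \<Psi>"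
      using False by (auto simp: \<Psi>_def fun_eq_iff)
    finally show ?thesis
    proof (rule representable_mono)
      show "err_kernel r K1 (2 ^ (k - 1)) \<bar>x\<bar> t + err_kernel r K1 (2 ^ k) \<bar>x\<bar> t \<le> diff_kernel r K k \<bar>x\<bar> t" for t
        using False kEm by (simp add: diff_kernel_def add_mono)
    qed simp
  qed
  show ?thesis
  proof (cases "x > 0")
    case True
    show ?thesis unfolding eq using True
    by (simp, intro representable_mono[OF pos]) (use U in auto)
  next
    case False
    then have "x < 0" using x by simp
    have "representable (uminus ` {0<..}) r (\<lambda>\<epsilon> t. \<Psi> \<epsilon> (- t)) (\<lambda>t. diff_kernel r K k \<bar>x\<bar> (- t))" by (rule representable_reflect[OF pos])
    then have "representable U r (\<lambda>\<epsilon> t. \<Psi> \<epsilon> (- t)) (diff_kernel r K k x)"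
      by (rule representable_mono) (use \<open>x < 0\<close> U x in \<open>auto simp: diff_kernel_def\<close>)
    then show ?thesis unfolding eq using \<open>x < 0\<close> by simp
  qed
qed

theorem sampling_family_exists:
  assumes r: "r \<ge> 1" and \<alpha>: "\<alpha> > -1" and U: "U = UNIV \<or> U = {0<..}"
  shows "\<exists>\<kappa> C. sampling_family \<alpha> r U (diff_coef r) \<kappa> (diff_nodes r U) C ((1 / sqrt 2) ^ r)"
proof -
  \<comment> \<open>Doubling \<open>N\<close> multiplies the factor \<open>(1 / sqrt N) ^ r\<close>
    of \<open>nn_integral_err_kernel\<close> by \<open>q\<close>.\<close>
  define q where "q = (1 / sqrt 2 :: real) ^ r"
  have q: "0 < q" "q < 1" using r unfolding q_def by (auto intro!: power_Suc_less_one simp: power_less_one_iff)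
  obtain K1 where K1: "K1 > 0" and E: "\<And>N x. N \<ge> 1 \<Longrightarrow> x > 0 \<Longrightarrow> representable {0<..} r
    (\<lambda>\<epsilon> t. moll \<epsilon> (t - x) - (\<Sum>j<r. lagrange_coef r N x j * moll \<epsilon> (t - interp_node r N (cell N x) j))) (err_kernel r K1 N x)"
    using representable_interpolation_error[OF r] by blast
  obtain K2 where K2: "K2 > 0" and L: "\<And>x. x > 0 \<Longrightarrow> representable {0<..} r
    (\<lambda>\<epsilon> t. (\<Sum>j<r. lagrange_coef r 1 x j * moll \<epsilon> (t - interp_node r 1 (cell 1 x) j))) (coarse_kernel r K2 x)"
    using representable_coarsest_interpolation[OF r] by blast
  define K where "K = max K1 K2"
  have K: "K1 \<le> K" "K2 \<le> K" "K > 0" using K1 by (auto simp: K_def)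
  obtain A where A: "A > 0" and IA: "\<And>N t. N \<ge> 1 \<Longrightarrow> t > 0 \<Longrightarrow>
    (\<integral>\<^sup>+x. ennreal (err_kernel r K N x t * wr \<alpha> 0 x) \<partial>lborel) \<le> ennreal (A * (1 / sqrt N) ^ r * wr \<alpha> r t)"
    using nn_integral_err_kernel[OF r \<alpha> K(3)] by blast
  obtain B where B: "B > 0" and IB: "\<And>t. t > 0 \<Longrightarrow>
    (\<integral>\<^sup>+x. ennreal (coarse_kernel r K x t * wr \<alpha> 0 x) \<partial>lborel) \<le> ennreal (B * wr \<alpha> r t)"
    using nn_integral_coarse_kernel[OF r \<alpha> K(3)] by blast
  define H where "H = real r * real r ^ (r - 1)"
  have H: "H \<ge> 0" by (simp add: H_def)
  \<comment> \<open>One summand per bound: node counts, coefficients, kernels. In the last, the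
    outer 2 comes from folding the line onto the half line, the inner 2 from the two error kernels,
    and \<open>1 / q\<close> from the coarser level \<open>k - 1\<close>.\<close>
  define C where "C = 4 * real r + 2 * H + 2 * (B + 2 * (A * (1 / q)))"
  have C: "C > 0" "4 * real r \<le> C" "2 * H \<le> C" "H \<le> C" "2 * B \<le> C" "4 * (A * (1 / q)) \<le> C"
    using r H A B q by (auto simp: C_def intro!: add_pos_nonneg)
  have err_kernel_m [measurable]: "(\<lambda>x. err_kernel r K N x t) \<in> borel_measurable borel" for N t
    unfolding err_kernel_def by measurable
  have coarse_kernel_m [measurable]: "(\<lambda>x. coarse_kernel r K x t) \<in> borel_measurable borel" for t
    unfolding coarse_kernel_def by measurable
  have scaled: "(1 / sqrt (2 ^ k)) ^ r = q ^ k" for k :: nat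
    by (simp add: q_def real_sqrt_power power_one_over mult.commute flip: power_mult)
  have fold: "(\<integral>\<^sup>+x. ennreal (h \<bar>x\<bar> * wr \<alpha> 0 x) \<partial>lborel) \<le> 2 * (\<integral>\<^sup>+x. ennreal (h x * wr \<alpha> 0 x) \<partial>lborel)"
    if [measurable]: "h \<in> borel_measurable borel" and h0: "\<And>x. h x \<ge> 0" for h :: "real \<Rightarrow> real"
  proof -
    have 1: "(\<integral>\<^sup>+x. ennreal (h (- x) * wr \<alpha> 0 (- x)) \<partial>lborel) = (\<integral>\<^sup>+x. ennreal (h x * wr \<alpha> 0 x) \<partial>lborel)"
      using nn_integral_real_affine[of "\<lambda>x. ennreal (h x * wr \<alpha> 0 x)" "-1" 0] by simp
    have "(\<integral>\<^sup>+x. ennreal (h \<bar>x\<bar> * wr \<alpha> 0 x) \<partial>lborel) \<le>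
      (\<integral>\<^sup>+x. ennreal (h x * wr \<alpha> 0 x) + ennreal (h (- x) * wr \<alpha> 0 (- x)) \<partial>lborel)"
    proof (rule nn_integral_mono)
      fix x
      have "wr \<alpha> 0 (- x) = wr \<alpha> 0 x" by (simp add: wr_def)
      then have "h \<bar>x\<bar> * wr \<alpha> 0 x \<le> h x * wr \<alpha> 0 x + h (- x) * wr \<alpha> 0 (- x)"
        using h0[of x] h0[of "- x"] wr_nonneg[of \<alpha> 0 x] by (cases "x \<ge> 0") auto
      then show "ennreal (h \<bar>x\<bar> * wr \<alpha> 0 x) \<le> ennreal (h x * wr \<alpha> 0 x) + ennreal (h (- x) * wr \<alpha> 0 (- x))"
        using h0 wr_nonneg by (simp add: ennreal_leI flip: ennreal_plus)
    qed
    also have "\<dots> = 2 * (\<integral>\<^sup>+x. ennreal (h x * wr \<alpha> 0 x) \<partial>lborel)"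
      by (subst nn_integral_add) (auto simp: 1 mult_2)
    finally show ?thesis .
  qed
  have wr_abs: "wr \<alpha> r \<bar>t\<bar> = wr \<alpha> r t" for t by (simp add: wr_def)
  have "sampling_family \<alpha> r U (diff_coef r) (diff_kernel r K) (diff_nodes r U) C q"
  proof
    fix k x t
    show "finite (diff_nodes r U k)" by (rule finite_diff_nodes)
    show "diff_nodes r U k \<subseteq> U" by (auto simp: diff_nodes_def)
    show "real (card (diff_nodes r U k)) \<le> C * 2 ^ k"
      by (rule order_trans[OF card_diff_nodes]) (use C in auto)
    show "(\<lambda>x. diff_coef r k x z) \<in> borel_measurable borel" for z unfolding diff_coef_def by measurable
    show "\<bar>diff_coef r k x z\<bar> \<le> C" for z
      using sym_interp_coef_bound[of r k x z] sym_interp_coef_bound[of r "k - 1" x z] C H unfolding H_def[symmetric] diff_coef_def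
      by (auto simp: abs_le_iff)
    show "(\<lambda>p. diff_kernel r K k (fst p) (snd p)) \<in> borel_measurable (borel \<Otimes>\<^sub>M borel)"
      unfolding diff_kernel_def err_kernel_def coarse_kernel_def by measurable
    show "diff_kernel r K k x t \<ge> 0" using K by (simp add: diff_kernel_def err_kernel_nonneg coarse_kernel_nonneg)
    show "(\<integral>\<^sup>+x. ennreal (diff_kernel r K k x t * wr \<alpha> 0 x) \<partial>lborel) \<le> ennreal (C * q ^ k * wr \<alpha> r t)"
    proof (cases "t = 0")
      case True
      then have "diff_kernel r K k x t = 0" for x using r by (simp add: diff_kernel_def err_kernel_def coarse_kernel_def)
      then show ?thesis by simp
    next
      case t: False
      show ?thesis
      proof (cases "k = 0")
        case True
        have "(\<integral>\<^sup>+x. ennreal (diff_kernel r K k x t * wr \<alpha> 0 x) \<partial>lborel) \<le>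
          2 * (\<integral>\<^sup>+x. ennreal (coarse_kernel r K x \<bar>t\<bar> * wr \<alpha> 0 x) \<partial>lborel)"
          unfolding diff_kernel_def if_P[OF True] by (rule fold[OF coarse_kernel_m coarse_kernel_nonneg]) (use K in auto)
        also have "\<dots> \<le> 2 * ennreal (B * wr \<alpha> r t)"
          using IB[of "\<bar>t\<bar>"] t by (intro mult_left_mono) (auto simp: wr_abs)
        also have "\<dots> = ennreal (2 * (B * wr \<alpha> r t))" using B by (simp add: ennreal_mult wr_nonneg)
        also have "\<dots> \<le> ennreal (C * q ^ k * wr \<alpha> r t)"
          using mult_right_mono[OF C(5) wr_nonneg[of \<alpha> r t]] True by (intro ennreal_leI) simp
        finally show ?thesis .
      next
        case False
        have "(\<integral>\<^sup>+x. ennreal (diff_kernel r K k x t * wr \<alpha> 0 x) \<partial>lborel) \<le>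
          2 * (\<integral>\<^sup>+x. ennreal ((err_kernel r K (2 ^ (k - 1)) x \<bar>t\<bar> + err_kernel r K (2 ^ k) x \<bar>t\<bar>) * wr \<alpha> 0 x) \<partial>lborel)"
          unfolding diff_kernel_def if_not_P[OF False]
          by (rule fold[OF borel_measurable_add[OF err_kernel_m err_kernel_m] add_nonneg_nonneg[OF err_kernel_nonneg err_kernel_nonneg]]) (use K in auto)
        also have "(\<integral>\<^sup>+x. ennreal ((err_kernel r K (2 ^ (k - 1)) x \<bar>t\<bar> + err_kernel r K (2 ^ k) x \<bar>t\<bar>) * wr \<alpha> 0 x) \<partial>lborel)
          = (\<integral>\<^sup>+x. ennreal (err_kernel r K (2 ^ (k - 1)) x \<bar>t\<bar> * wr \<alpha> 0 x) \<partial>lborel)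
          + (\<integral>\<^sup>+x. ennreal (err_kernel r K (2 ^ k) x \<bar>t\<bar> * wr \<alpha> 0 x) \<partial>lborel)"
          using K by (subst nn_integral_add[symmetric])
            (auto simp: distrib_right err_kernel_nonneg wr_nonneg intro!: nn_integral_cong)
        also have "\<dots> \<le> ennreal (A * q ^ (k - 1) * wr \<alpha> r t) + ennreal (A * q ^ k * wr \<alpha> r t)"
          using IA[of "2 ^ (k - 1)" "\<bar>t\<bar>"] IA[of "2 ^ k" "\<bar>t\<bar>"] t
          unfolding scaled wr_abs by (intro add_mono) auto
        also have "\<dots> = ennreal ((A * q ^ (k - 1) + A * q ^ k) * wr \<alpha> r t)"
          using A q by (simp add: wr_nonneg distrib_right flip: ennreal_plus)
        also have "2 * \<dots> = ennreal (2 * (A * q ^ (k - 1) + A * q ^ k) * wr \<alpha> r t)"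
        proof -
          have "2 * ennreal y = ennreal (2 * y)" if "y \<ge> 0" for y using that by (simp add: ennreal_mult)
          then show ?thesis using A q unfolding mult.assoc by (simp add: wr_nonneg)
        qed
        also have "\<dots> \<le> ennreal (C * q ^ k * wr \<alpha> r t)"
        proof (intro ennreal_leI mult_right_mono wr_nonneg)
          have qk: "q ^ (k - 1) = q ^ k * (1 / q)" using False q by (cases k) auto
          have "q ^ k * 1 \<le> q ^ k * (1 / q)" using q by (intro mult_left_mono) auto
          then have "A * q ^ (k - 1) + A * q ^ k \<le> A * (q ^ k * (1 / q)) + A * (q ^ k * (1 / q))"
            unfolding qk using A q by (intro add_mono mult_left_mono) auto
          also have "\<dots> = 2 * (A * (1 / q)) * q ^ k" by simp
          finally have "2 * (A * q ^ (k - 1) + A * q ^ k) \<le> 4 * (A * (1 / q)) * q ^ k" by simp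
          also have "\<dots> \<le> C * q ^ k" using C q by (intro mult_right_mono) auto
          finally show "2 * (A * q ^ (k - 1) + A * q ^ k) \<le> C * q ^ k" .
        qed
        finally show ?thesis by (simp add: mult_left_mono)
      qed
    qed
    assume x: "x \<in> U" "x \<noteq> 0"
    show "diff_coef r k x z = 0" if "z \<notin> diff_nodes r U k" for z
    proof -
      have "sym_interp_coef r k' x z = 0" if "k' = k \<or> k' = k - 1" for k'
        by (rule sym_interp_coef_zero[OF _ x U]) (use that \<open>z \<notin> diff_nodes r U k\<close> in \<open>auto simp: diff_nodes_def\<close>)
      then show ?thesis by (simp add: diff_coef_def)
    qed
    show "representable U r (\<lambda>\<epsilon> t. \<Sum>z\<in>diff_nodes r U k. diff_coef r k x z * moll \<epsilon> (t - z)) (diff_kernel r K k x)"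
      by (rule representable_diff_coef[OF U x E L]) (use K1 K2 K in auto)
    have mem: "sgn x * z \<in> (\<Union>k\<le>n. diff_nodes r U k)" if "z \<in> interp_nodes r (2 ^ n)" for z n
      using sgn_times_interp_nodes[OF that x U] that by (auto simp: diff_nodes_def)
    have fin: "finite (\<Union>k\<le>n. diff_nodes r U k)" for n by (simp add: finite_diff_nodes)
    show "(\<Sum>z\<in>(\<Union>k\<le>n. diff_nodes r U k). \<bar>\<Sum>k\<le>n. diff_coef r k x z\<bar>) \<le> C" for n
      unfolding diff_coef_telescope
      by (rule order_trans[OF sym_interp_coef_abs_sum[OF fin x(2) mem]]) (use C in \<open>auto simp: H_def\<close>)
    have pw: "filterlim (\<lambda>n. (2::real) ^ n) at_top sequentially"
      by (rule filterlim_at_top_mono[OF filterlim_real_sequentially])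
        (auto intro!: always_eventually less_imp_le of_nat_less_two_power)
    \<comment> \<open>As soon as \<open>2 ^ n\<close> exceeds \<open>\<bar>x\<bar>\<close>, the
      point is in the interpolated range, and the sum of the coefficients is the zeroth
      moment.\<close>
    show "\<forall>\<^sub>F n in sequentially. (\<Sum>z\<in>(\<Union>k\<le>n. diff_nodes r U k). \<Sum>k\<le>n. diff_coef r k x z) = 1"
      using filterlim_at_top_dense[THEN iffD1, OF pw, rule_format, of "\<bar>x\<bar>"]
    proof eventually_elim
      case (elim n)
      have "(\<Sum>z\<in>(\<Union>k\<le>n. diff_nodes r U k). sym_interp_coef r n x z * 1) = (\<Sum>j<r. lagrange_coef r (2 ^ n) \<bar>x\<bar> j * 1)"
        by (rule sym_interp_coef_sum[OF fin x(2) mem])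
      also have "\<dots> = 1"
        using lagrange_coef_moment[of "2 ^ n" "\<bar>x\<bar>" 0 r 0] r elim x by simp
      finally show ?case unfolding diff_coef_telescope by simp
    qed
    show "\<forall>\<^sub>F n in sequentially. \<forall>z. (\<Sum>k\<le>n. diff_coef r k x z) \<noteq> 0 \<longrightarrow> \<bar>z - x\<bar> < \<delta>" if "\<delta> > 0" for \<delta>
    proof -
      have "(\<lambda>n. 2 * sqrt (\<bar>x\<bar> / 2 ^ n) + 1 / 2 ^ n) \<longlonglongrightarrow> 2 * sqrt 0 + 0"
        by (intro tendsto_add tendsto_mult tendsto_const tendsto_real_sqrt
            tendsto_divide_0[OF tendsto_const filterlim_at_top_imp_at_infinity[OF pw]])
      then have "\<forall>\<^sub>F n in sequentially. 2 * sqrt (\<bar>x\<bar> / 2 ^ n) + 1 / 2 ^ n < \<delta>"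
        using that by (intro order_tendstoD) auto
      then show ?thesis unfolding diff_coef_telescope
        by eventually_elim (use sym_interp_coef_local in \<open>force\<close>)
    qed
  next
    show "(\<integral>\<^sup>+x. ennreal (wr \<alpha> 0 x) \<partial>lborel) < \<infinity>" by (rule nn_integral_wr_finite[OF \<alpha>])
  qed (use C q U in auto)
  then show ?thesis unfolding q_def by blast
qed

section \<open>Tensor products\<close>

definition tensor :: "('d::finite \<Rightarrow> real \<Rightarrow> real) \<Rightarrow> real^'d \<Rightarrow> real" where
  "tensor u x = (\<Prod>i\<in>UNIV. u i (x $ i))"

definition grid :: "('d::finite \<Rightarrow> real set) \<Rightarrow> (real^'d) set" where
  "grid Z = {z. \<forall>i. z $ i \<in> Z i}"

lemma bij_betw_grid: "bij_betw (\<lambda>g. \<chi> i. g i) (PiE UNIV Z) (grid Z :: (real^'d::finite) set)"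
  by (rule bij_betwI[where g = "\<lambda>z i. z $ i"]) (auto simp: grid_def PiE_def Pi_def vec_eq_iff)

lemma finite_grid: "(\<And>i. finite (Z i)) \<Longrightarrow> finite (grid Z :: (real^'d::finite) set)"
  using bij_betw_finite[OF bij_betw_grid[of Z]] finite_PiE[of UNIV Z] by auto

lemma card_grid: "card (grid Z :: (real^'d::finite) set) = (\<Prod>i\<in>UNIV. card (Z i))"
  using bij_betw_same_card[OF bij_betw_grid[of Z]] card_PiE[of UNIV Z] by auto

lemma prod_sum_grid:
  fixes f :: "'d::finite \<Rightarrow> real \<Rightarrow> real"
  assumes "\<And>i. finite (Z i)"
  shows "(\<Prod>i\<in>UNIV. \<Sum>y\<in>Z i. f i y) = (\<Sum>z\<in>grid Z. \<Prod>i\<in>UNIV. f i (z $ i))"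
proof -
  have "(\<Prod>i\<in>UNIV. \<Sum>y\<in>Z i. f i y) = (\<Sum>g\<in>PiE UNIV Z. \<Prod>i\<in>UNIV. f i (g i))"
    by (rule prod_sum_PiE) (use assms in auto)
  also have "\<dots> = (\<Sum>z\<in>grid Z. \<Prod>i\<in>UNIV. f i (z $ i))"
    using sum.reindex_bij_betw[OF bij_betw_grid[of Z], of "\<lambda>z. \<Prod>i\<in>UNIV. f i (z $ i)"] by simp
  finally show ?thesis .
qed

lemma nn_integral_prod_vec:
  fixes g :: "'d::finite \<Rightarrow> real \<Rightarrow> ennreal"
  assumes [measurable]: "\<And>i. g i \<in> borel_measurable borel"
  shows "(\<integral>\<^sup>+x. (\<Prod>i\<in>UNIV. g i (x $ i)) \<partial>lborel) = (\<Prod>i\<in>UNIV. \<integral>\<^sup>+t. g i t \<partial>lborel)"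
proof -
  \<comment> \<open>The product formula for \<open>lborel\<close> runs over \<open>Basis\<close>;
    \<open>h\<close> carries the factors from coordinates to axis vectors.\<close>
  define h where "h b = g (THE i. b = axis i (1::real))" for b
  have h: "h (axis i 1) = g i" for i
    unfolding h_def by (rule arg_cong[of _ _ g]) (auto simp: axis_eq_axis intro: the_equality)
  have B: "(Basis :: (real^'d) set) = (\<lambda>i. axis i 1) ` UNIV" by (auto simp: Basis_vec_def)
  have inj: "inj (\<lambda>i::'d. axis i (1::real))" by (auto simp: inj_on_def axis_eq_axis)
  have "(\<integral>\<^sup>+x. (\<Prod>b\<in>Basis. h b (x \<bullet> b)) \<partial>(lborel :: (real^'d) measure)) = (\<Prod>b\<in>(Basis :: (real^'d) set). (\<integral>\<^sup>+x. h b x \<partial>lborel))"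
    by (rule nn_integral_lborel_prod) (auto simp: B h)
  then show ?thesis
    unfolding B by (subst (asm) (1 2) prod.reindex) (auto simp: inj h cart_eq_inner_axis o_def)
qed

lemma tensor_measurable [measurable]:
  assumes [measurable]: "\<And>i. u i \<in> borel_measurable borel"
  shows "tensor u \<in> borel_measurable borel"
proof -
  have [measurable]: "(\<lambda>x::real^'a. x $ i) \<in> borel_measurable borel" for i
    by (intro borel_measurable_continuous_onI continuous_intros)
  show ?thesis unfolding tensor_def by measurable
qed

lemma nn_integral_tensor:
  assumes "\<And>i. u i \<in> borel_measurable borel" "\<And>i t. u i t \<ge> 0"
  shows "(\<integral>\<^sup>+x. ennreal (tensor u x) \<partial>lborel) = (\<Prod>i\<in>UNIV. \<integral>\<^sup>+t. ennreal (u i t) \<partial>lborel)"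
  unfolding tensor_def using nn_integral_prod_vec[of "\<lambda>i t. ennreal (u i t)"] assms
  by (simp add: prod_ennreal)

lemma tensor_eq_0: "u i (x $ i) = 0 \<Longrightarrow> tensor u x = 0"
  unfolding tensor_def by (rule prod_zero) auto

lemma continuous_tensor:
  assumes "\<And>i. continuous_on UNIV (u i)" shows "continuous_on S (tensor u)"
  unfolding tensor_def
  by (intro continuous_on_prod continuous_on_compose2[OF assms] continuous_intros) auto

section \<open>Derivatives of tensor products\<close>

lemma tensor_shift:
  "tensor u (x + t *\<^sub>R axis i 1) = u i (x $ i + t) * (\<Prod>j\<in>UNIV - {i}. u j (x $ j))"
  unfolding tensor_def by (subst prod.remove[of UNIV i]) (auto simp: axis_def intro!: prod.cong)

lemma tensor_upd: "tensor (u(i := v)) x = v (x $ i) * (\<Prod>j\<in>UNIV - {i}. u j (x $ j))"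
  unfolding tensor_def by (subst prod.remove[of UNIV i]) (auto intro!: prod.cong)

lemma tensor_has_deriv:
  assumes "smooth (u i)"
  shows "((\<lambda>t. tensor u (x + t *\<^sub>R axis i 1)) has_real_derivative tensor (u(i := deriv (u i))) x) (at 0)"
proof -
  have "((\<lambda>t. u i (x $ i + t)) has_real_derivative deriv (u i) (x $ i + 0) * 1) (at 0)"
    by (rule DERIV_chain2[OF smooth_has_deriv[OF assms]]) (auto intro!: derivative_eq_intros)
  from DERIV_cmult_right[OF this] show ?thesis unfolding tensor_shift tensor_upd by simp
qed

lemma pdiff_tensor: "smooth (u i) \<Longrightarrow> pdiff i (tensor u) = tensor (u(i := deriv (u i)))"
  unfolding pdiff_def using DERIV_imp_deriv[OF tensor_has_deriv] by blast

text \<open>Differentiating in one direction changes only that factor, so just the number of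
  occurrences of each direction matters and all orderings of a multi-index agree.\<close>

lemma pdiffs_tensor:
  assumes "\<And>i. smooth (u i)"
  shows "pdiffs is (tensor u) = tensor (\<lambda>j. (deriv ^^ count (mset is) j) (u j))"
  using assms
proof (induction "is" arbitrary: u)
  case (Cons i "is")
  have "pdiffs (i # is) (tensor u) = pdiffs is (tensor (u(i := deriv (u i))))"
    using Cons.prems by (simp add: pdiff_tensor)
  also have "\<dots> = tensor (\<lambda>j. (deriv ^^ count (mset is) j) ((u(i := deriv (u i))) j))"
    by (rule Cons.IH) (use Cons.prems smooth_deriv in auto)
  also have "\<dots> = tensor (\<lambda>j. (deriv ^^ count (mset (i # is)) j) (u j))"
    by (rule arg_cong[of _ _ tensor]) (auto simp: fun_eq_iff funpow_swap1)
  finally show ?case .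
qed simp

lemma compact_box_vec:
  assumes "\<And>i. compact (K i)" shows "compact {x::real^'d::finite. \<forall>i. x $ i \<in> K i}"
proof -
  have "closed {x::real^'d. \<forall>i. x $ i \<in> K i}"
    by (intro closed_Collect_all closed_vimage[of _ "\<lambda>x. x $ _", unfolded vimage_def] compact_imp_closed assms continuous_intros)
  moreover have "bounded {x::real^'d. \<forall>i. x $ i \<in> K i}"
  proof -
    have "\<forall>i. \<exists>B. \<forall>t\<in>K i. \<bar>t\<bar> \<le> B" using compact_imp_bounded[OF assms] by (simp add: bounded_iff)
    then obtain B where B: "\<And>i t. t \<in> K i \<Longrightarrow> \<bar>t\<bar> \<le> B i" by metis
    have "norm x \<le> (\<Sum>i\<in>UNIV. B i)" if "\<forall>i. x $ i \<in> K i" for x :: "real^'d"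
      by (rule order_trans[OF norm_le_l1_cart sum_mono]) (use that B in auto)
    then show ?thesis unfolding bounded_iff by blast
  qed
  ultimately show ?thesis by (simp add: compact_eq_bounded_closed)
qed

lemma tensor_support:
  assumes "\<And>i. cc_smooth U (u i)"
  obtains K :: "(real^'d::finite) set" where "compact K" "K \<subseteq> cube U" "\<And>x. x \<notin> K \<Longrightarrow> tensor u x = 0"
proof -
  have "\<forall>i. \<exists>K. compact K \<and> K \<subseteq> U \<and> (\<forall>t. t \<notin> K \<longrightarrow> u i t = 0)" using assms by (simp add: cc_smooth_def)
  then obtain K where K: "\<And>i. compact (K i)" "\<And>i. K i \<subseteq> U" "\<And>i t. t \<notin> K i \<Longrightarrow> u i t = 0" by metis
  show ?thesis
  proof (rule that[of "{x. \<forall>i. x $ i \<in> K i}"])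
    show "tensor u x = 0" if "x \<notin> {x. \<forall>i. x $ i \<in> K i}" for x
      using that K(3) unfolding tensor_def by (auto intro: prod_zero)
    show "{x. \<forall>i. x $ i \<in> K i} \<subseteq> cube U" using K(2) unfolding cube_def by blast
  qed (rule compact_box_vec[OF K(1)])
qed

lemma test_fun_tensor:
  fixes u :: "'d::finite \<Rightarrow> real \<Rightarrow> real"
  assumes "\<And>i. cc_smooth U (u i)" shows "test_fun (cube U) (tensor u)"
proof -
  have s: "\<And>i. smooth (u i)" using assms by (simp add: cc_smooth_def)
  obtain K :: "(real^'d) set" where K: "compact K" "K \<subseteq> cube U" "\<And>x. x \<notin> K \<Longrightarrow> tensor u x = 0"
    using tensor_support[where u = u and U = U, OF assms] by blast
  have sub: "closure {x. tensor u x \<noteq> 0} \<subseteq> K"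
    by (rule closure_minimal[OF _ compact_imp_closed[OF K(1)]]) (use K(3) in blast)
  have "compact (closure {x. tensor u x \<noteq> 0})"
    using sub K(1) by (meson bounded_subset closed_closure compact_eq_bounded_closed)
  then show ?thesis unfolding test_fun_def
  proof (intro conjI allI)
    fix "is" i x
    show "continuous_on UNIV (pdiffs is (tensor u))"
      unfolding pdiffs_tensor[OF s] by (intro continuous_tensor smooth_continuous smooth_higher_deriv s)
    have "smooth ((deriv ^^ count (mset is) i) (u i))" by (intro smooth_higher_deriv s)
    from tensor_has_deriv[where u = "\<lambda>j. (deriv ^^ count (mset is) j) (u j)", OF this]
    show "(\<lambda>t. pdiffs is (tensor u) (x + t *\<^sub>R axis i 1)) differentiable (at 0)"
      unfolding pdiffs_tensor[OF s] real_differentiable_def by blast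
  qed (use sub K in auto)
qed

lemma multi_index_list:
  fixes k :: "'d::finite \<Rightarrow> nat" shows "\<exists>is. \<forall>i. count (mset is) i = k i"
proof -
  obtain "is" where "mset is = Abs_multiset k" using ex_mset by blast
  then show ?thesis by (intro exI[of _ "is"]) (simp add: count_Abs_multiset)
qed

lemma has_weak_deriv_tensor:
  fixes f :: "real^'d::finite \<Rightarrow> real"
  assumes "has_weak_deriv (cube U) f k G" "\<And>i. cc_smooth U (u i)"
  shows "(LINT x:cube U|lborel. f x * tensor (\<lambda>i. (deriv ^^ k i) (u i)) x)
    = (-1) ^ (\<Sum>i\<in>UNIV. k i) * (LINT x:cube U|lborel. G x * tensor u x)"
proof -
  obtain "is" where "is": "\<forall>i. count (mset is) i = k i" using multi_index_list by blast
  have "pdiffs is (tensor u) = tensor (\<lambda>i. (deriv ^^ k i) (u i))"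
    using "is" assms(2) by (subst pdiffs_tensor) (auto simp: cc_smooth_def)
  moreover have "test_fun (cube U) (tensor u)" by (rule test_fun_tensor[OF assms(2)])
  moreover have "(LINT x:cube U|lborel. f x * pdiffs is \<phi> x)
    = (-1) ^ (\<Sum>i\<in>UNIV. k i) * (LINT x:cube U|lborel. G x * \<phi> x)" if "test_fun (cube U) \<phi>" for \<phi>
    using assms(1) that "is" unfolding has_weak_deriv_def by blast
  ultimately show ?thesis by metis
qed

section \<open>Point values from mollified masses\<close>

lemma locally_integrable_mult:
  assumes "locally_integrable_on g \<Omega>" "continuous_on UNIV \<psi>" "compact K" "K \<subseteq> \<Omega>"
    "\<And>x. x \<notin> K \<Longrightarrow> \<psi> x = 0"
  shows "set_integrable lborel \<Omega> (\<lambda>x. g x * \<psi> x)"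
proof -
  have i: "integrable lborel (\<lambda>x. indicator K x *\<^sub>R g x)"
    using assms unfolding locally_integrable_on_def set_integrable_def by blast
  have m [measurable]: "\<psi> \<in> borel_measurable borel" by (rule borel_measurable_continuous_onI[OF assms(2)])
  have "bounded (\<psi> ` K)"
    by (intro compact_imp_bounded compact_continuous_image continuous_on_subset[OF assms(2)] assms) auto
  then obtain B where B: "\<And>x. x \<in> K \<Longrightarrow> \<bar>\<psi> x\<bar> \<le> B" unfolding bounded_iff by (metis imageI real_norm_def)
  have "integrable lborel (\<lambda>x. (indicator K x *\<^sub>R g x) * \<psi> x)"
  proof (rule Bochner_Integration.integrable_bound[OF integrable_mult_right[OF i, of B]])
    show "(\<lambda>x. (indicator K x *\<^sub>R g x) * \<psi> x) \<in> borel_measurable lborel"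
      using borel_measurable_integrable[OF i] by measurable
    show "AE x in lborel. norm ((indicator K x *\<^sub>R g x) * \<psi> x) \<le> norm (B * (indicator K x *\<^sub>R g x))"
    proof (rule AE_I2)
      fix x show "norm ((indicator K x *\<^sub>R g x) * \<psi> x) \<le> norm (B * (indicator K x *\<^sub>R g x))"
        using B[of x] by (cases "x \<in> K") (auto simp: abs_mult mult.commute[of B] intro!: mult_left_mono)
    qed
  qed
  also have "(\<lambda>x. (indicator K x *\<^sub>R g x) * \<psi> x) = (\<lambda>x. indicator \<Omega> x *\<^sub>R (g x * \<psi> x))"
    using assms(4,5) by (auto simp: indicator_def fun_eq_iff)
  finally show ?thesis unfolding set_integrable_def .
qed

lemma moll_cc_smooth: "{z - \<epsilon>..z + \<epsilon>} \<subseteq> U \<Longrightarrow> cc_smooth U (\<lambda>t. moll \<epsilon> (t - z))"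
  unfolding cc_smooth_def
  by (intro conjI exI[of _ "{z - \<epsilon>..z + \<epsilon>}"] smooth_shift smooth_moll) (auto intro!: moll_zero)

lemma open_cube: assumes "open U" shows "open (cube U :: (real^'d::finite) set)"
proof -
  have "cube U = (\<Inter>i. (\<lambda>x::real^'d. x $ i) -` U)" by (auto simp: cube_def)
  then show ?thesis using assms by (auto intro!: open_INT open_vimage continuous_intros)
qed

text \<open>An approximate identity: the tensor mollifiers are nonnegative, have integral 1 and
  shrink to \<open>z\<close>, where \<open>f\<close> is continuous.\<close>

lemma tensor_moll_tendsto:
  fixes f :: "real^'d::finite \<Rightarrow> real"
  assumes U: "open U" and f: "continuous_on (cube U) f" and z: "z \<in> cube U"
    and loc: "locally_integrable_on f (cube U)"
  shows "((\<lambda>\<epsilon>. LINT t:cube U|lborel. f t * tensor (\<lambda>i s. moll \<epsilon> (s - z $ i)) t) \<longlongrightarrow> f z) (at_right 0)"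
proof (rule tendstoI)
  fix e :: real assume "e > 0"
  have oc: "open (cube U :: (real^'d) set)" by (rule open_cube[OF U])
  obtain \<delta>1 where \<delta>1: "\<delta>1 > 0" "\<And>t. dist t z < \<delta>1 \<Longrightarrow> t \<in> cube U" using oc z unfolding open_dist by blast
  obtain \<delta>2 where \<delta>2: "\<delta>2 > 0" "\<And>t. t \<in> cube U \<Longrightarrow> dist t z < \<delta>2 \<Longrightarrow> dist (f t) (f z) < e / 2"
    using f z \<open>e > 0\<close> unfolding continuous_on_iff by (metis half_gt_zero)
  \<comment> \<open>Euclidean distance is bounded by the sum of the coordinate distances, hence the
    division by the dimension; the extra 1 leaves room for a crude estimate.\<close>
  define \<delta> where "\<delta> = min \<delta>1 \<delta>2 / (real CARD('d) + 1)"
  have \<delta>: "\<delta> > 0" using \<delta>1 \<delta>2 by (simp add: \<delta>_def)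
  have "dist (LINT t:cube U|lborel. f t * tensor (\<lambda>i s. moll \<epsilon> (s - z $ i)) t) (f z) < e"
    if \<epsilon>: "0 < \<epsilon>" "\<epsilon> < \<delta>" for \<epsilon>
  proof -
    define \<phi> where "\<phi> = tensor (\<lambda>i s. moll \<epsilon> (s - z $ i))"
    have \<phi>0: "\<phi> t \<ge> 0" for t unfolding \<phi>_def tensor_def by (intro prod_nonneg) (simp add: moll_nonneg)
    define K where "K = {x. \<forall>i. x $ i \<in> {z $ i - \<epsilon>..z $ i + \<epsilon>}}"
    have K: "compact K" unfolding K_def by (rule compact_box_vec) simp
    have \<phi>K: "\<phi> t = 0" if tK: "t \<notin> K" for t
    proof -
      obtain i where "t $ i \<notin> {z $ i - \<epsilon>..z $ i + \<epsilon>}" using tK unfolding K_def by blast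
      then have "moll \<epsilon> (t $ i - z $ i) = 0" by (intro moll_zero) auto
      then show ?thesis unfolding \<phi>_def by (rule tensor_eq_0)
    qed
    have near: "t \<in> cube U" "dist (f t) (f z) < e / 2" if "t \<in> K" for t
    proof -
      have "dist t z \<le> (\<Sum>i\<in>UNIV. \<bar>(t - z) $ i\<bar>)" unfolding dist_norm by (rule norm_le_l1_cart)
      also have "\<dots> \<le> (\<Sum>i\<in>(UNIV::'d set). \<epsilon>)"
        by (rule sum_mono) (use that in \<open>auto simp: K_def abs_le_iff algebra_simps\<close>)
      also have "\<dots> \<le> (real CARD('d) + 1) * \<epsilon>" using \<epsilon> by (simp add: distrib_right)
      also have "\<dots> < (real CARD('d) + 1) * \<delta>" using \<epsilon> by (intro mult_strict_left_mono) auto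
      also have "\<dots> = min \<delta>1 \<delta>2" by (simp add: \<delta>_def)
      finally have "dist t z < \<delta>1" "dist t z < \<delta>2" by auto
      then show "t \<in> cube U" "dist (f t) (f z) < e / 2" using \<delta>1 \<delta>2 by auto
    qed
    have KU: "K \<subseteq> cube U" using near by blast
    have c\<phi>: "continuous_on UNIV \<phi>" unfolding \<phi>_def
      by (intro continuous_tensor smooth_continuous smooth_shift smooth_moll)
    have i\<phi>: "integrable lborel \<phi>" by (rule continuous_compact_integrable[OF c\<phi> K \<phi>K])
    have "(\<integral>\<^sup>+t. ennreal (\<phi> t) \<partial>lborel) = 1" unfolding \<phi>_def
      by (subst nn_integral_tensor)
        (auto simp: moll_nonneg moll_nn_integral \<epsilon> intro!: borel_measurable_continuous_onI smooth_continuous smooth_shift smooth_moll)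
    then have one: "(LINT t|lborel. \<phi> t) = 1"
      using nn_integral_eq_integral[OF i\<phi>] \<phi>0 by (simp add: ennreal_eq_1)
    have if\<phi>: "integrable lborel (\<lambda>t. indicator (cube U) t *\<^sub>R (f t * \<phi> t))"
      using locally_integrable_mult[OF loc c\<phi> K KU \<phi>K] unfolding set_integrable_def .
    have "\<bar>(LINT t:cube U|lborel. f t * \<phi> t) - f z\<bar> =
      \<bar>(LINT t|lborel. indicator (cube U) t *\<^sub>R (f t * \<phi> t) - f z * \<phi> t)\<bar>"
      using if\<phi> i\<phi> one unfolding set_lebesgue_integral_def by simp
    also have "\<dots> \<le> (LINT t|lborel. \<bar>indicator (cube U) t *\<^sub>R (f t * \<phi> t) - f z * \<phi> t\<bar>)"
      by (rule integral_abs_bound)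
    also have "\<dots> \<le> (LINT t|lborel. e / 2 * \<phi> t)"
    proof (rule integral_mono)
      show "integrable lborel (\<lambda>t. \<bar>indicator (cube U) t *\<^sub>R (f t * \<phi> t) - f z * \<phi> t\<bar>)"
        using if\<phi> i\<phi> by simp
      fix t show "\<bar>indicator (cube U) t *\<^sub>R (f t * \<phi> t) - f z * \<phi> t\<bar> \<le> e / 2 * \<phi> t"
      proof (cases "t \<in> K")
        case True
        have "\<bar>f t * \<phi> t - f z * \<phi> t\<bar> = \<bar>f t - f z\<bar> * \<phi> t"
          using \<phi>0[of t] by (simp add: left_diff_distrib[symmetric] abs_mult)
        also have "\<dots> \<le> e / 2 * \<phi> t" using near(2)[OF True] \<phi>0[of t]
          by (intro mult_right_mono) (auto simp: dist_real_def)
        finally show ?thesis using near(1)[OF True] by simp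
      qed (simp add: \<phi>K)
    qed (use i\<phi> in simp)
    also have "\<dots> = e / 2" using one by simp
    finally show ?thesis using \<open>e > 0\<close> by (simp add: dist_real_def \<phi>_def)
  qed
  then show "\<forall>\<^sub>F \<epsilon> in at_right 0. dist (LINT t:cube U|lborel. f t * tensor (\<lambda>i s. moll \<epsilon> (s - z $ i)) t) (f z) < e"
    using \<delta> unfolding eventually_at_right_field by blast
qed

lemma set_lebesgue_integral_sum:
  fixes h :: "'b \<Rightarrow> 'a \<Rightarrow> real"
  assumes "\<And>i. i \<in> I \<Longrightarrow> set_integrable M A (h i)"
  shows "(LINT t:A|M. (\<Sum>i\<in>I. h i t)) = (\<Sum>i\<in>I. LINT t:A|M. h i t)"
  using assms unfolding set_lebesgue_integral_def set_integrable_def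
  by (simp add: sum_distrib_left Bochner_Integration.integral_sum)

lemma multi_idx_PiE: "(multi_idx r :: ('d::finite \<Rightarrow> nat) set) = PiE UNIV (\<lambda>_. {..r})"
  by (auto simp: multi_idx_def PiE_def Pi_def)

lemma finite_multi_idx: "finite (multi_idx r :: ('d::finite \<Rightarrow> nat) set)"
  unfolding multi_idx_PiE by (intro finite_PiE) auto

text \<open>A tensor product of representable point functionals is tested against mollified point
  masses, which are themselves sums of derivatives of tensor product test functions; hence no
  smoothing of \<open>f\<close> is needed.\<close>
lemma tensor_functional_bound:
  fixes f :: "real^'d::finite \<Rightarrow> real" and \<Lambda> :: "'d \<Rightarrow> real \<Rightarrow> real"
  assumes U: "open U" and f: "continuous_on (cube U) f"
    and G: "\<And>k. k \<in> multi_idx r \<Longrightarrow> has_weak_deriv (cube U) f k (G k)"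
    and S: "\<And>i. finite (S i)" "\<And>i. S i \<subseteq> U"
    and representable: "\<And>i. representable U r (\<lambda>\<epsilon> t. \<Sum>z\<in>S i. \<Lambda> i z * moll \<epsilon> (t - z)) (\<kappa> i)"
  shows "ennreal \<bar>\<Sum>z\<in>grid S. (\<Prod>i\<in>UNIV. \<Lambda> i (z $ i)) * f z\<bar> \<le>
    (\<Sum>k\<in>multi_idx r. \<integral>\<^sup>+t. ennreal (\<bar>G k t\<bar> * (\<Prod>i\<in>UNIV. \<kappa> i (t $ i))) * indicator (cube U) t \<partial>lborel)"
    (is "_ \<le> ?B")
proof -
  have "\<forall>i. \<exists>e>0. \<forall>\<epsilon>. 0 < \<epsilon> \<and> \<epsilon> < e \<longrightarrow>
     (\<exists>u. (\<forall>j\<le>r. cc_smooth U (u j) \<and> (\<forall>t. \<bar>u j t\<bar> \<le> \<kappa> i t)) \<and>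
          (\<forall>t. (\<Sum>z\<in>S i. \<Lambda> i z * moll \<epsilon> (t - z)) = (\<Sum>j\<le>r. (-1) ^ j * (deriv ^^ j) (u j) t)))"
    using representable unfolding representable_def by blast
  from choice[OF this] obtain e where e: "\<And>i. e i > 0" "\<And>i \<epsilon>. 0 < \<epsilon> \<Longrightarrow> \<epsilon> < e i \<Longrightarrow>
     (\<exists>u. (\<forall>j\<le>r. cc_smooth U (u j) \<and> (\<forall>t. \<bar>u j t\<bar> \<le> \<kappa> i t)) \<and>
          (\<forall>t. (\<Sum>z\<in>S i. \<Lambda> i z * moll \<epsilon> (t - z)) = (\<Sum>j\<le>r. (-1) ^ j * (deriv ^^ j) (u j) t)))"
    by blast
  define e0 where "e0 = Min (range e)"
  have e0: "e0 > 0" "\<And>i. e0 \<le> e i" using e(1) by (auto simp: e0_def)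
  define \<Phi> where "\<Phi> \<epsilon> t = (\<Prod>i\<in>UNIV. \<Sum>z\<in>S i. \<Lambda> i z * moll \<epsilon> (t $ i - z))" for \<epsilon> and t :: "real^'d"
  \<comment> \<open>\<open>X\<close> is evaluated in two ways: through the representing test
    functions it is bounded by the right-hand side, and through the mollified masses it tends to the
    sum over the grid.\<close>
  define X where "X \<epsilon> = (LINT t:cube U|lborel. f t * \<Phi> \<epsilon> t)" for \<epsilon>
  have loc: "locally_integrable_on f (cube U)"
    \<comment> \<open>Local integrability of \<open>f\<close> is read off from the weak derivative
      of order 0.\<close>
    using G[of "\<lambda>_. 0"] by (simp add: has_weak_deriv_def multi_idx_def)
  have X_le: "ennreal \<bar>X \<epsilon>\<bar> \<le> ?B" if \<epsilon>: "0 < \<epsilon>" "\<epsilon> < e0" for \<epsilon>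
  proof -
    have "\<forall>i. \<exists>u. (\<forall>j\<le>r. cc_smooth U (u j) \<and> (\<forall>t. \<bar>u j t\<bar> \<le> \<kappa> i t)) \<and>
          (\<forall>t. (\<Sum>z\<in>S i. \<Lambda> i z * moll \<epsilon> (t - z)) = (\<Sum>j\<le>r. (-1) ^ j * (deriv ^^ j) (u j) t))"
      using e(2)[OF \<epsilon>(1)] \<epsilon>(2) e0(2) by (meson less_le_trans)
    from choice[OF this] obtain u where u: "\<And>i j. j \<le> r \<Longrightarrow> cc_smooth U (u i j)"
      "\<And>i j t. j \<le> r \<Longrightarrow> \<bar>u i j t\<bar> \<le> \<kappa> i t"
      "\<And>i t. (\<Sum>z\<in>S i. \<Lambda> i z * moll \<epsilon> (t - z)) = (\<Sum>j\<le>r. (-1) ^ j * (deriv ^^ j) (u i j) t)" by blast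
    define T where "T k = tensor (\<lambda>i. (deriv ^^ k i) (u i (k i)))" for k :: "'d \<Rightarrow> nat"
    define V where "V k = tensor (\<lambda>i. u i (k i))" for k :: "'d \<Rightarrow> nat"
    have kr: "k i \<le> r" if "k \<in> multi_idx r" for k :: "'d \<Rightarrow> nat" and i using that by (simp add: multi_idx_def)
    have \<Phi>: "\<Phi> \<epsilon> t = (\<Sum>k\<in>multi_idx r. (-1) ^ (\<Sum>i\<in>UNIV. k i) * T k t)" for t
    proof -
      have "\<Phi> \<epsilon> t = (\<Sum>k\<in>multi_idx r. \<Prod>i\<in>UNIV. (-1) ^ k i * (deriv ^^ k i) (u i (k i)) (t $ i))"
        unfolding \<Phi>_def u(3) multi_idx_PiE by (rule prod_sum_PiE) auto
      then show ?thesis by (simp add: T_def tensor_def prod.distrib power_sum)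
    qed
    have intg: "set_integrable lborel (cube U) (\<lambda>x. h x * tensor v x)"
      if hl: "locally_integrable_on h (cube U)" and vc: "\<And>i. cc_smooth U (v i)" for h and v :: "'d \<Rightarrow> real \<Rightarrow> real"
    proof -
      obtain K :: "(real^'d) set" where K: "compact K" "K \<subseteq> cube U" "\<And>x. x \<notin> K \<Longrightarrow> tensor v x = 0"
        using tensor_support[where u = v and U = U, OF vc] by blast
      show ?thesis
        by (rule locally_integrable_mult[OF hl continuous_tensor K(1,2,3)])
          (use vc smooth_continuous in \<open>auto simp: cc_smooth_def\<close>)
    qed
    have csmd: "cc_smooth U ((deriv ^^ n) v)" if "cc_smooth U v" for n v
    proof -
      obtain K where K: "compact K" "K \<subseteq> U" "\<forall>t. t \<notin> K \<longrightarrow> v t = 0" "smooth v" using \<open>cc_smooth U v\<close> by (auto simp: cc_smooth_def)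
      then show ?thesis unfolding cc_smooth_def
        using higher_deriv_zero_outside[OF K(4) compact_imp_closed[OF K(1)]] smooth_higher_deriv by blast
    qed
    have "X \<epsilon> = (LINT t:cube U|lborel. (\<Sum>k\<in>multi_idx r. (-1) ^ (\<Sum>i\<in>UNIV. k i) * (f t * T k t)))"
      unfolding X_def \<Phi> by (simp add: sum_distrib_left mult_ac)
    also have "\<dots> = (\<Sum>k\<in>multi_idx r. LINT t:cube U|lborel. (-1) ^ (\<Sum>i\<in>UNIV. k i) * (f t * T k t))"
      unfolding T_def by (rule set_lebesgue_integral_sum)
        (intro set_integrable_mult_right intg loc csmd u(1) kr)
    also have "\<dots> = (\<Sum>k\<in>multi_idx r. LINT t:cube U|lborel. G k t * V k t)"
    proof (rule sum.cong[OF refl])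
      fix k :: "'d \<Rightarrow> nat" assume k: "k \<in> multi_idx r"
      have "(LINT t:cube U|lborel. f t * T k t) = (-1) ^ (\<Sum>i\<in>UNIV. k i) * (LINT t:cube U|lborel. G k t * V k t)"
        unfolding T_def V_def by (rule has_weak_deriv_tensor[OF G[OF k] u(1)[OF kr[OF k]]])
      \<comment> \<open>The sign built into \<open>representable\<close> meets the sign of the weak
        derivative, and the two cancel.\<close>
      then show "(LINT t:cube U|lborel. (-1) ^ (\<Sum>i\<in>UNIV. k i) * (f t * T k t)) = (LINT t:cube U|lborel. G k t * V k t)"
        unfolding set_integral_mult_right by (simp flip: mult.assoc power_mult_distrib)
    qed
    finally have "\<bar>X \<epsilon>\<bar> \<le> (\<Sum>k\<in>multi_idx r. \<bar>LINT t:cube U|lborel. G k t * V k t\<bar>)" by simp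
    then have "ennreal \<bar>X \<epsilon>\<bar> \<le> (\<Sum>k\<in>multi_idx r. ennreal \<bar>LINT t:cube U|lborel. G k t * V k t\<bar>)"
      by (simp add: ennreal_leI)
    also have "\<dots> \<le> ?B"
    proof (rule sum_mono)
      fix k :: "'d \<Rightarrow> nat" assume k: "k \<in> multi_idx r"
      have "integrable lborel (\<lambda>t. indicator (cube U) t *\<^sub>R (G k t * V k t))"
        using intg[of "G k" "\<lambda>i. u i (k i)"] G[OF k] u(1)[OF kr[OF k]]
        unfolding V_def set_integrable_def has_weak_deriv_def by blast
      from integral_norm_bound_ennreal[OF this]
      have "ennreal \<bar>LINT t:cube U|lborel. G k t * V k t\<bar> \<le>
        (\<integral>\<^sup>+t. ennreal \<bar>indicator (cube U) t *\<^sub>R (G k t * V k t)\<bar> \<partial>lborel)"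
        unfolding set_lebesgue_integral_def by simp
      also have "\<dots> \<le> (\<integral>\<^sup>+t. ennreal (\<bar>G k t\<bar> * (\<Prod>i\<in>UNIV. \<kappa> i (t $ i))) * indicator (cube U) t \<partial>lborel)"
      proof (rule nn_integral_mono)
        fix t
        have "\<bar>V k t\<bar> \<le> (\<Prod>i\<in>UNIV. \<kappa> i (t $ i))"
          unfolding V_def tensor_def abs_prod by (intro prod_mono) (use u(2)[OF kr[OF k]] in auto)
        then show "ennreal \<bar>indicator (cube U) t *\<^sub>R (G k t * V k t)\<bar> \<le>
          ennreal (\<bar>G k t\<bar> * (\<Prod>i\<in>UNIV. \<kappa> i (t $ i))) * indicator (cube U) t"
          by (cases "t \<in> cube U") (auto simp: abs_mult intro!: ennreal_leI mult_left_mono)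
      qed
      finally show "ennreal \<bar>LINT t:cube U|lborel. G k t * V k t\<bar> \<le>
        (\<integral>\<^sup>+t. ennreal (\<bar>G k t\<bar> * (\<Prod>i\<in>UNIV. \<kappa> i (t $ i))) * indicator (cube U) t \<partial>lborel)" .
    qed
    finally show ?thesis .
  qed
  have zU: "z \<in> cube U" if "z \<in> grid S" for z :: "real^'d" using that S(2) by (auto simp: grid_def cube_def)
  have "(X \<longlongrightarrow> (\<Sum>z\<in>grid S. (\<Prod>i\<in>UNIV. \<Lambda> i (z $ i)) * f z)) (at_right 0)"
  proof (rule Lim_transform_eventually)
    show "((\<lambda>\<epsilon>. \<Sum>z\<in>grid S. (\<Prod>i\<in>UNIV. \<Lambda> i (z $ i)) *
        (LINT t:cube U|lborel. f t * tensor (\<lambda>i s. moll \<epsilon> (s - z $ i)) t)) \<longlongrightarrow>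
        (\<Sum>z\<in>grid S. (\<Prod>i\<in>UNIV. \<Lambda> i (z $ i)) * f z)) (at_right 0)"
      by (intro tendsto_sum tendsto_mult tendsto_const tensor_moll_tendsto[OF U f _ loc] zU)
    have oU: "\<exists>\<delta>>0. \<forall>z\<in>\<Union>(range S). {z - \<delta>..z + \<delta>} \<subseteq> U"
    proof -
      have "\<forall>z\<in>\<Union>(range S). \<exists>\<delta>>0. cball z \<delta> \<subseteq> U" using S(2) U open_contains_cball by blast
      then obtain d where d: "\<And>z. z \<in> \<Union>(range S) \<Longrightarrow> d z > 0 \<and> cball z (d z) \<subseteq> U" by metis
      have fin: "finite (insert 1 (d ` \<Union>(range S)))" using S(1) by simp
      define \<delta> where "\<delta> = Min (insert 1 (d ` \<Union>(range S)))"
      have "\<delta> > 0" unfolding \<delta>_def using fin d by (subst Min_gr_iff) auto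
      moreover have "{z - \<delta>..z + \<delta>} \<subseteq> U" if z: "z \<in> \<Union>(range S)" for z
      proof -
        have "\<delta> \<le> d z" unfolding \<delta>_def by (rule Min_le[OF fin]) (use z in auto)
        then have "{z - \<delta>..z + \<delta>} \<subseteq> cball z (d z)" by (auto simp: dist_real_def)
        then show ?thesis using d[OF z] by blast
      qed
      ultimately show ?thesis by blast
    qed
    then obtain \<delta> where \<delta>: "\<delta> > 0" "\<And>z i. z \<in> S i \<Longrightarrow> {z - \<delta>..z + \<delta>} \<subseteq> U" by blast
    have "(\<Sum>z\<in>grid S. (\<Prod>i\<in>UNIV. \<Lambda> i (z $ i)) *
        (LINT t:cube U|lborel. f t * tensor (\<lambda>i s. moll \<epsilon> (s - z $ i)) t)) = X \<epsilon>"
      if \<epsilon>: "0 < \<epsilon>" "\<epsilon> < \<delta>" for \<epsilon>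
    proof -
      have i: "set_integrable lborel (cube U) (\<lambda>t. f t * tensor (\<lambda>i s. moll \<epsilon> (s - z $ i)) t)"
        if z: "z \<in> grid S" for z :: "real^'d"
      proof -
        have c: "cc_smooth U (\<lambda>s. moll \<epsilon> (s - z $ i))" for i
        proof (rule moll_cc_smooth)
          have "{z $ i - \<epsilon>..z $ i + \<epsilon>} \<subseteq> {z $ i - \<delta>..z $ i + \<delta>}" using \<epsilon> by auto
          then show "{z $ i - \<epsilon>..z $ i + \<epsilon>} \<subseteq> U" using \<delta>(2)[of "z $ i" i] z by (auto simp: grid_def)
        qed
        obtain K :: "(real^'d) set" where K: "compact K" "K \<subseteq> cube U"
          "\<And>x. x \<notin> K \<Longrightarrow> tensor (\<lambda>i s. moll \<epsilon> (s - z $ i)) x = 0"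
          using tensor_support[where u = "\<lambda>i s. moll \<epsilon> (s - z $ i)" and U = U, OF c] by blast
        show ?thesis
          by (rule locally_integrable_mult[OF loc continuous_tensor K(1,2,3)])
            (intro smooth_continuous smooth_shift smooth_moll)
      qed
      have "\<Phi> \<epsilon> t = (\<Sum>z\<in>grid S. (\<Prod>i\<in>UNIV. \<Lambda> i (z $ i)) * tensor (\<lambda>i s. moll \<epsilon> (s - z $ i)) t)" for t
        unfolding \<Phi>_def using prod_sum_grid[OF S(1), of "\<lambda>i z. \<Lambda> i z * moll \<epsilon> (t $ i - z)"]
        by (simp add: tensor_def prod.distrib)
      then have "X \<epsilon> = (LINT t:cube U|lborel. (\<Sum>z\<in>grid S. (\<Prod>i\<in>UNIV. \<Lambda> i (z $ i)) * (f t * tensor (\<lambda>i s. moll \<epsilon> (s - z $ i)) t)))"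
        unfolding X_def by (simp add: sum_distrib_left mult_ac)
      also have "\<dots> = (\<Sum>z\<in>grid S. LINT t:cube U|lborel. (\<Prod>i\<in>UNIV. \<Lambda> i (z $ i)) * (f t * tensor (\<lambda>i s. moll \<epsilon> (s - z $ i)) t))"
        by (rule set_lebesgue_integral_sum) (intro set_integrable_mult_right i)
      finally show ?thesis by simp
    qed
    then show "\<forall>\<^sub>F \<epsilon> in at_right 0. (\<Sum>z\<in>grid S. (\<Prod>i\<in>UNIV. \<Lambda> i (z $ i)) *
        (LINT t:cube U|lborel. f t * tensor (\<lambda>i s. moll \<epsilon> (s - z $ i)) t)) = X \<epsilon>"
      using \<delta> unfolding eventually_at_right_field by blast
  qed
  then have "((\<lambda>\<epsilon>. ennreal \<bar>X \<epsilon>\<bar>) \<longlongrightarrow> ennreal \<bar>\<Sum>z\<in>grid S. (\<Prod>i\<in>UNIV. \<Lambda> i (z $ i)) * f z\<bar>) (at_right 0)"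
    by (intro tendsto_intros)
  moreover have "\<forall>\<^sub>F \<epsilon> in at_right 0. ennreal \<bar>X \<epsilon>\<bar> \<le> ?B"
    using X_le e0(1) unfolding eventually_at_right_field by blast
  ultimately show ?thesis by (rule tendsto_upperbound) simp
qed

section \<open>Sparse grid approximation\<close>

lemma wvec_nonneg: "wvec \<alpha> r x \<ge> 0"
  unfolding wvec_def by (rule prod_nonneg, rule wr_nonneg)

lemma vec_nth_measurable [measurable]: "(\<lambda>x::real^'d::finite. x $ i) \<in> borel_measurable borel"
  by (intro borel_measurable_continuous_onI continuous_intros)

lemma wvec_measurable [measurable]: "(wvec \<alpha> r :: real^'d::finite \<Rightarrow> real) \<in> borel_measurable borel"
  unfolding wvec_def by measurable

lemma cube_measurable: "open U \<Longrightarrow> (cube U :: (real^'d::finite) set) \<in> sets borel"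
  by (rule borel_open[OF open_cube])

text \<open>Because \<open>0 powr a = 0\<close>, the coordinate hyperplanes carry no weight and can
  be treated pointwise instead of as null sets.\<close>

lemma wvec_zero: "x $ i = 0 \<Longrightarrow> wvec \<alpha> r x = 0"
  unfolding wvec_def by (rule prod_zero) (auto simp: wr_def)

lemma ennreal_prod_mono:
  fixes f g :: "'a \<Rightarrow> ennreal"
  assumes "\<And>i. i \<in> I \<Longrightarrow> f i \<le> g i" shows "prod f I \<le> prod g I"
  using assms
proof (induction I rule: infinite_finite_induct)
  case (insert i I)
  have "f i * prod f I \<le> g i * prod g I" by (rule mult_mono) (use insert in auto)
  then show ?case using insert by simp
qed simp_all

lemma nn_integral_norm_L1w:
  assumes "in_L1w \<alpha> r U g"
  shows "(\<integral>\<^sup>+t. ennreal (\<bar>g t\<bar> * wvec \<alpha> r t) * indicator (cube U) t \<partial>lborel) = ennreal (norm_L1w \<alpha> r U g)"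
proof -
  have i: "integrable lborel (\<lambda>x. indicator (cube U) x *\<^sub>R \<bar>g x * wvec \<alpha> r x\<bar>)"
    using set_integrable_abs[OF conjunct2[OF assms[unfolded in_L1w_def]]] unfolding set_integrable_def .
  have "(\<integral>\<^sup>+t. ennreal (\<bar>g t\<bar> * wvec \<alpha> r t) * indicator (cube U) t \<partial>lborel)
    = (\<integral>\<^sup>+t. ennreal (indicator (cube U) t *\<^sub>R \<bar>g t * wvec \<alpha> r t\<bar>) \<partial>lborel)"
  proof (rule nn_integral_cong)
    fix t
    show "ennreal (\<bar>g t\<bar> * wvec \<alpha> r t) * indicator (cube U) t = ennreal (indicator (cube U) t *\<^sub>R \<bar>g t * wvec \<alpha> r t\<bar>)"
      using wvec_nonneg[of \<alpha> r t] by (cases "t \<in> cube U") (simp_all add: abs_mult)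
  qed
  also have "\<dots> = ennreal (norm_L1w \<alpha> r U g)"
    unfolding norm_L1w_def set_lebesgue_integral_def by (rule nn_integral_eq_integral[OF i]) simp
  finally show ?thesis .
qed

context sampling_family
begin

text \<open>The tensor product of one-dimensional differences of interpolants, the building block of
  a Smolyak sum.\<close>

definition detail :: "(real^'d::finite \<Rightarrow> real) \<Rightarrow> ('d \<Rightarrow> nat) \<Rightarrow> real^'d \<Rightarrow> real" where
  "detail f k x = (\<Sum>z\<in>grid (\<lambda>i. Z (k i)). (\<Prod>i\<in>UNIV. c (k i) (x $ i) (z $ i)) * f z)"

lemma coef_measurable:
  "(\<lambda>x::real^'d::finite. \<Prod>i\<in>UNIV. c (k i) (x $ i) (z $ i)) \<in> borel_measurable borel"
proof -
  have [measurable]: "(\<lambda>x::real^'d. c (k i) (x $ i) (z $ i)) \<in> borel_measurable borel" for i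
    by (rule measurable_compose[OF vec_nth_measurable c_meas])
  show ?thesis by measurable
qed

lemma detail_measurable [measurable]: "detail f k \<in> borel_measurable borel"
  unfolding detail_def by (intro borel_measurable_sum borel_measurable_times coef_measurable borel_measurable_const)

lemma kernel_prod_measurable:
  "(\<lambda>p::(real^'d::finite) \<times> (real^'d). \<Prod>i\<in>UNIV. \<kappa> (k i) (fst p $ i) (snd p $ i)) \<in> borel_measurable (borel \<Otimes>\<^sub>M borel)"
proof -
  have [measurable]: "(\<lambda>p::(real^'d) \<times> (real^'d). (fst p $ i, snd p $ i)) \<in> (borel \<Otimes>\<^sub>M borel) \<rightarrow>\<^sub>M (borel \<Otimes>\<^sub>M borel)" for i
    by measurable
  have [measurable]: "(\<lambda>p::(real^'d) \<times> (real^'d). \<kappa> (k i) (fst p $ i) (snd p $ i)) \<in> borel_measurable (borel \<Otimes>\<^sub>M borel)" for i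
    using measurable_compose[OF _ \<kappa>_meas[of "k i"], of "\<lambda>p. (fst p $ i, snd p $ i)"] by simp
  show ?thesis by measurable
qed

text \<open>\<open>tensor_functional_bound\<close> estimates the detail at \<open>x\<close> by
  integrals of the weak derivatives against product kernels. Integrating in \<open>x\<close> first,
  the product splits into coordinates, and \<open>\<kappa>_integral\<close> exchanges
  \<open>wr \<alpha> 0\<close> at \<open>x\<close> for \<open>q ^ k i\<close> and
  \<open>wr \<alpha> r\<close> at \<open>t\<close>; what remains are the norms whose sum is at most
  1.\<close>

lemma detail_bound:
  fixes f :: "real^'d::finite \<Rightarrow> real"
  assumes f: "f \<in> sobolev_ball \<alpha> r U"
  shows "(\<integral>\<^sup>+x. ennreal (\<bar>detail f k x\<bar> * wvec \<alpha> 0 x) * indicator (cube U) x \<partial>lborel)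
    \<le> ennreal (C ^ CARD('d) * q ^ (\<Sum>i\<in>UNIV. k i))"
proof -
  note [measurable] = cube_measurable[OF open_U]
  obtain G where G: "\<And>J. J \<in> multi_idx r \<Longrightarrow> has_weak_deriv (cube U) f J (G J)"
    "\<And>J. J \<in> multi_idx r \<Longrightarrow> in_L1w \<alpha> r U (G J)"
    "(\<Sum>J\<in>multi_idx r. norm_L1w \<alpha> r U (G J)) \<le> 1"
    and cf: "continuous_on (cube U) f"
    using f unfolding sobolev_ball_def by blast
  have Gm: "G J \<in> borel_measurable borel" if "J \<in> multi_idx r" for J
    using G(2)[OF that] by (simp add: in_L1w_def)
  define P where "P x t = (\<Prod>i\<in>UNIV. \<kappa> (k i) (x $ i) (t $ i))" for x t :: "real^'d"
  have P0: "P x t \<ge> 0" for x t unfolding P_def by (intro prod_nonneg) (simp add: \<kappa>_nonneg)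
  have Pm [measurable]: "(\<lambda>p. P (fst p) (snd p)) \<in> borel_measurable (borel \<Otimes>\<^sub>M borel)"
    unfolding P_def by (rule kernel_prod_measurable)
  define D where "D = C ^ CARD('d) * q ^ (\<Sum>i\<in>UNIV. k i)"
  have D0: "D \<ge> 0" using C_pos q_bounds by (simp add: D_def)
  define g where "g J x t = ennreal (\<bar>G J t\<bar> * P x t) * indicator (cube U) t * ennreal (wvec \<alpha> 0 x)" for J x t
  have Pm1 [measurable]: "(\<lambda>t. P x t) \<in> borel_measurable borel" for x
    using measurable_compose[OF measurable_Pair1'[of x borel borel] Pm] by simp
  have gm: "(\<lambda>p. g J (fst p) (snd p)) \<in> borel_measurable (lborel \<Otimes>\<^sub>M lborel)" if J: "J \<in> multi_idx r" for J
  proof -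
    define H where "H t = ennreal \<bar>G J t\<bar> * indicator (cube U) t" for t
    have "H \<in> borel_measurable borel" unfolding H_def using Gm[OF J] by measurable
    then have [measurable]: "(\<lambda>p. H (snd p)) \<in> borel_measurable (borel \<Otimes>\<^sub>M borel)"
      by (rule measurable_compose[OF measurable_snd])
    have "(\<lambda>p. g J (fst p) (snd p)) = (\<lambda>p. H (snd p) * ennreal (P (fst p) (snd p)) * ennreal (wvec \<alpha> 0 (fst p)))"
      by (simp add: g_def H_def ennreal_mult P0 mult_ac fun_eq_iff)
    moreover have "\<dots> \<in> borel_measurable (borel \<Otimes>\<^sub>M borel)" by measurable
    ultimately show ?thesis by simp
  qed
  have "(\<integral>\<^sup>+x. ennreal (\<bar>detail f k x\<bar> * wvec \<alpha> 0 x) * indicator (cube U) x \<partial>lborel)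
    \<le> (\<integral>\<^sup>+x. (\<Sum>J\<in>multi_idx r. \<integral>\<^sup>+t. g J x t \<partial>lborel) \<partial>lborel)"
  proof (rule nn_integral_mono)
    fix x :: "real^'d"
    show "ennreal (\<bar>detail f k x\<bar> * wvec \<alpha> 0 x) * indicator (cube U) x \<le> (\<Sum>J\<in>multi_idx r. \<integral>\<^sup>+t. g J x t \<partial>lborel)"
    \<comment> \<open>Where some coordinate is 0 the weight vanishes; elsewhere
      \<open>c_representable\<close> applies in each coordinate.\<close>
    proof (cases "x \<in> cube U \<and> (\<forall>i. x $ i \<noteq> 0)")
      case True
      then have x: "x $ i \<in> U" "x $ i \<noteq> 0" for i by (auto simp: cube_def)
      have "ennreal \<bar>detail f k x\<bar> \<le> (\<Sum>J\<in>multi_idx r. \<integral>\<^sup>+t. ennreal (\<bar>G J t\<bar> * P x t) * indicator (cube U) t \<partial>lborel)"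
        unfolding detail_def P_def
        by (rule tensor_functional_bound[OF open_U cf G(1) finite_Z Z_sub c_representable[OF x]])
      then have "ennreal \<bar>detail f k x\<bar> * ennreal (wvec \<alpha> 0 x) \<le>
        (\<Sum>J\<in>multi_idx r. \<integral>\<^sup>+t. ennreal (\<bar>G J t\<bar> * P x t) * indicator (cube U) t \<partial>lborel) * ennreal (wvec \<alpha> 0 x)"
        by (rule mult_right_mono) simp
      also have "\<dots> = (\<Sum>J\<in>multi_idx r. \<integral>\<^sup>+t. g J x t \<partial>lborel)"
        unfolding g_def sum_distrib_right
        by (intro sum.cong refl nn_integral_multc[symmetric]) (use Gm in measurable)
      finally show ?thesis using True by (simp add: ennreal_mult wvec_nonneg)
    next
      case False
      then consider "x \<notin> cube U" | i where "x $ i = 0" by blast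
      then show ?thesis by cases (simp_all add: wvec_zero)
    qed
  qed
  also have "\<dots> = (\<Sum>J\<in>multi_idx r. \<integral>\<^sup>+x. \<integral>\<^sup>+t. g J x t \<partial>lborel \<partial>lborel)"
  proof (rule nn_integral_sum)
    fix J :: "'d \<Rightarrow> nat" assume "J \<in> multi_idx r"
    from gm[OF this] show "(\<lambda>x. \<integral>\<^sup>+t. g J x t \<partial>lborel) \<in> borel_measurable lborel"
      using lborel.borel_measurable_nn_integral_fst[of "\<lambda>p. g J (fst p) (snd p)" lborel] by simp
  qed
  also have "\<dots> \<le> (\<Sum>J\<in>multi_idx r. ennreal D * ennreal (norm_L1w \<alpha> r U (G J)))"
  proof (rule sum_mono)
    fix J :: "'d \<Rightarrow> nat" assume J: "J \<in> multi_idx r"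
    note [measurable] = Gm[OF this]
    have "(\<integral>\<^sup>+x. \<integral>\<^sup>+t. g J x t \<partial>lborel \<partial>lborel) = (\<integral>\<^sup>+t. \<integral>\<^sup>+x. g J x t \<partial>lborel \<partial>lborel)"
      by (rule lborel_pair.Fubini'[symmetric]) (use gm[OF J] in \<open>simp add: case_prod_beta'\<close>)
    also have "\<dots> \<le> (\<integral>\<^sup>+t. ennreal D * (ennreal (\<bar>G J t\<bar> * wvec \<alpha> r t) * indicator (cube U) t) \<partial>lborel)"
    proof (rule nn_integral_mono)
      fix t :: "real^'d"
      show "(\<integral>\<^sup>+x. g J x t \<partial>lborel) \<le> ennreal D * (ennreal (\<bar>G J t\<bar> * wvec \<alpha> r t) * indicator (cube U) t)"
      proof (cases "t \<in> cube U")
        case False then show ?thesis by (simp add: g_def)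
      next
        case True
        then have t: "t $ i \<in> U" for i by (simp add: cube_def)
        have km: "(\<lambda>s. \<kappa> (k i) s (t $ i)) \<in> borel_measurable borel" for i
          using measurable_compose[OF measurable_Pair2'[of "t $ i" borel borel] \<kappa>_meas[of "k i"]] by simp
        have [measurable]: "(\<lambda>s. ennreal (\<kappa> (k i) s (t $ i) * wr \<alpha> 0 s)) \<in> borel_measurable borel" for i
          using km[of i] by measurable
        have "(\<integral>\<^sup>+x. g J x t \<partial>lborel) = (\<integral>\<^sup>+x. ennreal \<bar>G J t\<bar> * (\<Prod>i\<in>UNIV. ennreal (\<kappa> (k i) (x $ i) (t $ i) * wr \<alpha> 0 (x $ i))) \<partial>lborel)"
          using True unfolding g_def P_def wvec_def
          by (intro nn_integral_cong)
            (simp add: prod_ennreal \<kappa>_nonneg wr_nonneg prod_nonneg prod.distrib ennreal_mult mult.assoc)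
        also have "\<dots> = ennreal \<bar>G J t\<bar> * (\<integral>\<^sup>+x. (\<Prod>i\<in>UNIV. ennreal (\<kappa> (k i) (x $ i) (t $ i) * wr \<alpha> 0 (x $ i))) \<partial>lborel)"
          by (rule nn_integral_cmult) measurable
        also have "(\<integral>\<^sup>+x. (\<Prod>i\<in>UNIV. ennreal (\<kappa> (k i) (x $ i) (t $ i) * wr \<alpha> 0 (x $ i))) \<partial>lborel)
          = (\<Prod>i\<in>UNIV. \<integral>\<^sup>+s. ennreal (\<kappa> (k i) s (t $ i) * wr \<alpha> 0 s) \<partial>lborel)"
          by (rule nn_integral_prod_vec) measurable
        also have "\<dots> \<le> (\<Prod>i\<in>UNIV. ennreal (C * q ^ k i * wr \<alpha> r (t $ i)))"
          by (intro ennreal_prod_mono \<kappa>_integral t)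
        also have "\<dots> = ennreal (D * wvec \<alpha> r t)"
          using C_pos q_bounds
          by (simp add: prod_ennreal wr_nonneg prod.distrib D_def wvec_def power_sum)
        finally have "(\<integral>\<^sup>+x. g J x t \<partial>lborel) \<le> ennreal \<bar>G J t\<bar> * ennreal (D * wvec \<alpha> r t)"
          by (simp add: mult_left_mono)
        then show ?thesis using True D0 by (simp add: ennreal_mult wvec_nonneg mult_ac)
      qed
    qed
    also have "\<dots> = ennreal D * ennreal (norm_L1w \<alpha> r U (G J))"
      unfolding nn_integral_norm_L1w[OF G(2)[OF J], symmetric] by (rule nn_integral_cmult) measurable
    finally show "(\<integral>\<^sup>+x. \<integral>\<^sup>+t. g J x t \<partial>lborel \<partial>lborel) \<le> ennreal D * ennreal (norm_L1w \<alpha> r U (G J))" .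
  qed
  also have "\<dots> = ennreal (D * (\<Sum>J\<in>multi_idx r. norm_L1w \<alpha> r U (G J)))"
  proof -
    have "norm_L1w \<alpha> r U (G J) \<ge> 0" for J
      unfolding norm_L1w_def set_lebesgue_integral_def by (intro integral_nonneg_AE) auto
    then show ?thesis using D0 by (simp add: sum_distrib_left[symmetric] ennreal_mult sum_nonneg)
  qed
  also have "\<dots> \<le> ennreal (D * 1)" by (intro ennreal_leI mult_left_mono G(3) D0)
  finally show ?thesis by (simp add: D_def)
qed

text \<open>Over a full box of levels the details telescope in every coordinate to one tensor
  product interpolant. Its coefficients eventually sum to 1, have bounded absolute sum and
  concentrate at \<open>x\<close>, so continuity of \<open>f\<close> at \<open>x\<close>
  suffices.\<close>

lemma detail_sum_tendsto:
  fixes f :: "real^'d::finite \<Rightarrow> real"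
  assumes f: "continuous_on (cube U) f" and x: "x \<in> cube U" "\<And>i. x $ i \<noteq> 0"
  shows "(\<lambda>K. \<Sum>k\<in>multi_idx K. detail f k x) \<longlonglongrightarrow> f x"
proof (rule tendstoI)
  fix e :: real assume e: "e > 0"
  have xU: "x $ i \<in> U" for i using x by (simp add: cube_def)
  define Y where "Y K = (\<Union>k\<le>K. Z k)" for K
  define A where "A K i y = (\<Sum>k\<le>K. c k (x $ i) y)" for K i y
  have Y: "finite (Y K)" "Y K \<subseteq> U" for K using finite_Z Z_sub by (auto simp: Y_def)
  define W where "W K = (grid (\<lambda>_. Y K) :: (real^'d) set)" for K
  have W: "finite (W K)" for K unfolding W_def by (rule finite_grid[OF Y(1)])
  have eq: "(\<Sum>k\<in>multi_idx K. detail f k x) = (\<Sum>z\<in>W K. (\<Prod>i\<in>UNIV. A K i (z $ i)) * f z)" for K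
  proof -
    have "detail f k x = (\<Sum>z\<in>W K. (\<Prod>i\<in>UNIV. c (k i) (x $ i) (z $ i)) * f z)" if k: "k \<in> multi_idx K" for k
      unfolding detail_def
    proof (rule sum.mono_neutral_left[OF W])
      show "grid (\<lambda>i. Z (k i)) \<subseteq> W K" using k by (auto simp: W_def grid_def Y_def multi_idx_def)
      show "\<forall>z\<in>W K - grid (\<lambda>i. Z (k i)). (\<Prod>i\<in>UNIV. c (k i) (x $ i) (z $ i)) * f z = 0"
      proof
        fix z assume "z \<in> W K - grid (\<lambda>i. Z (k i))"
        then obtain i where "z $ i \<notin> Z (k i)" by (auto simp: grid_def)
        then have "c (k i) (x $ i) (z $ i) = 0" using c_zero xU x(2) by blast
        then have "(\<Prod>i\<in>UNIV. c (k i) (x $ i) (z $ i)) = 0" by (intro prod_zero) auto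
        then show "(\<Prod>i\<in>UNIV. c (k i) (x $ i) (z $ i)) * f z = 0" by simp
      qed
    qed
    then have "(\<Sum>k\<in>multi_idx K. detail f k x) =
      (\<Sum>z\<in>W K. (\<Sum>k\<in>multi_idx K. \<Prod>i\<in>UNIV. c (k i) (x $ i) (z $ i)) * f z)"
      by (simp add: sum.swap[of _ "W K"] sum_distrib_right)
    \<comment> \<open>Distributivity: a box of multi-indices is a product set, so the sum of
      products is a product of telescoping sums.\<close>
    moreover have "(\<Sum>k\<in>multi_idx K. \<Prod>i\<in>UNIV. c (k i) (x $ i) (z $ i)) = (\<Prod>i\<in>UNIV. A K i (z $ i))" for z :: "real^'d"
      unfolding A_def multi_idx_PiE by (rule prod_sum_PiE[symmetric]) auto
    ultimately show ?thesis by simp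
  qed
  define B where "B = C ^ CARD('d)"
  have B: "B > 0" using C_pos by (simp add: B_def)
  obtain \<delta> where \<delta>: "\<delta> > 0" "\<And>z. z \<in> cube U \<Longrightarrow> dist z x < \<delta> \<Longrightarrow> dist (f z) (f x) < e / (2 * B)"
    using f x(1) e B unfolding continuous_on_iff by (metis divide_pos_pos mult_pos_pos zero_less_numeral)
  define d where "d = \<delta> / (real CARD('d) + 1)"
  have d: "d > 0" using \<delta> by (simp add: d_def)
  have "\<forall>\<^sub>F K in sequentially. \<forall>i. (\<Sum>y\<in>Y K. A K i y) = 1"
    unfolding Y_def A_def by (intro eventually_all_finite c_sum_one xU x)
  moreover have "\<forall>\<^sub>F K in sequentially. \<forall>i y. A K i y \<noteq> 0 \<longrightarrow> \<bar>y - x $ i\<bar> < d"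
    unfolding A_def by (intro eventually_all_finite c_local xU x d)
  ultimately show "\<forall>\<^sub>F K in sequentially. dist (\<Sum>k\<in>multi_idx K. detail f k x) (f x) < e"
  proof eventually_elim
    case (elim K)
    have one: "(\<Sum>z\<in>W K. \<Prod>i\<in>UNIV. A K i (z $ i)) = 1"
      using prod_sum_grid[of "\<lambda>_. Y K" "A K", OF Y(1)] elim(1) by (simp add: W_def)
    have abs: "(\<Sum>z\<in>W K. \<bar>\<Prod>i\<in>UNIV. A K i (z $ i)\<bar>) \<le> B"
    proof -
      have "(\<Sum>z\<in>W K. \<bar>\<Prod>i\<in>UNIV. A K i (z $ i)\<bar>) = (\<Prod>i\<in>UNIV. \<Sum>y\<in>Y K. \<bar>A K i y\<bar>)"
        using prod_sum_grid[of "\<lambda>_. Y K" "\<lambda>i y. \<bar>A K i y\<bar>", OF Y(1)] by (simp add: W_def abs_prod)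
      also have "\<dots> \<le> (\<Prod>i\<in>(UNIV::'d set). C)"
        unfolding Y_def A_def by (intro prod_mono conjI sum_nonneg c_abs_sum xU x) auto
      finally show ?thesis by (simp add: B_def)
    qed
    have "(\<Sum>k\<in>multi_idx K. detail f k x) - f x = (\<Sum>z\<in>W K. (\<Prod>i\<in>UNIV. A K i (z $ i)) * (f z - f x))"
      unfolding eq using one by (simp add: right_diff_distrib sum_subtractf sum_distrib_right[symmetric])
    also have "\<bar>\<dots>\<bar> \<le> (\<Sum>z\<in>W K. \<bar>\<Prod>i\<in>UNIV. A K i (z $ i)\<bar> * (e / (2 * B)))"
    proof (rule order_trans[OF sum_abs sum_mono])
      fix z assume z: "z \<in> W K"
      show "\<bar>(\<Prod>i\<in>UNIV. A K i (z $ i)) * (f z - f x)\<bar> \<le> \<bar>\<Prod>i\<in>UNIV. A K i (z $ i)\<bar> * (e / (2 * B))"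
      proof (cases "(\<Prod>i\<in>UNIV. A K i (z $ i)) = 0")
        case False
        then have "A K i (z $ i) \<noteq> 0" for i by (simp add: prod_zero_iff)
        then have near: "\<bar>z $ i - x $ i\<bar> < d" for i using elim(2) by blast
        have "dist z x \<le> (\<Sum>i\<in>UNIV. \<bar>(z - x) $ i\<bar>)" unfolding dist_norm by (rule norm_le_l1_cart)
        also have "\<dots> \<le> (\<Sum>i\<in>(UNIV::'d set). d)" by (rule sum_mono) (use near less_imp_le in auto)
        also have "\<dots> < (real CARD('d) + 1) * d" using d by (simp add: distrib_right)
        also have "\<dots> = \<delta>" by (simp add: d_def)
        finally have "dist z x < \<delta>" .
        moreover have "z \<in> cube U" using z Y(2) by (auto simp: W_def grid_def cube_def)
        ultimately have "\<bar>f z - f x\<bar> \<le> e / (2 * B)" using \<delta>(2) by (simp add: dist_real_def less_imp_le)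
        then show ?thesis unfolding abs_mult by (rule mult_left_mono) simp
      next
        case True
        show ?thesis unfolding True by simp
      qed
    qed
    also have "\<dots> \<le> B * (e / (2 * B))"
      unfolding sum_distrib_right[symmetric] by (rule mult_right_mono[OF abs]) (use e B in auto)
    also have "\<dots> = e / 2" using B by simp
    finally show ?case using e by (simp add: dist_real_def)
  qed
qed

end

section \<open>Error of the sparse sum and its quadrature\<close>

lemma finite_sum_less: "finite {k::'d::finite \<Rightarrow> nat. (\<Sum>i\<in>UNIV. k i) < m}"
proof (rule finite_subset[OF _ finite_multi_idx[of m]])
  show "{k::'d \<Rightarrow> nat. (\<Sum>i\<in>UNIV. k i) < m} \<subseteq> multi_idx m"
  proof (clarsimp simp: multi_idx_def)
    fix k :: "'d \<Rightarrow> nat" and i assume "sum k UNIV < m"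
    moreover have "k i \<le> sum k UNIV" by (rule member_le_sum) auto
    ultimately show "k i \<le> m" by simp
  qed
qed

lemma set_integrable_sum:
  fixes h :: "'b \<Rightarrow> 'a \<Rightarrow> real"
  assumes "\<And>i. i \<in> I \<Longrightarrow> set_integrable M A (h i)"
  shows "set_integrable M A (\<lambda>t. \<Sum>i\<in>I. h i t)"
  using assms unfolding set_integrable_def scaleR_sum_right by (rule Bochner_Integration.integrable_sum)

context sampling_family
begin

lemma wvec_integrable: "integrable lborel (wvec \<alpha> 0 :: real^'d::finite \<Rightarrow> real)"
proof (rule integrableI_bounded)
  have [measurable]: "(\<lambda>t. ennreal (wr \<alpha> 0 t)) \<in> borel_measurable borel" by measurable
  have "(\<integral>\<^sup>+x. ennreal (norm (wvec \<alpha> 0 (x :: real^'d))) \<partial>lborel) =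
      (\<integral>\<^sup>+x. (\<Prod>i\<in>UNIV. ennreal (wr \<alpha> 0 (x $ i))) \<partial>(lborel :: (real^'d) measure))"
    by (rule nn_integral_cong) (simp add: wvec_def abs_prod wr_nonneg prod_ennreal prod_nonneg)
  also have "\<dots> = (\<Prod>i\<in>(UNIV::'d set). \<integral>\<^sup>+t. ennreal (wr \<alpha> 0 t) \<partial>lborel)"
    by (rule nn_integral_prod_vec) measurable
  also have "\<dots> < \<infinity>"
  proof -
    obtain y where "y \<ge> 0" "(\<integral>\<^sup>+t. ennreal (wr \<alpha> 0 t) \<partial>lborel) = ennreal y"
      using wr_finite by (cases "\<integral>\<^sup>+t. ennreal (wr \<alpha> 0 t) \<partial>lborel") auto
    then show ?thesis by (simp add: ennreal_power)
  qed
  finally show "(\<integral>\<^sup>+x. ennreal (norm (wvec \<alpha> 0 (x :: real^'d))) \<partial>lborel) < \<infinity>" .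
qed simp

lemma coef_integrable:
  "set_integrable lborel (cube U) (\<lambda>x::real^'d::finite. (\<Prod>i\<in>UNIV. c (k i) (x $ i) (z $ i)) * wvec \<alpha> 0 x)"
proof -
  have "integrable lborel (\<lambda>x::real^'d. indicator (cube U) x *\<^sub>R (C ^ CARD('d) * wvec \<alpha> 0 x))"
    by (rule integrable_mult_indicator) (use cube_measurable[OF open_U] wvec_integrable in auto)
  then show ?thesis unfolding set_integrable_def
  proof (rule Bochner_Integration.integrable_bound)
    have [measurable]: "(cube U :: (real^'d) set) \<in> sets borel" by (rule cube_measurable[OF open_U])
    note [measurable] = coef_measurable[of k z]
    show "(\<lambda>x::real^'d. indicator (cube U) x *\<^sub>R ((\<Prod>i\<in>UNIV. c (k i) (x $ i) (z $ i)) * wvec \<alpha> 0 x)) \<in> borel_measurable lborel"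
      by measurable
    show "AE x in lborel. norm (indicator (cube U) x *\<^sub>R ((\<Prod>i\<in>UNIV. c (k i) (x $ i) (z $ i)) * wvec \<alpha> 0 x))
      \<le> norm (indicator (cube U) (x :: real^'d) *\<^sub>R (C ^ CARD('d) * wvec \<alpha> 0 x))"
    proof (rule AE_I2)
      fix x :: "real^'d"
      have "\<bar>\<Prod>i\<in>UNIV. c (k i) (x $ i) (z $ i)\<bar> \<le> (\<Prod>i\<in>(UNIV::'d set). C)"
        unfolding abs_prod by (rule prod_mono) (simp add: c_bound)
      then show "norm (indicator (cube U) x *\<^sub>R ((\<Prod>i\<in>UNIV. c (k i) (x $ i) (z $ i)) * wvec \<alpha> 0 x))
        \<le> norm (indicator (cube U) x *\<^sub>R (C ^ CARD('d) * wvec \<alpha> 0 x))"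
        using C_pos by (cases "x \<in> cube U") (simp_all add: abs_mult wvec_nonneg mult_right_mono)
    qed
  qed
qed

text \<open>The error is the pointwise limit of finite sums of details of total level at least
  \<open>m\<close>. These have weighted \<open>L1\<close> norm at most \<open>B\<close> uniformly in
  the box, and Fatou's lemma carries the bound over to the limit.\<close>

lemma sparse_approximation_error:
  fixes f :: "real^'d::finite \<Rightarrow> real"
  assumes f: "f \<in> sobolev_ball \<alpha> r U"
    and B: "\<And>K. (\<Sum>k\<in>{k\<in>multi_idx K. m \<le> (\<Sum>i\<in>UNIV. k i)}. C ^ CARD('d) * q ^ (\<Sum>i\<in>(UNIV::'d set). k i)) \<le> B"
  shows "(\<integral>\<^sup>+x. ennreal (\<bar>f x - (\<Sum>k\<in>{k. (\<Sum>i\<in>UNIV. k i) < m}. detail f k x)\<bar> * wvec \<alpha> 0 x) * indicator (cube U) x \<partial>lborel)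
    \<le> ennreal B"
proof -
  define I where "I = {k::'d \<Rightarrow> nat. (\<Sum>i\<in>UNIV. k i) < m}"
  have I: "finite I" unfolding I_def by (rule finite_sum_less)
  define A where "A x = (\<Sum>k\<in>I. detail f k x)" for x
  define S where "S K x = (\<Sum>k\<in>multi_idx K. detail f k x)" for K x
  have cf: "continuous_on (cube U) f" using f by (simp add: sobolev_ball_def)
  note cm = cube_measurable[OF open_U]
  have Am: "A \<in> borel_measurable borel" unfolding A_def by measurable
  have Sm: "S K \<in> borel_measurable borel" for K unfolding S_def by measurable
  \<comment> \<open>The shift by \<open>m\<close> ensures that the box contains all of
    \<open>I\<close>, even for \<open>K = 0\<close>.\<close>
  define h where "h K x = ennreal (\<bar>S (K + m) x - A x\<bar> * wvec \<alpha> 0 x) * indicator (cube U) x" for K x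
  have hm: "h K \<in> borel_measurable borel" for K
    unfolding h_def using Am Sm[of "K + m"] cm by measurable
  have hB: "(\<integral>\<^sup>+x. h K x \<partial>lborel) \<le> ennreal B" for K
  proof -
    define J where "J = {k\<in>multi_idx (K + m). m \<le> (\<Sum>i\<in>(UNIV::'d set). k i)}"
    have J: "finite J" unfolding J_def by (rule finite_subset[OF _ finite_multi_idx]) auto
    have split: "multi_idx (K + m) = I \<union> J" "I \<inter> J = {}"
    proof -
      have "I \<subseteq> multi_idx (K + m)"
      proof
        fix k assume "k \<in> I"
        have "k i \<le> K + m" for i
          using member_le_sum[of i UNIV k] \<open>k \<in> I\<close> by (auto simp: I_def intro: order_trans)
        then show "k \<in> multi_idx (K + m)" by (simp add: multi_idx_def)
      qed
      then show "multi_idx (K + m) = I \<union> J" by (auto simp: I_def J_def)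
      show "I \<inter> J = {}" by (auto simp: I_def J_def)
    qed
    have diff: "S (K + m) x - A x = (\<Sum>k\<in>J. detail f k x)" for x
      unfolding S_def A_def split(1) by (subst sum.union_disjoint[OF I J split(2)]) simp
    have "(\<integral>\<^sup>+x. h K x \<partial>lborel) \<le> (\<integral>\<^sup>+x. (\<Sum>k\<in>J. ennreal (\<bar>detail f k x\<bar> * wvec \<alpha> 0 x) * indicator (cube U) x) \<partial>lborel)"
    proof (rule nn_integral_mono)
      fix x :: "real^'d"
      have "\<bar>S (K + m) x - A x\<bar> * wvec \<alpha> 0 x \<le> (\<Sum>k\<in>J. \<bar>detail f k x\<bar> * wvec \<alpha> 0 x)"
        unfolding diff sum_distrib_right[symmetric] by (intro mult_right_mono sum_abs wvec_nonneg)
      then have "ennreal (\<bar>S (K + m) x - A x\<bar> * wvec \<alpha> 0 x) \<le> (\<Sum>k\<in>J. ennreal (\<bar>detail f k x\<bar> * wvec \<alpha> 0 x))"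
        by (simp add: sum_ennreal wvec_nonneg ennreal_leI)
      then show "h K x \<le> (\<Sum>k\<in>J. ennreal (\<bar>detail f k x\<bar> * wvec \<alpha> 0 x) * indicator (cube U) x)"
        unfolding h_def sum_distrib_right[symmetric] by (rule mult_right_mono) simp
    qed
    also have "\<dots> = (\<Sum>k\<in>J. \<integral>\<^sup>+x. ennreal (\<bar>detail f k x\<bar> * wvec \<alpha> 0 x) * indicator (cube U) x \<partial>lborel)"
      by (rule nn_integral_sum) (use cm in measurable)
    also have "\<dots> \<le> (\<Sum>k\<in>J. ennreal (C ^ CARD('d) * q ^ (\<Sum>i\<in>UNIV. k i)))"
      by (intro sum_mono detail_bound f)
    also have "\<dots> = ennreal (\<Sum>k\<in>J. C ^ CARD('d) * q ^ (\<Sum>i\<in>UNIV. k i))"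
      by (rule sum_ennreal) (use C_pos q_bounds in simp)
    also have "\<dots> \<le> ennreal B" unfolding J_def by (intro ennreal_leI B)
    finally show ?thesis .
  qed
  have lim: "ennreal (\<bar>f x - A x\<bar> * wvec \<alpha> 0 x) * indicator (cube U) x = liminf (\<lambda>K. h K x)" for x
  proof -
    consider "x \<notin> cube U" | i where "x $ i = 0" | "x \<in> cube U" "\<And>i. x $ i \<noteq> 0" by blast
    then have "(\<lambda>K. h K x) \<longlonglongrightarrow> ennreal (\<bar>f x - A x\<bar> * wvec \<alpha> 0 x) * indicator (cube U) x"
    proof cases
      case 3
      have "(\<lambda>K. S (K + m) x) \<longlonglongrightarrow> f x"
        unfolding S_def using detail_sum_tendsto[OF cf 3] by (rule LIMSEQ_ignore_initial_segment)
      then have "(\<lambda>K. ennreal (\<bar>S (K + m) x - A x\<bar> * wvec \<alpha> 0 x)) \<longlonglongrightarrow> ennreal (\<bar>f x - A x\<bar> * wvec \<alpha> 0 x)"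
        by (intro tendsto_intros)
      then show ?thesis using 3 by (simp add: h_def)
    qed (simp_all add: h_def wvec_zero)
    then show ?thesis by (intro lim_imp_Liminf[symmetric]) auto
  qed
  have "(\<integral>\<^sup>+x. ennreal (\<bar>f x - A x\<bar> * wvec \<alpha> 0 x) * indicator (cube U) x \<partial>lborel)
    = (\<integral>\<^sup>+x. liminf (\<lambda>K. h K x) \<partial>lborel)"
    by (simp only: lim)
  also have "\<dots> \<le> liminf (\<lambda>K. \<integral>\<^sup>+x. h K x \<partial>lborel)"
    by (rule nn_integral_liminf) (use hm in simp)
  also have "\<dots> \<le> limsup (\<lambda>K. \<integral>\<^sup>+x. h K x \<partial>lborel)" by (rule Liminf_le_Limsup) simp
  also have "\<dots> \<le> ennreal B" by (rule Limsup_bounded) (use hB in simp)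
  finally show ?thesis by (simp add: A_def I_def)
qed

text \<open>The weights are the integrals of the coefficient functions, so the rule integrates the
  sparse interpolant exactly. A node occurring at several levels is listed once for each, which
  makes the length an exact count.\<close>

lemma sparse_quadrature:
  assumes B: "\<And>K. (\<Sum>k\<in>{k\<in>multi_idx K. m \<le> (\<Sum>i\<in>UNIV. k i)}. C ^ CARD('d) * q ^ (\<Sum>i\<in>(UNIV::'d set). k i)) \<le> B"
  shows "\<exists>Q :: (real \<times> (real^'d::finite)) list.
    length Q = (\<Sum>k\<in>{k::'d \<Rightarrow> nat. (\<Sum>i\<in>UNIV. k i) < m}. \<Prod>i\<in>UNIV. card (Z (k i))) \<and>
    (\<forall>p\<in>set Q. snd p \<in> cube U) \<and>
    (\<forall>f\<in>sobolev_ball \<alpha> r U. \<bar>(LINT x:cube U|lborel. f x * wvec \<alpha> 0 x) - quad Q f\<bar> \<le> B)"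
proof -
  define I where "I = {k::'d \<Rightarrow> nat. (\<Sum>i\<in>UNIV. k i) < m}"
  have I: "finite I" unfolding I_def by (rule finite_sum_less)
  define P where "P = (SIGMA k:I. (grid (\<lambda>i. Z (k i)) :: (real^'d) set))"
  have fg: "finite (grid (\<lambda>i. Z (k i)) :: (real^'d) set)" for k by (intro finite_grid finite_Z)
  have P: "finite P" unfolding P_def using I fg by blast
  define W where "W k z = (LINT x:cube U|lborel. (\<Prod>i\<in>UNIV. c (k i) (x $ i) (z $ i)) * wvec \<alpha> 0 x)"
    for k :: "'d \<Rightarrow> nat" and z :: "real^'d"
  obtain ps where ps: "set ps = P" "distinct ps" using finite_distinct_list[OF P] by blast
  define Q where "Q = map (\<lambda>(k, z). (W k z, z)) ps"
  have "length Q = card P" using ps distinct_card[of ps] by (simp add: Q_def)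
  also have "\<dots> = (\<Sum>k\<in>I. \<Prod>i\<in>UNIV. card (Z (k i)))"
    unfolding P_def by (subst card_SigmaI) (use I fg in \<open>auto simp: card_grid\<close>)
  finally have len: "length Q = (\<Sum>k\<in>I. \<Prod>i\<in>UNIV. card (Z (k i)))" .
  have nodes: "\<forall>p\<in>set Q. snd p \<in> cube U"
    using Z_sub by (fastforce simp: Q_def ps P_def grid_def cube_def)
  have "\<bar>(LINT x:cube U|lborel. f x * wvec \<alpha> 0 x) - quad Q f\<bar> \<le> B" if f: "f \<in> sobolev_ball \<alpha> r U" for f
  proof -
    define A where "A x = (\<Sum>k\<in>I. detail f k x)" for x
    have quad: "quad Q f = (\<Sum>k\<in>I. \<Sum>z\<in>grid (\<lambda>i. Z (k i)). W k z * f z)"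
    proof -
      have "quad Q f = (\<Sum>p\<leftarrow>ps. case p of (k, z) \<Rightarrow> W k z * f z)"
        unfolding quad_def Q_def by (simp add: o_def case_prod_beta')
      also have "\<dots> = (\<Sum>p\<in>P. case p of (k, z) \<Rightarrow> W k z * f z)"
        using sum_list_distinct_conv_sum_set[OF ps(2)] ps(1) by simp
      also have "\<dots> = (\<Sum>k\<in>I. \<Sum>z\<in>grid (\<lambda>i. Z (k i)). W k z * f z)"
        unfolding P_def by (rule sum.Sigma[symmetric]) (use I fg in auto)
      finally show ?thesis .
    qed
    have Aw: "A x * wvec \<alpha> 0 x = (\<Sum>k\<in>I. \<Sum>z\<in>grid (\<lambda>i. Z (k i)). f z * ((\<Prod>i\<in>UNIV. c (k i) (x $ i) (z $ i)) * wvec \<alpha> 0 x))" for x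
      unfolding A_def detail_def by (simp add: sum_distrib_left sum_distrib_right mult_ac)
    have iT: "set_integrable lborel (cube U) (\<lambda>x. \<Sum>z\<in>grid (\<lambda>i. Z (k i)). f z * ((\<Prod>i\<in>UNIV. c (k i) (x $ i) (z $ i)) * wvec \<alpha> 0 x))" for k
      by (intro set_integrable_sum set_integrable_mult_right coef_integrable)
    have iA: "set_integrable lborel (cube U) (\<lambda>x. A x * wvec \<alpha> 0 x)"
      unfolding Aw by (rule set_integrable_sum[OF iT])
    have intA: "(LINT x:cube U|lborel. A x * wvec \<alpha> 0 x) = quad Q f"
    proof -
      have "(LINT x:cube U|lborel. A x * wvec \<alpha> 0 x) = (\<Sum>k\<in>I. LINT x:cube U|lborel.
          (\<Sum>z\<in>grid (\<lambda>i. Z (k i)). f z * ((\<Prod>i\<in>UNIV. c (k i) (x $ i) (z $ i)) * wvec \<alpha> 0 x)))"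
        unfolding Aw by (rule set_lebesgue_integral_sum[OF iT])
      also have "\<dots> = (\<Sum>k\<in>I. \<Sum>z\<in>grid (\<lambda>i. Z (k i)). LINT x:cube U|lborel.
          f z * ((\<Prod>i\<in>UNIV. c (k i) (x $ i) (z $ i)) * wvec \<alpha> 0 x))"
        by (intro sum.cong refl set_lebesgue_integral_sum set_integrable_mult_right coef_integrable)
      also have "\<dots> = quad Q f" unfolding quad W_def set_integral_mult_right by (simp only: mult.commute)
      finally show ?thesis .
    qed
    have fm: "f \<in> borel_measurable borel" using f by (simp add: sobolev_ball_def in_L1w_def)
    have Am: "A \<in> borel_measurable borel" unfolding A_def by measurable
    define g where "g x = indicator (cube U) x *\<^sub>R ((f x - A x) * wvec \<alpha> 0 x)" for x
    have gm: "g \<in> borel_measurable lborel" unfolding g_def using fm Am cube_measurable[OF open_U] by measurable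
    have B0: "B \<ge> 0" using order_trans[OF sum_nonneg B[of 0]] C_pos q_bounds by simp
    have nn: "(\<integral>\<^sup>+x. ennreal (norm (g x)) \<partial>lborel) \<le> ennreal B"
    proof -
      have "(\<integral>\<^sup>+x. ennreal (norm (g x)) \<partial>lborel) = (\<integral>\<^sup>+x. ennreal (\<bar>f x - A x\<bar> * wvec \<alpha> 0 x) * indicator (cube U) x \<partial>lborel)"
      proof (rule nn_integral_cong)
        fix x show "ennreal (norm (g x)) = ennreal (\<bar>f x - A x\<bar> * wvec \<alpha> 0 x) * indicator (cube U) x"
          using wvec_nonneg[of \<alpha> 0 x] by (cases "x \<in> cube U") (simp_all add: g_def abs_mult)
      qed
      then show ?thesis using sparse_approximation_error[OF f B] by (simp add: A_def I_def)
    qed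
    have gi: "integrable lborel g"
      by (rule integrableI_bounded[OF gm]) (use nn in \<open>auto intro: le_less_trans\<close>)
    have gs: "set_integrable lborel (cube U) (\<lambda>x. (f x - A x) * wvec \<alpha> 0 x)"
      using gi unfolding set_integrable_def g_def .
    \<comment> \<open>Membership in the ball gives integrability of \<open>f\<close> against
      \<open>wvec \<alpha> r\<close>, not against \<open>wvec \<alpha> 0\<close>; the integral is
      therefore split into two parts already known to be integrable.\<close>
    have "(LINT x:cube U|lborel. f x * wvec \<alpha> 0 x) = (LINT x:cube U|lborel. (f x - A x) * wvec \<alpha> 0 x + A x * wvec \<alpha> 0 x)"
      by (simp add: left_diff_distrib)
    also have "\<dots> = (LINT x:cube U|lborel. (f x - A x) * wvec \<alpha> 0 x) + quad Q f"
      using set_integral_add(2)[OF gs iA] intA by simp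
    finally have "(LINT x:cube U|lborel. f x * wvec \<alpha> 0 x) - quad Q f = (LINT x|lborel. g x)"
      by (simp add: set_lebesgue_integral_def g_def)
    moreover have "ennreal \<bar>LINT x|lborel. g x\<bar> \<le> ennreal B"
      using order_trans[OF integral_norm_bound_ennreal[OF gi] nn] by simp
    ultimately show ?thesis using B0 by simp
  qed
  then show ?thesis using len nodes unfolding I_def by blast
qed

end

section \<open>Convergence rate\<close>

lemma finite_sum_eq: "finite {k::'d::finite \<Rightarrow> nat. (\<Sum>i\<in>UNIV. k i) = s}"
  by (rule finite_subset[OF _ finite_sum_less[of "Suc s"]]) auto

text \<open>One coordinate is determined by the others, and each of these is at most
  \<open>s\<close>.\<close>

lemma card_sum_eq_le: "card {k::'d::finite \<Rightarrow> nat. (\<Sum>i\<in>UNIV. k i) = s} \<le> (s + 1) ^ (CARD('d) - 1)"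
proof -
  obtain i0 :: 'd where "True" by blast
  let ?A = "{k::'d \<Rightarrow> nat. (\<Sum>i\<in>UNIV. k i) = s}" and ?B = "PiE (UNIV - {i0}) (\<lambda>_. {..s})"
  have sum: "(\<Sum>i\<in>UNIV. k i) = k i0 + (\<Sum>i\<in>UNIV - {i0}. k i)" for k :: "'d \<Rightarrow> nat"
    by (rule sum.remove) auto
  have "inj_on (\<lambda>k. restrict k (UNIV - {i0})) ?A"
  proof (rule inj_onI)
    fix k l assume kl: "k \<in> ?A" "l \<in> ?A" and eq: "restrict k (UNIV - {i0}) = restrict l (UNIV - {i0})"
    have e: "k i = l i" if "i \<noteq> i0" for i using fun_cong[OF eq, of i] that by (simp add: restrict_def)
    then have "(\<Sum>i\<in>UNIV - {i0}. k i) = (\<Sum>i\<in>UNIV - {i0}. l i)" by (intro sum.cong) auto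
    then have "k i0 = l i0" using kl sum[of k] sum[of l] by simp
    then show "k = l" using e by (metis ext)
  qed
  moreover have "(\<lambda>k. restrict k (UNIV - {i0})) ` ?A \<subseteq> ?B"
  proof (rule image_subsetI)
    fix k assume "k \<in> ?A"
    moreover have "k i \<le> (\<Sum>i\<in>UNIV. k i)" for i by (rule member_le_sum) auto
    ultimately show "restrict k (UNIV - {i0}) \<in> ?B" by auto
  qed
  ultimately have "card ?A \<le> card ?B" by (intro card_inj_on_le) (auto intro: finite_PiE)
  also have "card ?B = (s + 1) ^ (CARD('d) - 1)" by (simp add: card_PiE card_Diff_singleton)
  finally show ?thesis .
qed

lemma sum_by_level:
  fixes g :: "nat \<Rightarrow> real"
  assumes "finite I" "\<And>k. k \<in> I \<Longrightarrow> (\<Sum>i\<in>UNIV. k i) \<in> S" "finite S" "\<And>s. g s \<ge> 0"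
  shows "(\<Sum>k\<in>I. g (\<Sum>i\<in>(UNIV::'d::finite set). k i)) \<le> (\<Sum>s\<in>S. (real s + 1) ^ (CARD('d) - 1) * g s)"
proof -
  have "(\<Sum>k\<in>I. g (\<Sum>i\<in>UNIV. k i)) = (\<Sum>s\<in>S. \<Sum>k\<in>{k\<in>I. (\<Sum>i\<in>UNIV. k i) = s}. g (\<Sum>i\<in>UNIV. k i))"
    by (rule sum.group[symmetric]) (use assms in auto)
  also have "\<dots> \<le> (\<Sum>s\<in>S. (real s + 1) ^ (CARD('d) - 1) * g s)"
  proof (rule sum_mono)
    fix s
    have "(\<Sum>k\<in>{k\<in>I. (\<Sum>i\<in>UNIV. k i) = s}. g (\<Sum>i\<in>UNIV. k i)) = real (card {k\<in>I. (\<Sum>i\<in>UNIV. k i) = s}) * g s"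
      by simp
    also have "real (card {k\<in>I. (\<Sum>i\<in>UNIV. k i) = s}) \<le> real ((s + 1) ^ (CARD('d) - 1))"
    proof -
      have "card {k\<in>I. (\<Sum>i\<in>UNIV. k i) = s} \<le> card {k::'d \<Rightarrow> nat. (\<Sum>i\<in>UNIV. k i) = s}"
        by (rule card_mono[OF finite_sum_eq]) auto
      then show ?thesis using card_sum_eq_le[where 'd = 'd, of s] by (simp only: of_nat_le_iff)
    qed
    finally show "(\<Sum>k\<in>{k\<in>I. (\<Sum>i\<in>UNIV. k i) = s}. g (\<Sum>i\<in>UNIV. k i)) \<le> (real s + 1) ^ (CARD('d) - 1) * g s"
      using assms(4)[of s] by (simp add: mult_right_mono add.commute)
  qed
  finally show ?thesis .
qed

text \<open>Ratio test: the quotients tend to \<open>q\<close>, so they are eventually below the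
  midpoint between \<open>q\<close> and 1.\<close>

lemma summable_poly_geometric:
  fixes q :: real
  assumes "0 < q" "q < 1"
  shows "summable (\<lambda>j. (real j + 1) ^ e * q ^ j)"
proof -
  have "(\<lambda>j. norm ((real (Suc j) + 1) ^ e * q ^ Suc j) / norm ((real j + 1) ^ e * q ^ j)) \<longlonglongrightarrow> 1 ^ e * q"
  proof (rule Lim_transform_eventually)
    show "(\<lambda>j. (1 + inverse (real (Suc j))) ^ e * q) \<longlonglongrightarrow> 1 ^ e * q"
      by (intro tendsto_mult tendsto_power tendsto_const LIMSEQ_inverse_real_of_nat_add)
    have "(1 + inverse (real (Suc j))) ^ e * q = norm ((real (Suc j) + 1) ^ e * q ^ Suc j) / norm ((real j + 1) ^ e * q ^ j)" for j
    proof -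
      have "1 + inverse (real (Suc j)) = (real (Suc j) + 1) / (real j + 1)" by (simp add: field_simps)
      then show ?thesis using assms by (simp add: power_divide abs_mult)
    qed
    then show "\<forall>\<^sub>F j in sequentially. (1 + inverse (real (Suc j))) ^ e * q =
      norm ((real (Suc j) + 1) ^ e * q ^ Suc j) / norm ((real j + 1) ^ e * q ^ j)" by simp
  qed
  then have "\<forall>\<^sub>F j in sequentially. norm ((real (Suc j) + 1) ^ e * q ^ Suc j) / norm ((real j + 1) ^ e * q ^ j) < (1 + q) / 2"
    using assms by (intro order_tendstoD) auto
  then obtain N where N: "\<And>j. j \<ge> N \<Longrightarrow> norm ((real (Suc j) + 1) ^ e * q ^ Suc j) / norm ((real j + 1) ^ e * q ^ j) < (1 + q) / 2"
    unfolding eventually_sequentially by blast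
  show ?thesis
  proof (rule summable_ratio_test[of "(1 + q) / 2" N])
    fix j assume "N \<le> j"
    have "norm ((real j + 1) ^ e * q ^ j) > 0" using assms by (simp add: add_eq_0_iff)
    then show "norm ((real (Suc j) + 1) ^ e * q ^ Suc j) \<le> (1 + q) / 2 * norm ((real j + 1) ^ e * q ^ j)"
      using N[OF \<open>N \<le> j\<close>] by (simp only: pos_divide_less_eq less_imp_le)
  qed (use assms in simp)
qed

text \<open>Grouping by total level leaves the tail of a polynomial times a geometric sequence,
  which is its first term up to a constant. The bound is uniform in the box size \<open>K\<close>,
  as the passage to the limit needs.\<close>

lemma tail_sum_bound:
  fixes q :: real
  assumes q: "0 < q" "q < 1"
  shows "\<exists>D>0. \<forall>m K. (\<Sum>k\<in>{k\<in>multi_idx K. m \<le> (\<Sum>i\<in>UNIV. k i)}. q ^ (\<Sum>i\<in>(UNIV::'d::finite set). k i))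
    \<le> D * q ^ m * (real m + 1) ^ (CARD('d) - 1)"
proof -
  define e where "e = CARD('d) - 1"
  define D where "D = (\<Sum>j. (real j + 1) ^ e * q ^ j)"
  note sm = summable_poly_geometric[OF q, of e]
  have D: "D > 0" unfolding D_def by (rule suminf_pos[OF sm]) (use q in auto)
  have "(\<Sum>k\<in>{k\<in>multi_idx K. m \<le> (\<Sum>i\<in>UNIV. k i)}. q ^ (\<Sum>i\<in>(UNIV::'d set). k i))
    \<le> D * q ^ m * (real m + 1) ^ e" for m K
  proof -
    define n where "n = K * CARD('d)"
    have "(\<Sum>k\<in>{k\<in>multi_idx K. m \<le> (\<Sum>i\<in>UNIV. k i)}. q ^ (\<Sum>i\<in>(UNIV::'d set). k i))
      \<le> (\<Sum>s\<in>{m..m + n}. (real s + 1) ^ e * q ^ s)"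
      unfolding e_def
    proof (rule sum_by_level)
      show "finite {k\<in>multi_idx K. m \<le> (\<Sum>i\<in>(UNIV::'d set). k i)}"
        by (rule finite_subset[OF _ finite_multi_idx]) auto
      fix k :: "'d \<Rightarrow> nat" assume k: "k \<in> {k\<in>multi_idx K. m \<le> (\<Sum>i\<in>(UNIV::'d set). k i)}"
      have "(\<Sum>i\<in>UNIV. k i) \<le> (\<Sum>i\<in>(UNIV::'d set). K)" by (rule sum_mono) (use k in \<open>auto simp: multi_idx_def\<close>)
      then show "(\<Sum>i\<in>UNIV. k i) \<in> {m..m + n}" using k by (simp add: n_def mult.commute)
    qed (use q in auto)
    also have "\<dots> = (\<Sum>j\<le>n. (real (m + j) + 1) ^ e * q ^ (m + j))"
      by (rule sum.reindex_bij_witness[of _ "\<lambda>j. m + j" "\<lambda>s. s - m"]) auto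
    \<comment> \<open>The inequality m + j + 1 \<le> (m + 1) * (j + 1) separates the starting level
      from the summation index.\<close>
    also have "\<dots> \<le> (\<Sum>j\<le>n. ((real m + 1) * (real j + 1)) ^ e * (q ^ m * q ^ j))"
      by (intro sum_mono mult_mono power_mono) (use q in \<open>auto simp: power_add algebra_simps\<close>)
    also have "\<dots> = (q ^ m * (real m + 1) ^ e) * (\<Sum>j\<le>n. (real j + 1) ^ e * q ^ j)"
      by (simp add: sum_distrib_left power_mult_distrib mult_ac)
    also have "\<dots> \<le> (q ^ m * (real m + 1) ^ e) * D"
      unfolding D_def by (intro mult_left_mono sum_le_suminf sm) (use q in auto)
    finally show ?thesis by (simp add: mult_ac)
  qed
  then show ?thesis using D unfolding e_def by blast
qed

lemma power_half_powr: "x > 0 \<Longrightarrow> (1 / sqrt x) ^ r = x powr (- real r / 2)"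
proof -
  assume x: "x > 0"
  have "x powr (- real r / 2) = (x powr (- (1/2))) powr real r" by (simp add: powr_powr)
  also have "x powr (- (1/2)) = 1 / sqrt x" using x by (simp add: powr_minus powr_half_sqrt field_simps)
  finally show ?thesis using x by (simp add: powr_realpow)
qed

text \<open>The level \<open>m\<close> is the predecessor of the first one whose node bound
  \<open>P\<close> exceeds \<open>n\<close>. That the rule of level \<open>m\<close> fits into
  \<open>n\<close> nodes gives \<open>m = O(ln n)\<close>; that the next one does not gives
  \<open>2^(-m) = O((ln n)^(d-1) / n)\<close>.\<close>

lemma (in sampling_family) sparse_quadrature_rate:
  assumes d: "CARD('d::finite) \<ge> 2" and q: "q = (1 / sqrt 2) ^ r"
  shows "\<exists>C2>0. \<forall>n::nat. n \<ge> 2 \<longrightarrow> (\<exists>Q :: (real \<times> (real^'d)) list. length Q \<le> n \<and> (\<forall>p\<in>set Q. snd p \<in> cube U) \<and>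
    (\<forall>f\<in>sobolev_ball \<alpha> r U. \<bar>(LINT x:cube U|lborel. f x * wvec \<alpha> 0 x) - quad Q f\<bar> \<le>
      C2 * real n powr (- real r / 2) * ln (real n) powr ((real r / 2 + 1) * (real CARD('d) - 1))))"
proof -
  define e where "e = CARD('d) - 1"
  have e: "e \<ge> 1" "real e = real CARD('d) - 1" using d by (auto simp: e_def)
  define A where "A = (max C 1) ^ CARD('d)"
  have A: "A \<ge> 1" by (simp add: A_def)
  obtain D where D: "D > 0" and tail: "\<And>m K. (\<Sum>k\<in>{k\<in>multi_idx K. m \<le> (\<Sum>i\<in>UNIV. k i)}. q ^ (\<Sum>i\<in>(UNIV::'d set). k i))
    \<le> D * q ^ m * (real m + 1) ^ e"
    using tail_sum_bound[where 'd = 'd, OF q_bounds] unfolding e_def by blast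
  define E where "E = A * D"
  have E: "E > 0" using A D by (simp add: E_def)
  define P where "P m = A * real m ^ e * 2 ^ m" for m
  have points: "real (\<Sum>k\<in>{k::'d \<Rightarrow> nat. (\<Sum>i\<in>UNIV. k i) < m}. \<Prod>i\<in>UNIV. card (Z (k i))) \<le> P m" for m
  proof -
    have "real (\<Sum>k\<in>{k::'d \<Rightarrow> nat. (\<Sum>i\<in>UNIV. k i) < m}. \<Prod>i\<in>UNIV. card (Z (k i)))
      = (\<Sum>k\<in>{k::'d \<Rightarrow> nat. (\<Sum>i\<in>UNIV. k i) < m}. \<Prod>i\<in>UNIV. real (card (Z (k i))))"
      by simp
    also have "\<dots> \<le> (\<Sum>k\<in>{k::'d \<Rightarrow> nat. (\<Sum>i\<in>UNIV. k i) < m}. A * 2 ^ (\<Sum>i\<in>UNIV. k i))"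
    proof (rule sum_mono)
      fix k :: "'d \<Rightarrow> nat"
      have "(\<Prod>i\<in>UNIV. real (card (Z (k i)))) \<le> (\<Prod>i\<in>UNIV. max C 1 * 2 ^ k i)"
      proof (rule prod_mono)
        fix i
        have "real (card (Z (k i))) \<le> C * 2 ^ k i" by (rule card_Z)
        also have "\<dots> \<le> max C 1 * 2 ^ k i" by (rule mult_right_mono) auto
        finally show "0 \<le> real (card (Z (k i))) \<and> real (card (Z (k i))) \<le> max C 1 * 2 ^ k i" by simp
      qed
      also have "\<dots> = A * 2 ^ (\<Sum>i\<in>UNIV. k i)" by (simp add: prod.distrib A_def power_sum)
      finally show "(\<Prod>i\<in>UNIV. real (card (Z (k i)))) \<le> A * 2 ^ (\<Sum>i\<in>UNIV. k i)" .
    qed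
    also have "\<dots> = A * (\<Sum>k\<in>{k::'d \<Rightarrow> nat. (\<Sum>i\<in>UNIV. k i) < m}. 2 ^ (\<Sum>i\<in>UNIV. k i))"
      by (simp add: sum_distrib_left)
    also have "\<dots> \<le> A * (\<Sum>s<m. (real s + 1) ^ e * 2 ^ s)"
      unfolding e_def using A by (intro mult_left_mono sum_by_level finite_sum_less) auto
    also have "\<dots> \<le> A * (\<Sum>s<m. real m ^ e * 2 ^ s)"
      using A by (intro mult_left_mono sum_mono mult_right_mono power_mono) auto
    also have "\<dots> = A * (real m ^ e * (2 ^ m - 1))"
      by (simp add: sum_distrib_left[symmetric] geometric_sum)
    also have "\<dots> \<le> P m" using A by (simp add: P_def mult_left_mono)
    finally show ?thesis .
  qed
  \<comment> \<open>\<open>E\<close> comes from the tail sum, \<open>2 * A\<close> from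
    \<open>n < P (m + 1)\<close>, and 4 from \<open>m + 1 \<le> 4 * ln n\<close>.\<close>
  define C2 where "C2 = E * (2 * A) powr (real r / 2) * 4 powr ((real r / 2 + 1) * real e)"
  have C2: "C2 > 0" using E A by (simp add: C2_def)
  have "\<exists>Q :: (real \<times> (real^'d)) list. length Q \<le> n \<and> (\<forall>p\<in>set Q. snd p \<in> cube U) \<and>
    (\<forall>f\<in>sobolev_ball \<alpha> r U. \<bar>(LINT x:cube U|lborel. f x * wvec \<alpha> 0 x) - quad Q f\<bar> \<le>
      C2 * real n powr (- real r / 2) * ln (real n) powr ((real r / 2 + 1) * (real CARD('d) - 1)))"
    if n: "n \<ge> 2" for n :: nat
  proof -
    have Pge: "2 ^ m \<le> P m" if "m \<ge> 1" for m
    proof -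
      have "1 \<le> real m ^ e" using that by (intro one_le_power) simp
      then have "1 * 1 \<le> A * real m ^ e" using A by (intro mult_mono) auto
      from mult_right_mono[OF this, of "2 ^ m"] show ?thesis by (simp add: P_def)
    qed
    have ex: "\<exists>m. real n < P m"
    proof
      have "real n < 2 ^ n" by (rule of_nat_less_two_power)
      also have "\<dots> \<le> P n" using n by (intro Pge) simp
      finally show "real n < P n" .
    qed
    define m0 where "m0 = (LEAST m. real n < P m)"
    have m0: "real n < P m0" unfolding m0_def by (rule LeastI_ex[OF ex])
    \<comment> \<open>Here \<open>d \<ge> 2\<close> is used, as \<open>e \<ge> 1\<close>; it gives
      \<open>m0\<close> a predecessor. That predecessor may be 0, and the rule is then
      empty.\<close>
    have "P 0 = 0" using e by (simp add: P_def)
    then have "m0 \<noteq> 0" using m0 by (metis not_less of_nat_0_le_iff)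
    then obtain m where m: "m0 = Suc m" using not0_implies_Suc by blast
    have le: "P m \<le> real n" using not_less_Least[of m "\<lambda>m. real n < P m"] m unfolding m0_def[symmetric] by simp
    have "2 ^ m \<le> real n" 
    proof (cases "m = 0")
      case False
      then show ?thesis using order_trans[OF Pge le] by simp
    qed (use n in simp)
    then have "ln (2 ^ m) \<le> ln (real n)" by (intro ln_mono) auto
    then have mln: "real m * ln 2 \<le> ln (real n)" by (simp add: ln_realpow)
    have l2: "ln (2::real) \<ge> 1/2"
      using ln_2_less_1 ln_ge_iff[of 2 "1/2"] exp_half_le2 by simp
    have "ln 2 \<le> ln (real n)" using n by (intro ln_mono) auto
    then have ln1: "ln (real n) \<ge> 1/2" using l2 by linarith
    have "real m * (1/2) \<le> real m * ln 2" using l2 by (intro mult_left_mono) auto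
    \<comment> \<open>Both \<open>m \<le> 2 * ln n\<close> and \<open>1 \<le> 2 * ln n\<close> hold,
      the latter because \<open>n \<ge> 2\<close>.\<close>
    then have m1: "real m + 1 \<le> 4 * ln (real n)" using mln ln1 by linarith
    obtain Q :: "(real \<times> (real^'d)) list" where Q: "length Q = (\<Sum>k\<in>{k::'d \<Rightarrow> nat. (\<Sum>i\<in>UNIV. k i) < m}. \<Prod>i\<in>UNIV. card (Z (k i)))"
      "\<forall>p\<in>set Q. snd p \<in> cube U"
      "\<And>f. f \<in> sobolev_ball \<alpha> r U \<Longrightarrow> \<bar>(LINT x:cube U|lborel. f x * wvec \<alpha> 0 x) - quad Q f\<bar> \<le> E * q ^ m * (real m + 1) ^ e"
    proof -
      have "(\<Sum>k\<in>{k\<in>multi_idx K. m \<le> (\<Sum>i\<in>UNIV. k i)}. C ^ CARD('d) * q ^ (\<Sum>i\<in>(UNIV::'d set). k i)) \<le> E * q ^ m * (real m + 1) ^ e" for K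
      proof -
        have "C ^ CARD('d) * (\<Sum>k\<in>{k\<in>multi_idx K. m \<le> (\<Sum>i\<in>UNIV. k i)}. q ^ (\<Sum>i\<in>(UNIV::'d set). k i))
          \<le> A * (D * q ^ m * (real m + 1) ^ e)"
        proof (rule mult_mono[OF _ tail])
          show "C ^ CARD('d) \<le> A" unfolding A_def by (rule power_mono) (use C_pos in auto)
          show "0 \<le> (\<Sum>k\<in>{k\<in>multi_idx K. m \<le> (\<Sum>i\<in>UNIV. k i)}. q ^ (\<Sum>i\<in>(UNIV::'d set). k i))"
            by (rule sum_nonneg) (use q_bounds in simp)
        qed (use A in simp)
        then show ?thesis by (simp add: sum_distrib_left E_def mult_ac)
      qed
      from sparse_quadrature[OF this] show ?thesis using that by blast
    qed
    have "length Q \<le> n" using points[of m] le unfolding Q(1)[symmetric] by linarith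
    moreover have "E * q ^ m * (real m + 1) ^ e \<le>
      C2 * real n powr (- real r / 2) * ln (real n) powr ((real r / 2 + 1) * (real CARD('d) - 1))"
    proof -
      define L where "L = 4 * ln (real n)"
      have L: "L > 0" "real m + 1 \<le> L" using m1 ln1 by (auto simp: L_def)
      have "P m0 = 2 * A * (real m + 1) ^ e * 2 ^ m" by (simp add: P_def m add.commute)
      also have "\<dots> \<le> 2 * A * L ^ e * 2 ^ m"
        using A L by (intro mult_right_mono mult_left_mono power_mono) auto
      finally have "real n \<le> 2 * A * L ^ e * 2 ^ m" using m0 by linarith
      then have b: "1 / 2 ^ m \<le> 2 * A * L ^ e / real n" using n by (simp add: field_simps)
      have "q ^ m = (1 / sqrt (2 ^ m)) ^ r"
        by (simp add: q real_sqrt_power power_one_over mult.commute flip: power_mult)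
      also have "\<dots> = (2 ^ m) powr (- real r / 2)" by (rule power_half_powr) simp
      also have "\<dots> = (1 / 2 ^ m) powr (real r / 2)" by (simp add: powr_minus powr_divide field_simps)
      also have "\<dots> \<le> (2 * A * L ^ e / real n) powr (real r / 2)" using b by (intro powr_mono2) auto
      also have "\<dots> = (2 * A) powr (real r / 2) * L powr (real e * (real r / 2)) * real n powr (- real r / 2)"
        using A L n by (simp add: powr_divide powr_mult powr_minus powr_powr field_simps flip: powr_realpow)
      finally have qm: "q ^ m \<le> (2 * A) powr (real r / 2) * L powr (real e * (real r / 2)) * real n powr (- real r / 2)" .
      have "(real m + 1) ^ e \<le> L ^ e" using L by (intro power_mono) auto
      also have "\<dots> = L powr real e" using L by (simp add: powr_realpow)
      finally have me: "(real m + 1) ^ e \<le> L powr real e" .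
      have "E * q ^ m * (real m + 1) ^ e \<le> E * ((2 * A) powr (real r / 2) * L powr (real e * (real r / 2)) * real n powr (- real r / 2)) * L powr real e"
        by (intro mult_mono mult_left_mono qm me) (use E q_bounds in auto)
      also have "\<dots> = E * (2 * A) powr (real r / 2) * (L powr (real e * (real r / 2)) * L powr real e) * real n powr (- real r / 2)"
        by (simp add: mult_ac)
      also have "L powr (real e * (real r / 2)) * L powr real e = L powr ((real r / 2 + 1) * real e)"
        by (simp add: powr_add[symmetric] algebra_simps)
      also have "\<dots> = 4 powr ((real r / 2 + 1) * real e) * ln (real n) powr ((real r / 2 + 1) * real e)"
        unfolding L_def using ln1 by (intro powr_mult)
      finally show ?thesis unfolding C2_def e(2) by (simp add: mult_ac)
    qed
    ultimately show ?thesis using Q(2,3) order_trans by blast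
  qed
  then show ?thesis using C2 by blast
qed

section \<open>Weak derivatives of smooth tensor products\<close>

lemma integral_translate:
  fixes h :: "'a::euclidean_space \<Rightarrow> real"
  assumes "h \<in> borel_measurable borel"
  shows "(LINT x|lborel. h (x + v)) = (LINT x|lborel. h x)"
proof -
  have "(LINT x|lborel. h x) = (LINT x|distr lborel borel ((+) v). h x)" by (simp add: lborel_distr_plus)
  also have "\<dots> = (LINT x|lborel. h (v + x))" by (rule integral_distr) (use assms in auto)
  finally show ?thesis by (simp add: add.commute)
qed

text \<open>Translation invariance makes the integral of every difference quotient 0, and dominated
  convergence passes this on to the derivative. The coordinates never have to be separated by an
  iterated integral.\<close>

lemma integral_directional_deriv:
  fixes h h' :: "real^'d::finite \<Rightarrow> real"
  assumes h: "continuous_on UNIV h" and h': "continuous_on UNIV h'"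
    and K: "compact K" "\<And>x. x \<notin> K \<Longrightarrow> h x = 0"
    and d: "\<And>x. ((\<lambda>t. h (x + t *\<^sub>R axis i 1)) has_real_derivative h' x) (at 0)"
  shows "(LINT x|lborel. h' x) = 0"
proof -
  let ?e = "axis i 1 :: real^'d"
  obtain R where R: "\<And>x. x \<in> K \<Longrightarrow> norm x \<le> R" using compact_imp_bounded[OF K(1)] by (auto simp: bounded_iff)
  obtain B where B: "\<And>x. x \<in> cball 0 (R + 2) \<Longrightarrow> \<bar>h' x\<bar> \<le> B"
  proof -
    have "bounded (h' ` cball 0 (R + 2))"
      by (intro compact_imp_bounded compact_continuous_image continuous_on_subset[OF h']) auto
    then show ?thesis using that unfolding bounded_iff by (metis imageI real_norm_def)
  qed
  have d_at: "((\<lambda>t. h (x + t *\<^sub>R ?e)) has_real_derivative h' (x + t *\<^sub>R ?e)) (at t)" for x t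
    using DERIV_shift[of "\<lambda>t. h (x + t *\<^sub>R ?e)" "h' (x + t *\<^sub>R ?e)" 0 t] d[of "x + t *\<^sub>R ?e"]
    by (simp add: scaleR_add_left add_ac)
  define s where "s n = 1 / real (Suc n)" for n
  have s: "0 < s n" "s n \<le> 1" for n by (auto simp: s_def)
  define D where "D n x = (h (x + s n *\<^sub>R ?e) - h x) / s n" for n x
  have hm: "h \<in> borel_measurable borel" using h by (rule borel_measurable_continuous_onI)
  have hi: "integrable lborel h" by (rule continuous_compact_integrable[OF h K])
  have hsi: "integrable lborel (\<lambda>x. h (x + v))" for v
  proof (rule continuous_compact_integrable)
    show "compact ((\<lambda>x. x - v) ` K)" using K(1) by (intro compact_continuous_image continuous_intros)
    show "h (x + v) = 0" if "x \<notin> (\<lambda>x. x - v) ` K" for x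
      using that by (intro K(2)) (metis add_diff_cancel_right' image_eqI)
  qed (intro continuous_on_compose2[OF h] continuous_intros, simp)
  have D0: "(LINT x|lborel. D n x) = 0" for n
    unfolding D_def using hi hsi integral_translate[OF hm] by simp
  have "(\<lambda>n. LINT x|lborel. D n x) \<longlonglongrightarrow> (LINT x|lborel. h' x)"
  \<comment> \<open>Steps are at most 1, so the quotients vanish outside radius
    \<open>R + 1\<close>; inside, the mean value theorem gives a value of \<open>h'\<close> within
    radius \<open>R + 2\<close>, where \<open>B\<close> bounds it.\<close>
  proof (rule integral_dominated_convergence[where w = "\<lambda>x. B * indicator (cball 0 (R + 1)) x"])
    show "h' \<in> borel_measurable lborel" using borel_measurable_continuous_onI[OF h'] by simp
    show "D n \<in> borel_measurable lborel" for n
      unfolding D_def using borel_measurable_integrable[OF hi] borel_measurable_integrable[OF hsi] by measurable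
    show "integrable lborel (\<lambda>x. B * indicator (cball 0 (R + 1)) (x :: real^'d))"
      by (intro integrable_mult_right integrable_real_indicator) (use emeasure_bounded_finite[OF bounded_cball, of "0::real^'d" "R + 1"] in auto)
    show "AE x in lborel. (\<lambda>n. D n x) \<longlonglongrightarrow> h' x"
    proof (rule AE_I2)
      fix x
      have "((\<lambda>t. (h (x + t *\<^sub>R ?e) - h x) / t) \<longlongrightarrow> h' x) (at 0)" using d[of x] by (simp add: DERIV_def)
      moreover have "filterlim s (at 0) sequentially"
      proof -
        have "s = (\<lambda>n. inverse (real (Suc n)))" by (simp add: s_def inverse_eq_divide fun_eq_iff)
        then have "s \<longlonglongrightarrow> 0" using LIMSEQ_inverse_real_of_nat by simp
        then show ?thesis unfolding filterlim_at using s by (auto simp: less_imp_neq[symmetric])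
      qed
      ultimately show "(\<lambda>n. D n x) \<longlonglongrightarrow> h' x" unfolding D_def by (rule filterlim_compose)
    qed
    show "AE x in lborel. norm (D n x) \<le> B * indicator (cball 0 (R + 1)) x" for n
    proof (rule AE_I2)
      fix x :: "real^'d"
      have n1: "norm (t *\<^sub>R ?e) \<le> 1" if "0 \<le> t" "t \<le> s n" for t using that s[of n] by (simp add: norm_axis_1)
      show "norm (D n x) \<le> B * indicator (cball 0 (R + 1)) x"
      proof (cases "x \<in> cball 0 (R + 1)")
        case False
        then have "x \<notin> K" using R[of x] by auto
        moreover have "x + s n *\<^sub>R ?e \<notin> K"
          using R[of "x + s n *\<^sub>R ?e"] False n1[of "s n"] s[of n] norm_triangle_ineq4[of "x + s n *\<^sub>R ?e" "s n *\<^sub>R ?e"] by auto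
        ultimately show ?thesis using False K(2) by (simp add: D_def)
      next
        case True
        obtain \<xi> where \<xi>: "0 < \<xi>" "\<xi> < s n" "h (x + s n *\<^sub>R ?e) - h (x + 0 *\<^sub>R ?e) = (s n - 0) * h' (x + \<xi> *\<^sub>R ?e)"
          using MVT2[OF s(1)[of n], of "\<lambda>t. h (x + t *\<^sub>R ?e)" "\<lambda>t. h' (x + t *\<^sub>R ?e)"] d_at by blast
        have "norm (x + \<xi> *\<^sub>R ?e) \<le> R + 2"
          using norm_triangle_ineq[of x "\<xi> *\<^sub>R ?e"] n1[of \<xi>] \<xi> True by auto
        then have "\<bar>h' (x + \<xi> *\<^sub>R ?e)\<bar> \<le> B" by (intro B) simp
        moreover have "D n x = h' (x + \<xi> *\<^sub>R ?e)" using \<xi> s[of n] by (simp add: D_def)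
        ultimately show ?thesis using True by simp
      qed
    qed
  qed
  then show ?thesis unfolding D0 by (simp add: LIMSEQ_const_iff)
qed

lemma test_fun_pdiff:
  assumes "test_fun \<Omega> \<phi>"
  shows "test_fun \<Omega> (pdiff i \<phi>)"
    and "\<And>x. ((\<lambda>t. \<phi> (x + t *\<^sub>R axis i 1)) has_real_derivative pdiff i \<phi> x) (at 0)"
    and "continuous_on UNIV \<phi>" "continuous_on UNIV (pdiff i \<phi>)"
proof -
  let ?S = "closure {x. \<phi> x \<noteq> 0}"
  have a: "compact ?S" "?S \<subseteq> \<Omega>" and c: "\<And>is. continuous_on UNIV (pdiffs is \<phi>)"
    and df: "\<And>is i x. (\<lambda>t. pdiffs is \<phi> (x + t *\<^sub>R axis i 1)) differentiable (at 0)"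
    using assms unfolding test_fun_def by auto
  show der: "((\<lambda>t. \<phi> (x + t *\<^sub>R axis i 1)) has_real_derivative pdiff i \<phi> x) (at 0)" for x
    using df[of "[]" x i] unfolding pdiff_def by (simp add: DERIV_deriv_iff_real_differentiable)
  show "continuous_on UNIV \<phi>" using c[of "[]"] by simp
  show "continuous_on UNIV (pdiff i \<phi>)" using c[of "[i]"] by simp
  \<comment> \<open>Off the closed support \<open>\<phi>\<close> is 0 along a whole neighbourhood in
    direction \<open>i\<close>, so differentiation does not enlarge the support.\<close>
  have "pdiff i \<phi> x = 0" if "x \<notin> ?S" for x
  proof -
    define S where "S = (\<lambda>t. x + t *\<^sub>R axis i 1) -` (- ?S)"
    have "open S" unfolding S_def by (intro open_vimage continuous_intros) auto
    moreover have "0 \<in> S" using that by (simp add: S_def)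
    moreover have "\<phi> (x + t *\<^sub>R axis i 1) = 0" if "t \<in> S" for t
      using that closure_subset[of "{x. \<phi> x \<noteq> 0}"] unfolding S_def by blast
    ultimately have "((\<lambda>t. 0) has_real_derivative pdiff i \<phi> x) (at 0)"
      by (rule has_field_derivative_transform_within_open[OF der[of x]])
    then show ?thesis using DERIV_unique[OF _ DERIV_const] by blast
  qed
  then have sub: "closure {x. pdiff i \<phi> x \<noteq> 0} \<subseteq> ?S" by (intro closure_minimal) auto
  have "compact (closure {x. pdiff i \<phi> x \<noteq> 0})"
    using sub a(1) by (meson bounded_subset closed_closure compact_eq_bounded_closed)
  then show "test_fun \<Omega> (pdiff i \<phi>)" unfolding test_fun_def
    using sub a(2) c[of "i # _"] df[of "i # _"] by auto
qed

lemma mult_eq_0_right: "b = 0 \<Longrightarrow> a * b = (0::real)" by simp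

text \<open>One direction at a time: the directional derivative of the compactly supported product
  of tensor and test function integrates to 0. Derivatives arrive on the tensor in the opposite
  order, which is harmless because only their counts matter there.\<close>

lemma tensor_integration_by_parts:
  fixes u :: "'d::finite \<Rightarrow> real \<Rightarrow> real"
  assumes "\<And>i. smooth (u i)" "test_fun \<Omega> \<phi>"
  shows "(LINT x|lborel. tensor u x * pdiffs is \<phi> x) =
    (-1) ^ length is * (LINT x|lborel. tensor (\<lambda>j. (deriv ^^ count (mset is) j) (u j)) x * \<phi> x)"
  using assms(2)
proof (induction "is" arbitrary: \<phi>)
  case (Cons i "is")
  define v where "v j = (deriv ^^ count (mset is) j) (u j)" for j
  have v: "smooth (v j)" for j unfolding v_def by (intro smooth_higher_deriv assms(1))
  have t: "test_fun \<Omega> (pdiff i \<phi>)"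
    "\<And>x. ((\<lambda>t. \<phi> (x + t *\<^sub>R axis i 1)) has_real_derivative pdiff i \<phi> x) (at 0)"
    "continuous_on UNIV \<phi>" "continuous_on UNIV (pdiff i \<phi>)"
    by (fact test_fun_pdiff[OF Cons.prems])+
  have ct: "continuous_on UNIV (tensor v)" "continuous_on UNIV (tensor (v(i := deriv (v i))))"
  proof -
    have "smooth ((v(i := deriv (v i))) j)" for j using v smooth_deriv[OF v] by simp
    then show "continuous_on UNIV (tensor v)" "continuous_on UNIV (tensor (v(i := deriv (v i))))"
      by (intro continuous_tensor smooth_continuous v, intro continuous_tensor smooth_continuous)
  qed
  have K: "compact (closure {x. \<phi> x \<noteq> 0})" using Cons.prems by (simp add: test_fun_def)
  have z: "\<phi> x = 0" if "x \<notin> closure {x. \<phi> x \<noteq> 0}" for x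
    using that closure_subset[of "{x. \<phi> x \<noteq> 0}"] by blast
  have z': "pdiff i \<phi> x = 0" if "x \<notin> closure {x. pdiff i \<phi> x \<noteq> 0}" for x
    using that closure_subset[of "{x. pdiff i \<phi> x \<noteq> 0}"] by blast
  have K': "compact (closure {x. pdiff i \<phi> x \<noteq> 0})" using t(1) by (simp add: test_fun_def)
  have i1: "integrable lborel (\<lambda>x. tensor (v(i := deriv (v i))) x * \<phi> x)"
    by (rule continuous_compact_integrable[OF continuous_on_mult[OF ct(2) t(3)] K]) (rule mult_eq_0_right[OF z])
  have i2: "integrable lborel (\<lambda>x. tensor v x * pdiff i \<phi> x)"
    by (rule continuous_compact_integrable[OF continuous_on_mult[OF ct(1) t(4)] K']) (rule mult_eq_0_right[OF z'])
  have "(LINT x|lborel. tensor (v(i := deriv (v i))) x * \<phi> x + tensor v x * pdiff i \<phi> x) = 0"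
  proof (rule integral_directional_deriv[where h = "\<lambda>x. tensor v x * \<phi> x" and i = i, OF _ _ K])
    show "((\<lambda>t. tensor v (x + t *\<^sub>R axis i 1) * \<phi> (x + t *\<^sub>R axis i 1)) has_real_derivative
        tensor (v(i := deriv (v i))) x * \<phi> x + tensor v x * pdiff i \<phi> x) (at 0)" for x
      using DERIV_mult[OF tensor_has_deriv[where u = v and i = i and x = x, OF v] t(2)[of x]] by (simp add: add.commute mult.commute)
    show "continuous_on UNIV (\<lambda>x. tensor v x * \<phi> x)" by (rule continuous_on_mult[OF ct(1) t(3)])
    show "continuous_on UNIV (\<lambda>x. tensor (v(i := deriv (v i))) x * \<phi> x + tensor v x * pdiff i \<phi> x)"
      by (intro continuous_on_add continuous_on_mult ct t(3,4))
  qed (rule mult_eq_0_right[OF z])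
  then have ibp: "(LINT x|lborel. tensor v x * pdiff i \<phi> x) = - (LINT x|lborel. tensor (v(i := deriv (v i))) x * \<phi> x)"
    using i1 i2 by simp
  have "v(i := deriv (v i)) = (\<lambda>j. (deriv ^^ count (mset (i # is)) j) (u j))"
    by (auto simp: v_def fun_eq_iff)
  note eq = this
  have IH: "(LINT x|lborel. tensor u x * pdiffs is (pdiff i \<phi>) x) = (-1) ^ length is * (LINT x|lborel. tensor v x * pdiff i \<phi> x)"
    using Cons.IH[OF t(1)] unfolding v_def .
  show ?case unfolding eq[symmetric] pdiffs.simps IH ibp by simp
qed simp

lemma tensor_has_weak_deriv:
  fixes u :: "'d::finite \<Rightarrow> real \<Rightarrow> real"
  assumes u: "\<And>i. smooth (u i)"
  shows "has_weak_deriv \<Omega> (tensor u) k (tensor (\<lambda>j. (deriv ^^ k j) (u j)))"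
proof -
  have loc: "locally_integrable_on g \<Omega>" if "continuous_on UNIV g" for g :: "real^'d \<Rightarrow> real"
    unfolding locally_integrable_on_def set_integrable_def
  proof (intro allI impI, elim conjE)
    fix K :: "(real^'d) set" assume "compact K"
    then show "integrable lborel (\<lambda>x. indicator K x *\<^sub>R g x)"
      by (rule borel_integrable_compact[OF _ continuous_on_subset[OF that]]) simp
  qed
  have pw: "(LINT x:\<Omega>|lborel. g x * \<psi> x) = (LINT x|lborel. g x * \<psi> x)"
    if "\<And>x. x \<notin> \<Omega> \<Longrightarrow> \<psi> x = 0" for g \<psi> :: "real^'d \<Rightarrow> real"
    unfolding set_lebesgue_integral_def
    by (rule Bochner_Integration.integral_cong) (use that in \<open>auto simp: indicator_def\<close>)
  have van: "\<psi> x = 0" if "test_fun \<Omega> \<psi>" "x \<notin> \<Omega>" for \<psi> and x :: "real^'d"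
    using that closure_subset[of "{x. \<psi> x \<noteq> 0}"] unfolding test_fun_def by blast
  have tp: "test_fun \<Omega> (pdiffs is \<phi>)" if "test_fun \<Omega> \<phi>" for "is" and \<phi> :: "real^'d \<Rightarrow> real"
    using that by (induction "is" arbitrary: \<phi>) (auto intro: test_fun_pdiff)
  show ?thesis unfolding has_weak_deriv_def
  proof (intro conjI allI impI)
    fix \<phi> :: "real^'d \<Rightarrow> real" and "is" assume a: "test_fun \<Omega> \<phi> \<and> (\<forall>i. count (mset is) i = k i)"
    have "length is = (\<Sum>i\<in>set_mset (mset is). count (mset is) i)"
      by (metis size_mset size_multiset_overloaded_eq)
    also have "\<dots> = (\<Sum>i\<in>UNIV. k i)"
      by (rule sum.mono_neutral_cong_left) (use a in \<open>auto simp: count_eq_zero_iff[symmetric] simp del: set_mset_mset\<close>)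
    finally have len: "length is = (\<Sum>i\<in>UNIV. k i)" .
    show "(LINT x:\<Omega>|lborel. tensor u x * pdiffs is \<phi> x) =
      (-1) ^ (\<Sum>i\<in>UNIV. k i) * (LINT x:\<Omega>|lborel. tensor (\<lambda>j. (deriv ^^ k j) (u j)) x * \<phi> x)"
    proof -
      have "(LINT x|lborel. tensor u x * pdiffs is \<phi> x) =
        (-1) ^ length is * (LINT x|lborel. tensor (\<lambda>j. (deriv ^^ count (mset is) j) (u j)) x * \<phi> x)"
        by (rule tensor_integration_by_parts[OF u conjunct1[OF a]])
      also have "(\<lambda>j. (deriv ^^ count (mset is) j) (u j)) = (\<lambda>j. (deriv ^^ k j) (u j))" using a by simp
      finally have *: "(LINT x|lborel. tensor u x * pdiffs is \<phi> x) =
        (-1) ^ length is * (LINT x|lborel. tensor (\<lambda>j. (deriv ^^ k j) (u j)) x * \<phi> x)" .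
      have "(LINT x:\<Omega>|lborel. tensor u x * pdiffs is \<phi> x) = (LINT x|lborel. tensor u x * pdiffs is \<phi> x)"
        by (rule pw, rule van[OF tp[OF conjunct1[OF a]]])
      moreover have "(LINT x:\<Omega>|lborel. tensor (\<lambda>j. (deriv ^^ k j) (u j)) x * \<phi> x) =
        (LINT x|lborel. tensor (\<lambda>j. (deriv ^^ k j) (u j)) x * \<phi> x)"
        by (rule pw, rule van[OF conjunct1[OF a]])
      ultimately show ?thesis using * by (simp only: len)
    qed
  qed (intro loc continuous_tensor smooth_continuous u smooth_higher_deriv)+
qed

section \<open>The lower bound\<close>

text \<open>All coordinates but one may be chosen freely up to \<open>m div d\<close>; the remaining
  one then fills the sum up to \<open>m\<close>.\<close>

lemma card_sum_eq_ge:
  "(m div CARD('d::finite) + 1) ^ (CARD('d) - 1) \<le> card {k::'d \<Rightarrow> nat. (\<Sum>i\<in>UNIV. k i) = m}"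
proof -
  obtain i0 :: 'd where "True" by blast
  define p where "p = m div CARD('d)"
  let ?A = "{k::'d \<Rightarrow> nat. (\<Sum>i\<in>UNIV. k i) = m}" and ?B = "PiE (UNIV - {i0}) (\<lambda>_. {..p})"
  define F where "F g = (\<lambda>i. if i = i0 then m - (\<Sum>j\<in>UNIV - {i0}. g j) else g i)" for g :: "'d \<Rightarrow> nat"
  have le: "(\<Sum>j\<in>UNIV - {i0}. g j) \<le> m" if "g \<in> ?B" for g
  proof -
    have "(\<Sum>j\<in>UNIV - {i0}. g j) \<le> (\<Sum>j\<in>UNIV - {i0}. p)" by (rule sum_mono) (use that in auto)
    also have "\<dots> \<le> CARD('d) * p" by (simp add: card_Diff_singleton)
    also have "\<dots> \<le> m" unfolding p_def by (rule times_div_less_eq_dividend)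
    finally show ?thesis .
  qed
  have "card ?B = (p + 1) ^ (CARD('d) - 1)" by (simp add: card_PiE card_Diff_singleton)
  moreover have "card ?B \<le> card ?A"
  proof (rule card_inj_on_le[of F])
    show "inj_on F ?B"
    proof (rule inj_onI)
      fix g h assume gh: "g \<in> ?B" "h \<in> ?B" "F g = F h"
      have "g i = h i" if "i \<in> UNIV - {i0}" for i using fun_cong[OF gh(3), of i] that by (simp add: F_def)
      then show "g = h" using gh(1,2) by (rule PiE_ext[rotated 2])
    qed
    show "F ` ?B \<subseteq> ?A"
    proof (rule image_subsetI)
      fix g assume g: "g \<in> ?B"
      have "(\<Sum>i\<in>UNIV. F g i) = F g i0 + (\<Sum>i\<in>UNIV - {i0}. F g i)" by (rule sum.remove) auto
      also have "(\<Sum>i\<in>UNIV - {i0}. F g i) = (\<Sum>i\<in>UNIV - {i0}. g i)" by (rule sum.cong) (auto simp: F_def)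
      finally show "F g \<in> ?A" using le[OF g] by (simp add: F_def)
    qed
  qed (rule finite_sum_eq)
  ultimately show ?thesis by (simp add: p_def)
qed

section \<open>Integer points in dyadic blocks\<close>

definition dyadic_block :: "('d::finite \<Rightarrow> nat) \<Rightarrow> ('d \<Rightarrow> nat) set" where
  "dyadic_block a = {k. \<forall>i. 2 ^ a i \<le> k i \<and> k i < 2 ^ (a i + 1)}"

lemma dyadic_block_PiE: "dyadic_block a = PiE UNIV (\<lambda>i. {2 ^ a i..<2 ^ (a i + 1)})"
  by (auto simp: dyadic_block_def PiE_def Pi_def)

lemma dyadic_block_card: "finite (dyadic_block a)" "card (dyadic_block a) = 2 ^ (\<Sum>i\<in>UNIV. a i)"
  unfolding dyadic_block_PiE by (auto simp: card_PiE power_sum intro: finite_PiE)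

lemma dyadic_unique:
  assumes "2 ^ a \<le> (k::nat)" "k < 2 ^ (a + 1)" "2 ^ b \<le> k" "k < 2 ^ (b + 1)" shows "a = b"
proof -
  have "(2::nat) ^ a < 2 ^ (b + 1)" "(2::nat) ^ b < 2 ^ (a + 1)" using assms by linarith+
  then have "a < b + 1" "b < a + 1" by (simp_all only: power_strict_increasing_iff[of 2] one_less_numeral_iff semiring_norm)
  then show ?thesis by simp
qed

text \<open>The blocks are disjoint, since a positive integer lies in only one dyadic range, and
  each contains exactly \<open>2 ^ m\<close> points; their number is at least of order
  m^(d-1).\<close>

lemma dyadic_blocks_card:
  "2 ^ m * (m div CARD('d::finite) + 1) ^ (CARD('d) - 1) \<le>
    card (\<Union>a\<in>{a::'d \<Rightarrow> nat. (\<Sum>i\<in>UNIV. a i) = m}. dyadic_block a)"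
proof -
  have "card (\<Union>a\<in>{a::'d \<Rightarrow> nat. (\<Sum>i\<in>UNIV. a i) = m}. dyadic_block a) =
    (\<Sum>a\<in>{a::'d \<Rightarrow> nat. (\<Sum>i\<in>UNIV. a i) = m}. card (dyadic_block a))"
  proof (rule card_UN_disjoint[OF finite_sum_eq])
    show "\<forall>a\<in>{a::'d \<Rightarrow> nat. sum a UNIV = m}. finite (dyadic_block a)" using dyadic_block_card(1) by blast
    show "\<forall>a\<in>{a::'d \<Rightarrow> nat. sum a UNIV = m}. \<forall>b\<in>{a. sum a UNIV = m}. a \<noteq> b \<longrightarrow> dyadic_block a \<inter> dyadic_block b = {}"
    proof (intro ballI impI, rule ccontr)
      fix a b :: "'d \<Rightarrow> nat" assume "a \<noteq> b" "dyadic_block a \<inter> dyadic_block b \<noteq> {}"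
      then obtain k where "k \<in> dyadic_block a" "k \<in> dyadic_block b" by blast
      then have "a i = b i" for i unfolding dyadic_block_def using dyadic_unique[of "a i" "k i" "b i"] by blast
      then show False using \<open>a \<noteq> b\<close> by blast
    qed
  qed
  also have "\<dots> = (\<Sum>a\<in>{a::'d \<Rightarrow> nat. (\<Sum>i\<in>UNIV. a i) = m}. 2 ^ m)"
    by (rule sum.cong) (auto simp: dyadic_block_card)
  also have "\<dots> = card {a::'d \<Rightarrow> nat. (\<Sum>i\<in>UNIV. a i) = m} * 2 ^ m" by simp
  finally show ?thesis using card_sum_eq_ge[where 'd = 'd, of m] by (simp add: mult.commute)
qed

lemma dyadic_block_prod_le:
  fixes k :: "'d::finite \<Rightarrow> nat"
  assumes "k \<in> dyadic_block a" shows "(\<Prod>i\<in>UNIV. real (k i)) \<le> 2 ^ ((\<Sum>i\<in>UNIV. a i) + CARD('d))"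
proof -
  have "(\<Prod>i\<in>UNIV. real (k i)) \<le> (\<Prod>i\<in>UNIV. 2 ^ (a i + 1))"
  proof (rule prod_mono)
    fix i
    have "k i \<le> 2 ^ (a i + 1)" using assms by (simp add: dyadic_block_def less_imp_le)
    then have "real (k i) \<le> real (2 ^ (a i + 1))" by (rule of_nat_mono)
    then show "0 \<le> real (k i) \<and> real (k i) \<le> 2 ^ (a i + 1)" by simp
  qed
  also have "\<dots> = 2 ^ (\<Sum>i\<in>UNIV. a i + 1)" by (rule power_sum[symmetric])
  also have "(\<Sum>i\<in>UNIV. a i + 1) = (\<Sum>i\<in>UNIV. a i) + CARD('d)"
    using sum.distrib[of a "\<lambda>_. 1::nat" UNIV] by simp
  finally show ?thesis .
qed

text \<open>On \<open>[k, k + 1]\<close> with \<open>k \<ge> 1\<close> the argument varies by at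
  most a factor 2 and the exponential by at most a factor e.\<close>

lemma wr_near_integer:
  fixes k :: nat
  assumes "k \<ge> 1" "real k \<le> t" "t \<le> real k + 1"
  shows "wr \<alpha> r t \<le> 2 powr \<bar>\<alpha> + real r / 2\<bar> * (real k powr (\<alpha> + real r / 2) * exp (- real k))"
    and "2 powr (- \<bar>\<alpha> + real r / 2\<bar>) * exp (-1) * (real k powr (\<alpha> + real r / 2) * exp (- real k)) \<le> wr \<alpha> r t"
proof -
  define \<beta> where "\<beta> = \<alpha> + real r / 2"
  have k: "real k \<ge> 1" using assms by simp
  have t: "t > 0" "t \<le> 2 * real k" "real k \<le> 2 * t" using k assms by linarith+
  have w: "wr \<alpha> r t = t powr \<beta> * exp (- t)" using t by (simp add: wr_def \<beta>_def)
  have "t powr \<beta> \<le> 2 powr \<bar>\<beta>\<bar> * real k powr \<beta>" using t k by (intro powr_le_powr_ratio) auto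
  then have "t powr \<beta> * exp (- t) \<le> (2 powr \<bar>\<beta>\<bar> * real k powr \<beta>) * exp (- real k)"
    using assms by (intro mult_mono) auto
  then show "wr \<alpha> r t \<le> 2 powr \<bar>\<alpha> + real r / 2\<bar> * (real k powr (\<alpha> + real r / 2) * exp (- real k))"
    unfolding w \<beta>_def by (simp add: mult_ac)
  have "real k powr \<beta> \<le> 2 powr \<bar>\<beta>\<bar> * t powr \<beta>" using t k by (intro powr_le_powr_ratio) auto
  then have "2 powr (- \<bar>\<beta>\<bar>) * real k powr \<beta> \<le> t powr \<beta>" by (simp add: powr_minus field_simps)
  moreover have "exp (-1) * exp (- real k) \<le> exp (- t)" unfolding mult_exp_exp using assms by simp
  ultimately have "(2 powr (- \<bar>\<beta>\<bar>) * real k powr \<beta>) * (exp (-1) * exp (- real k)) \<le> t powr \<beta> * exp (- t)"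
    by (intro mult_mono) auto
  then show "2 powr (- \<bar>\<alpha> + real r / 2\<bar>) * exp (-1) * (real k powr (\<alpha> + real r / 2) * exp (- real k)) \<le> wr \<alpha> r t"
    unfolding w \<beta>_def by (simp add: mult_ac)
qed

section \<open>Bump functions in the unit ball\<close>

lemma moll_derivs_bounded:
  "\<exists>M\<ge>1. \<forall>j\<le>r. \<forall>x. \<bar>(deriv ^^ j) (moll (1/2)) x\<bar> \<le> M * indicator {- (1/2)..1/2} x"
proof -
  have "\<exists>B. \<forall>x\<in>{- (1/2)..1/2}. \<bar>(deriv ^^ j) (moll (1/2)) x\<bar> \<le> B" for j
  proof -
    have "bounded ((deriv ^^ j) (moll (1/2)) ` {- (1/2)..1/2})"
      by (intro compact_imp_bounded compact_continuous_image smooth_continuous smooth_higher_deriv smooth_moll) auto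
    then show ?thesis unfolding bounded_iff by (metis imageI real_norm_def)
  qed
  then obtain B where B: "\<And>j x. x \<in> {- (1/2)..1/2} \<Longrightarrow> \<bar>(deriv ^^ j) (moll (1/2)) x\<bar> \<le> B j" by metis
  define M where "M = 1 + (\<Sum>j\<le>r. \<bar>B j\<bar>)"
  have M: "M \<ge> 1" by (simp add: M_def sum_nonneg)
  have "\<bar>(deriv ^^ j) (moll (1/2)) x\<bar> \<le> M * indicator {- (1/2)..1/2} x" if j: "j \<le> r" for j x
  proof (cases "x \<in> {- (1/2)..1/2}")
    case True
    have "\<bar>B j\<bar> \<le> (\<Sum>j\<le>r. \<bar>B j\<bar>)" by (rule member_le_sum) (use j in auto)
    then show ?thesis using B[OF True, of j] True by (simp add: M_def)
  next
    case False
    have "(deriv ^^ j) (moll (1/2)) x = 0"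
      by (rule higher_deriv_zero_outside[OF smooth_moll closed_atLeastAtMost _ False]) (auto intro!: moll_zero)
    then show ?thesis using False by simp
  qed
  then show ?thesis using M by blast
qed

lemma tensor_moll_integral:
  assumes "\<epsilon> > 0" shows "integrable lborel (tensor (\<lambda>i s. moll \<epsilon> (s - z i)) :: real^'d::finite \<Rightarrow> real)"
    and "(LINT x|lborel. tensor (\<lambda>i s. moll \<epsilon> (s - z i)) (x :: real^'d::finite)) = 1"
proof -
  let ?\<phi> = "tensor (\<lambda>i s. moll \<epsilon> (s - z i)) :: real^'d \<Rightarrow> real"
  have m: "(\<lambda>s. moll \<epsilon> (s - z i)) \<in> borel_measurable borel" for i
    by (intro borel_measurable_continuous_onI smooth_continuous smooth_shift smooth_moll)
  have nn: "?\<phi> x \<ge> 0" for x unfolding tensor_def by (rule prod_nonneg) (simp add: moll_nonneg)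
  have I: "(\<integral>\<^sup>+x. ennreal (?\<phi> x) \<partial>lborel) = 1"
    by (subst nn_integral_tensor[OF m moll_nonneg]) (simp add: moll_nn_integral assms)
  show i: "integrable lborel ?\<phi>"
    by (rule integrableI_nn_integral_finite[where x = 1]) (use tensor_measurable[OF m] nn I in auto)
  show "(LINT x|lborel. ?\<phi> x) = 1"
    using nn_integral_eq_integral[OF i] nn I by (simp add: ennreal_eq_1)
qed

text \<open>In each coordinate the height k^(-\<beta>) * exp(k), with \<beta> = \<alpha> + r/2,
  cancels the weight of the norm on the unit cell. The integral uses \<open>wr \<alpha> 0\<close>,
  which is smaller there by the order k^(-r/2); that loss is the product in the bound.\<close>

lemma bump_in_ball:
  assumes \<alpha>: "\<alpha> > -1" and U: "U = UNIV \<or> U = {0<..}"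
  shows "\<exists>b>0. \<forall>k::'d::finite \<Rightarrow> nat. (\<forall>i. k i \<ge> 1) \<longrightarrow> (\<exists>f\<in>sobolev_ball \<alpha> r U.
    (\<forall>x. f x \<noteq> 0 \<longrightarrow> (\<forall>i. real (k i) < x $ i \<and> x $ i < real (k i) + 1)) \<and>
    b * (\<Prod>i\<in>UNIV. real (k i)) powr (- real r / 2) \<le> \<bar>LINT x:cube U|lborel. f x * wvec \<alpha> 0 x\<bar>)"
proof -
  obtain M where M: "M \<ge> 1" "\<And>j x. j \<le> r \<Longrightarrow> \<bar>(deriv ^^ j) (moll (1/2)) x\<bar> \<le> M * indicator {- (1/2)..1/2} x"
    using moll_derivs_bounded by blast
  define \<beta> where "\<beta> = \<alpha> + real r / 2"
  define W where "W = 2 powr \<bar>\<beta>\<bar>"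
  \<comment> \<open>Chosen so that each univariate factor, differentiated or not, has weighted norm
    at most \<open>1 / (r + 1)\<close>: \<open>M\<close> bounds the derivatives of the mollifier and
    \<open>W\<close> the oscillation of the weight.\<close>
  define a0 where "a0 = 1 / ((real r + 1) * M * W)"
  define w0 where "w0 = 2 powr (- \<bar>\<alpha>\<bar>) * exp (-1 :: real)"
  define b where "b = (a0 * w0) ^ CARD('d)"
  have pos: "W > 0" "a0 > 0" "w0 > 0" "b > 0" using M by (auto simp: W_def a0_def w0_def b_def)
  have "\<exists>f\<in>sobolev_ball \<alpha> r U.
    (\<forall>x. f x \<noteq> 0 \<longrightarrow> (\<forall>i. real (k i) < x $ i \<and> x $ i < real (k i) + 1)) \<and>
    b * (\<Prod>i\<in>UNIV. real (k i)) powr (- real r / 2) \<le> \<bar>LINT x:cube U|lborel. f x * wvec \<alpha> 0 x\<bar>"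
    if k: "\<And>i. k i \<ge> 1" for k :: "'d \<Rightarrow> nat"
  proof -
    define a where "a i = a0 * (real (k i) powr (- \<beta>) * exp (real (k i)))" for i
    define m where "m i = (\<lambda>t. moll (1/2) (t - (real (k i) + 1/2)))" for i
    define u where "u i = (\<lambda>t. a i * m i t)" for i
    have kp: "real (k i) \<ge> 1" for i using k[of i] by simp
    have a: "a i > 0" for i using pos kp[of i] by (simp add: a_def)
    have sm: "smooth (m i)" for i unfolding m_def by (intro smooth_shift smooth_moll)
    have su: "smooth (u i)" for i unfolding u_def by (intro smooth_cmult sm)
    have inU: "t \<in> U" if "real (k i) \<le> t" for i t using that kp[of i] U by auto
    have der: "\<bar>(deriv ^^ j) (u i) t\<bar> \<le> a i * M * indicator {real (k i)..real (k i) + 1} t" if "j \<le> r" for i j t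
    proof -
      have "(deriv ^^ j) (u i) t = a i * (deriv ^^ j) (moll (1/2)) (t - (real (k i) + 1/2))"
        using higher_deriv_cmult[OF sm[of i], of j "a i"] higher_deriv_shift[OF smooth_moll, of j "1/2" "real (k i) + 1/2"]
        by (simp add: u_def m_def)
      moreover have "indicator {- (1/2)..1/2} (t - (real (k i) + 1/2)) = (indicator {real (k i)..real (k i) + 1} t :: real)"
        by (auto simp: indicator_def)
      ultimately show ?thesis using mult_left_mono[OF M(2)[OF that, of "t - (real (k i) + 1/2)"] less_imp_le[OF a[of i]]] a[of i]
        by (simp add: abs_mult mult.assoc)
    qed
    define f where "f = tensor u"
    define G where "G J = tensor (\<lambda>i. (deriv ^^ J i) (u i))" for J
    have Gc: "continuous_on UNIV (G J)" for J
      unfolding G_def by (intro continuous_tensor smooth_continuous smooth_higher_deriv su)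
    have Gm: "G J \<in> borel_measurable borel" for J using Gc by (rule borel_measurable_continuous_onI)
    have fG: "f = G (\<lambda>_. 0)" by (simp add: f_def G_def)
    \<comment> \<open>There are (r + 1)^d multi-indices, and each contributes at most s^d to the
      norm, so the sum is at most 1.\<close>
    define s where "s = 1 / (real r + 1)"
    have nnG: "(\<integral>\<^sup>+x. ennreal (\<bar>G J x\<bar> * wvec \<alpha> r x) * indicator (cube U) x \<partial>lborel) \<le> ennreal (s ^ CARD('d))"
      if J: "J \<in> multi_idx r" for J
    proof -
      define g where "g i = (\<lambda>t. s * indicator {real (k i)..real (k i) + 1} t :: real)" for i :: 'd
      have "(\<integral>\<^sup>+x. ennreal (\<bar>G J x\<bar> * wvec \<alpha> r x) * indicator (cube U) x \<partial>lborel) \<le> (\<integral>\<^sup>+x. ennreal (tensor g x) \<partial>lborel)"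
      proof (rule nn_integral_mono)
        fix x :: "real^'d"
        have "\<bar>G J x\<bar> * wvec \<alpha> r x = (\<Prod>i\<in>UNIV. \<bar>(deriv ^^ J i) (u i) (x $ i)\<bar> * wr \<alpha> r (x $ i))"
          by (simp add: G_def tensor_def wvec_def abs_prod prod.distrib)
        also have "\<dots> \<le> tensor g x" unfolding tensor_def
        proof (rule prod_mono, rule conjI)
          fix i
          have Ji: "J i \<le> r" using J by (simp add: multi_idx_def)
          show "0 \<le> \<bar>(deriv ^^ J i) (u i) (x $ i)\<bar> * wr \<alpha> r (x $ i)"
            by (intro mult_nonneg_nonneg wr_nonneg) simp
          show "\<bar>(deriv ^^ J i) (u i) (x $ i)\<bar> * wr \<alpha> r (x $ i) \<le> g i (x $ i)"
          proof (cases "x $ i \<in> {real (k i)..real (k i) + 1}")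
            case False
            then have "(deriv ^^ J i) (u i) (x $ i) = 0" using der[OF Ji, of i "x $ i"] by simp
            then show ?thesis using False by (simp add: g_def)
          next
            case True
            have "\<bar>(deriv ^^ J i) (u i) (x $ i)\<bar> * wr \<alpha> r (x $ i) \<le>
              (a i * M) * (W * (real (k i) powr \<beta> * exp (- real (k i))))"
              using der[OF Ji, of i "x $ i"] True wr_near_integer(1)[OF k, of i "x $ i" \<alpha> r] a[of i] M
              unfolding W_def \<beta>_def by (intro mult_mono) (auto simp: wr_nonneg)
            also have "\<dots> = a0 * M * W * ((real (k i) powr (- \<beta>) * real (k i) powr \<beta>) * (exp (real (k i)) * exp (- real (k i))))"
              by (simp add: a_def mult_ac)
            also have "real (k i) powr (- \<beta>) * real (k i) powr \<beta> = 1" using kp[of i] by (simp flip: powr_add)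
            also have "exp (real (k i)) * exp (- real (k i)) = 1" by (simp add: mult_exp_exp)
            also have "a0 * M * W * (1 * 1) = s" using M pos by (simp add: a0_def s_def)
            finally show ?thesis using True by (simp add: g_def)
          qed
        qed
        finally show "ennreal (\<bar>G J x\<bar> * wvec \<alpha> r x) * indicator (cube U) x \<le> ennreal (tensor g x)"
          by (cases "x \<in> cube U") (auto intro: ennreal_leI)
      qed
      also have "\<dots> = (\<Prod>i\<in>UNIV. \<integral>\<^sup>+t. ennreal (g i t) \<partial>lborel)"
        by (rule nn_integral_tensor) (auto simp: g_def s_def)
      also have "\<dots> = (\<Prod>i\<in>(UNIV::'d set). ennreal s)"
        unfolding g_def by (intro prod.cong refl) (subst nn_integral_const_interval, auto simp: s_def)
      also have "\<dots> = ennreal (s ^ CARD('d))" by (simp add: ennreal_power s_def)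
      finally show ?thesis .
    qed
    have oU: "open U" using U by auto
    have GL: "in_L1w \<alpha> r U (G J)" if J: "J \<in> multi_idx r" for J
      unfolding in_L1w_def set_integrable_def
    proof (intro conjI integrableI_bounded)
      show "G J \<in> borel_measurable lborel" using Gm by simp
      show "(\<lambda>x. indicator (cube U) x *\<^sub>R (G J x * wvec \<alpha> r x)) \<in> borel_measurable lborel"
        using Gm[of J] cube_measurable[OF oU] by measurable
      have "(\<integral>\<^sup>+x. ennreal (norm (indicator (cube U) x *\<^sub>R (G J x * wvec \<alpha> r x))) \<partial>lborel) =
        (\<integral>\<^sup>+x. ennreal (\<bar>G J x\<bar> * wvec \<alpha> r x) * indicator (cube U) x \<partial>lborel)"
      proof (rule nn_integral_cong)
        fix x show "ennreal (norm (indicator (cube U) x *\<^sub>R (G J x * wvec \<alpha> r x))) =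
          ennreal (\<bar>G J x\<bar> * wvec \<alpha> r x) * indicator (cube U) x"
          using wvec_nonneg[of \<alpha> r x] by (cases "x \<in> cube U") (simp_all add: abs_mult)
      qed
      also have "\<dots> \<le> ennreal (s ^ CARD('d))" by (rule nnG[OF J])
      also have "\<dots> < \<infinity>" by simp
      finally show "(\<integral>\<^sup>+x. ennreal (norm (indicator (cube U) x *\<^sub>R (G J x * wvec \<alpha> r x))) \<partial>lborel) < \<infinity>" .
    qed
    have norm_le: "norm_L1w \<alpha> r U (G J) \<le> s ^ CARD('d)" if J: "J \<in> multi_idx r" for J
      using nnG[OF J] unfolding nn_integral_norm_L1w[OF GL[OF J]] by (simp add: s_def)
    have "(\<Sum>J\<in>multi_idx r. norm_L1w \<alpha> r U (G J)) \<le> real (card (multi_idx r :: ('d \<Rightarrow> nat) set)) * s ^ CARD('d)"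
      by (rule order_trans[OF sum_mono[OF norm_le]]) simp_all
    also have "card (multi_idx r :: ('d \<Rightarrow> nat) set) = (r + 1) ^ CARD('d)"
      unfolding multi_idx_PiE by (simp add: card_PiE)
    also have "real ((r + 1) ^ CARD('d)) * s ^ CARD('d) = 1"
      by (simp add: s_def add.commute flip: power_mult_distrib)
    finally have nle: "(\<Sum>J\<in>multi_idx r. norm_L1w \<alpha> r U (G J)) \<le> 1" .
    have ball: "f \<in> sobolev_ball \<alpha> r U"
      unfolding sobolev_ball_def
    proof (intro CollectI conjI exI[of _ G] ballI)
      show "continuous_on (cube U) f" unfolding fG by (rule continuous_on_subset[OF Gc]) simp
      show "in_L1w \<alpha> r U f" unfolding fG by (rule GL) (simp add: multi_idx_def)
      show "has_weak_deriv (cube U) f J (G J)" for J unfolding f_def G_def by (rule tensor_has_weak_deriv[OF su])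
    qed (use GL nle in auto)
    have supp: "real (k i) < x $ i \<and> x $ i < real (k i) + 1" if "f x \<noteq> 0" for x i
    proof (rule ccontr)
      assume "\<not> ?thesis"
      then have "moll (1/2) (x $ i - (real (k i) + 1/2)) = 0" by (intro moll_zero) auto
      then have "f x = 0" unfolding f_def by (intro tensor_eq_0[of _ i]) (simp add: u_def m_def)
      then show False using that by simp
    qed
    define \<phi> where "\<phi> = (tensor m :: real^'d \<Rightarrow> real)"
    have \<phi>: "integrable lborel \<phi>" "(LINT x|lborel. \<phi> x) = 1"
      unfolding \<phi>_def m_def using tensor_moll_integral[of "1/2" "\<lambda>i. real (k i) + 1/2"] by auto
    have \<phi>0: "\<phi> x \<ge> 0" for x unfolding \<phi>_def tensor_def m_def by (rule prod_nonneg) (simp add: moll_nonneg)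
    define c where "c = (\<Prod>i\<in>UNIV. a i * (w0 * (real (k i) powr \<alpha> * exp (- real (k i)))))"
    have c: "c = b * (\<Prod>i\<in>UNIV. real (k i)) powr (- real r / 2)"
    proof -
      have "a i * (w0 * (real (k i) powr \<alpha> * exp (- real (k i)))) = a0 * w0 * real (k i) powr (- real r / 2)" for i
      proof -
        have "a i * (w0 * (real (k i) powr \<alpha> * exp (- real (k i)))) =
          a0 * w0 * (real (k i) powr (- \<beta>) * real (k i) powr \<alpha>) * (exp (real (k i)) * exp (- real (k i)))"
          by (simp add: a_def mult_ac)
        also have "exp (real (k i)) * exp (- real (k i)) = 1" by (simp add: mult_exp_exp)
        also have "real (k i) powr (- \<beta>) * real (k i) powr \<alpha> = real (k i) powr (- real r / 2)"
          by (simp add: \<beta>_def flip: powr_add)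
        finally show ?thesis by simp
      qed
      then have "c = (\<Prod>i\<in>UNIV. (a0 * w0) * real (k i) powr (- real r / 2))" unfolding c_def by (simp only:)
      also have "\<dots> = b * (\<Prod>i\<in>UNIV. real (k i) powr (- real r / 2))"
        unfolding prod.distrib[of "\<lambda>_. a0 * w0"] b_def by (simp only: prod_constant)
      finally show ?thesis by (simp add: prod_powr_distrib)
    qed
    have fw: "c * \<phi> x \<le> indicator (cube U) x *\<^sub>R (f x * wvec \<alpha> 0 x)" for x
    proof (cases "\<phi> x = 0")
      case True
      then have "f x = 0" unfolding f_def u_def \<phi>_def tensor_def by (simp add: prod.distrib)
      then show ?thesis using True by simp
    next
      case False
      then have mi: "m i (x $ i) \<noteq> 0" for i unfolding \<phi>_def using tensor_eq_0[of m i x] by auto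
      have xi: "real (k i) \<le> x $ i" "x $ i \<le> real (k i) + 1" for i
      proof -
        have "\<bar>x $ i - (real (k i) + 1/2)\<bar> < 1/2"
          using mi[of i] moll_zero[of "1/2" "x $ i - (real (k i) + 1/2)"] unfolding m_def by linarith
        then show "real (k i) \<le> x $ i" "x $ i \<le> real (k i) + 1" by linarith+
      qed
      have xc: "x \<in> cube U" using inU xi(1) by (auto simp: cube_def)
      have "c * \<phi> x = (\<Prod>i\<in>UNIV. (a i * (w0 * (real (k i) powr \<alpha> * exp (- real (k i))))) * m i (x $ i))"
        by (simp add: c_def \<phi>_def tensor_def prod.distrib)
      also have "\<dots> \<le> (\<Prod>i\<in>UNIV. u i (x $ i) * wr \<alpha> 0 (x $ i))"
      proof (rule prod_mono, rule conjI)
        fix i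
        have m0: "m i (x $ i) \<ge> 0" by (simp add: m_def moll_nonneg)
        show "0 \<le> a i * (w0 * (real (k i) powr \<alpha> * exp (- real (k i)))) * m i (x $ i)"
          using a[of i] pos m0 by simp
        have "w0 * (real (k i) powr \<alpha> * exp (- real (k i))) \<le> wr \<alpha> 0 (x $ i)"
          using wr_near_integer(2)[OF k xi(1)[of i] xi(2)[of i], of \<alpha> 0] by (simp add: w0_def)
        then have "(a i * m i (x $ i)) * (w0 * (real (k i) powr \<alpha> * exp (- real (k i)))) \<le> (a i * m i (x $ i)) * wr \<alpha> 0 (x $ i)"
          using a[of i] m0 by (intro mult_left_mono) auto
        then show "a i * (w0 * (real (k i) powr \<alpha> * exp (- real (k i)))) * m i (x $ i) \<le> u i (x $ i) * wr \<alpha> 0 (x $ i)"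
          by (simp add: u_def mult_ac)
      qed
      also have "\<dots> = f x * wvec \<alpha> 0 x" by (simp add: f_def tensor_def wvec_def prod.distrib)
      finally show ?thesis using xc by simp
    qed
    \<comment> \<open>Integrability has to be proved before the integral is bounded below, because a
      non-integrable function would have integral 0 by default.\<close>
    have fi: "integrable lborel (\<lambda>x. indicator (cube U) x *\<^sub>R (f x * wvec \<alpha> 0 x))"
    proof (rule Bochner_Integration.integrable_bound)
      define e where "e = (\<Prod>i\<in>UNIV. 2 powr \<bar>\<alpha>\<bar> * (real (k i) powr \<alpha> * exp (- real (k i))))"
      have e0: "e \<ge> 0" unfolding e_def by (rule prod_nonneg) simp
      have f\<phi>: "f x = (\<Prod>i\<in>UNIV. a i) * \<phi> x" for x
        by (simp add: f_def u_def \<phi>_def tensor_def prod.distrib)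
      show "integrable lborel (\<lambda>x. e * f x)" unfolding f\<phi> using \<phi>(1) by simp
      show "(\<lambda>x. indicator (cube U) x *\<^sub>R (f x * wvec \<alpha> 0 x)) \<in> borel_measurable lborel"
        using Gm[of "\<lambda>_. 0"] cube_measurable[OF oU] unfolding fG by measurable
      show "AE x in lborel. norm (indicator (cube U) x *\<^sub>R (f x * wvec \<alpha> 0 x)) \<le> norm (e * f x)"
      proof (rule AE_I2)
        fix x
        show "norm (indicator (cube U) x *\<^sub>R (f x * wvec \<alpha> 0 x)) \<le> norm (e * f x)"
        proof (cases "f x = 0")
          case False
          have "wvec \<alpha> 0 x \<le> e" unfolding wvec_def e_def
            using wr_near_integer(1)[OF k, of _ _ \<alpha> 0] supp[OF False]
            by (intro prod_mono conjI wr_nonneg) (simp add: less_imp_le)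
          then have "\<bar>f x\<bar> * wvec \<alpha> 0 x \<le> \<bar>f x\<bar> * e" by (rule mult_left_mono) simp
          then show ?thesis using e0 by (cases "x \<in> cube U") (simp_all add: abs_mult wvec_nonneg mult.commute)
        qed simp
      qed
    qed
    have "c * 1 = (LINT x|lborel. c * \<phi> x)" using \<phi> by simp
    also have "\<dots> \<le> (LINT x|lborel. indicator (cube U) x *\<^sub>R (f x * wvec \<alpha> 0 x))"
      by (rule integral_mono) (use \<phi> fi fw in auto)
    finally have "c \<le> (LINT x:cube U|lborel. f x * wvec \<alpha> 0 x)" by (simp add: set_lebesgue_integral_def)
    then have "b * (\<Prod>i\<in>UNIV. real (k i)) powr (- real r / 2) \<le> \<bar>LINT x:cube U|lborel. f x * wvec \<alpha> 0 x\<bar>"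
      unfolding c by linarith
    then show ?thesis using ball supp by blast
  qed
  then show ?thesis using pos(4) by blast
qed

text \<open>Pigeonhole on integer corners: \<open>m\<close> is the first level at which the
  guaranteed number \<open>P m\<close> of corners exceeds \<open>n\<close>. Minimality gives
  \<open>2^m * m^(d-1) = O(n)\<close>, so the product of coordinates of the free corner, at most
  \<open>2^(m+d)\<close>, is \<open>O(n / (ln n)^(d-1))\<close>.\<close>

lemma quadrature_lower_rate:
  assumes d: "CARD('d::finite) \<ge> 2" and \<alpha>: "\<alpha> > -1" and U: "U = UNIV \<or> U = {0<..}"
  shows "\<exists>c>0. \<forall>n::nat. n \<ge> 2 \<longrightarrow> (\<forall>Q :: (real \<times> (real^'d)) list. length Q \<le> n \<longrightarrow>
    (\<exists>f\<in>sobolev_ball \<alpha> r U. c * (ln (real n) ^ (CARD('d) - 1) / real n) powr (real r / 2)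
      \<le> \<bar>(LINT x:cube U|lborel. f x * wvec \<alpha> 0 x) - quad Q f\<bar>))"
proof -
  define e where "e = CARD('d) - 1"
  have e: "CARD('d) = Suc e" "e \<ge> 1" using d by (auto simp: e_def)
  obtain b where b: "b > 0" and bump: "\<And>k :: 'd \<Rightarrow> nat. (\<forall>i. k i \<ge> 1) \<Longrightarrow> (\<exists>f\<in>sobolev_ball \<alpha> r U.
    (\<forall>x. f x \<noteq> 0 \<longrightarrow> (\<forall>i. real (k i) < x $ i \<and> x $ i < real (k i) + 1)) \<and>
    b * (\<Prod>i\<in>UNIV. real (k i)) powr (- real r / 2) \<le> \<bar>LINT x:cube U|lborel. f x * wvec \<alpha> 0 x\<bar>)"
    using bump_in_ball[OF \<alpha> U, where 'd = 'd and r = r] by blast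
  define D where "D = real CARD('d)"
  have D: "D \<ge> 2" using d by (simp add: D_def)
  \<comment> \<open>The 2 comes from minimality of \<open>m\<close>, \<open>2 ^ d\<close> from the
    upper ends of the dyadic ranges, one \<open>D ^ e\<close> from \<open>ln n \<le> D * m\<close>
    and the other from the division by \<open>D\<close> in \<open>P\<close>.\<close>
  define A where "A = 2 * 2 ^ CARD('d) * (D ^ e * D ^ e)"
  have A: "A > 0" using D by (simp add: A_def)
  define c where "c = b * A powr (- real r / 2)"
  have "\<exists>f\<in>sobolev_ball \<alpha> r U. c * (ln (real n) ^ e / real n) powr (real r / 2)
      \<le> \<bar>(LINT x:cube U|lborel. f x * wvec \<alpha> 0 x) - quad Q f\<bar>"
    if n: "n \<ge> 2" and Q: "length Q \<le> n" for n :: nat and Q :: "(real \<times> (real^'d)) list"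
  proof -
    \<comment> \<open>A smooth lower bound for the number of corners: \<open>m div d + 1\<close> is
      at least \<open>(m + 1) / d\<close>.\<close>
    define P where "P m = 2 ^ m * ((real m + 1) / D) ^ e" for m
    have "\<exists>m. real n < P m"
    proof -
      obtain m where m: "real n * D ^ e < 2 ^ m" using real_arch_pow[of 2 "real n * D ^ e"] by auto
      have "real n = real n * D ^ e * (1 / D) ^ e" using D by (simp add: power_one_over)
      also have "\<dots> < 2 ^ m * (1 / D) ^ e" using m D by (intro mult_strict_right_mono) auto
      also have "\<dots> \<le> P m" unfolding P_def using D
        by (intro mult_left_mono power_mono divide_right_mono) auto
      finally show ?thesis by blast
    qed
    define m where "m = (LEAST m. real n < P m)"
    have Pm: "real n < P m" unfolding m_def by (rule LeastI_ex) fact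
    have "m \<noteq> 0"
    proof
      assume "m = 0"
      then have "P m \<le> 1" using D by (simp add: P_def power_le_one)
      then show False using Pm n by simp
    qed
    then obtain m' where m': "m = Suc m'" using not0_implies_Suc by blast
    have "P m' \<le> real n" using not_less_Least[of m' "\<lambda>m. real n < P m"] m' unfolding m_def[symmetric] by simp
    then have le: "2 ^ m * (real m / D) ^ e \<le> 2 * real n" by (simp add: P_def m' add.commute)
    have card: "n < card (\<Union>a\<in>{a::'d \<Rightarrow> nat. (\<Sum>i\<in>UNIV. a i) = m}. dyadic_block a)" (is "_ < card ?H")
    proof -
      have "m < CARD('d) * (m div CARD('d)) + CARD('d)"
      proof -
        have "m mod CARD('d) < CARD('d)" by simp
        then show ?thesis using mult_div_mod_eq[of "CARD('d)" m] by linarith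
      qed
      then have "m + 1 \<le> CARD('d) * (m div CARD('d) + 1)" by simp
      then have "real (m + 1) \<le> real (CARD('d) * (m div CARD('d) + 1))" by (rule of_nat_mono)
      then have "(real m + 1) / D \<le> real (m div CARD('d) + 1)"
        using D by (simp add: D_def field_simps)
      then have "P m \<le> 2 ^ m * real (m div CARD('d) + 1) ^ e"
        unfolding P_def using D by (intro mult_left_mono power_mono) auto
      also have "\<dots> = real (2 ^ m * (m div CARD('d) + 1) ^ e)" by simp
      also have "\<dots> \<le> real (card ?H)"
        using dyadic_blocks_card[where 'd = 'd, of m] unfolding e_def by (rule of_nat_mono)
      finally show ?thesis using Pm by simp
    qed
    \<comment> \<open>A node sees the bump at \<open>k\<close> only if its coordinatewise floor is
      \<open>k\<close>. Negative coordinates are sent to 0, which is never a coordinate of a corner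
      in the blocks.\<close>
    define fl where "fl p = (\<lambda>i. nat \<lfloor>snd p $ i\<rfloor>)" for p :: "real \<times> (real^'d)"
    have "card (fl ` set Q) \<le> n"
      using card_image_le[of "set Q" fl] card_length[of Q] Q by simp
    then have "\<not> ?H \<subseteq> fl ` set Q" using card card_mono[of "fl ` set Q" ?H] by auto
    then obtain k a where k: "(\<Sum>i\<in>UNIV. a i) = m" "k \<in> dyadic_block a" "k \<notin> fl ` set Q" by blast
    have k1: "\<forall>i. k i \<ge> 1"
    proof
      fix i have "1 \<le> (2::nat) ^ a i" by simp
      then show "k i \<ge> 1" using k(2) unfolding dyadic_block_def by (metis (mono_tags, lifting) mem_Collect_eq order_trans)
    qed
    obtain f where f: "f \<in> sobolev_ball \<alpha> r U"
      "\<And>x i. f x \<noteq> 0 \<Longrightarrow> real (k i) < x $ i \<and> x $ i < real (k i) + 1"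
      "b * (\<Prod>i\<in>UNIV. real (k i)) powr (- real r / 2) \<le> \<bar>LINT x:cube U|lborel. f x * wvec \<alpha> 0 x\<bar>"
      using bump[OF k1] by blast
    have "f (snd p) = 0" if "p \<in> set Q" for p
    proof (rule ccontr)
      assume nz: "f (snd p) \<noteq> 0"
      have "fl p i = k i" for i
      proof -
        have "\<lfloor>snd p $ i\<rfloor> = int (k i)" using f(2)[OF nz, of i] by (intro floor_unique) auto
        then show ?thesis by (simp add: fl_def)
      qed
      then have "fl p = k" by blast
      then show False using k(3) that by blast
    qed
    then have "map (\<lambda>p. fst p * f (snd p)) Q = map (\<lambda>_. 0) Q" by (intro map_cong[OF refl]) simp
    then have quad0: "quad Q f = 0" unfolding quad_def by (simp only: sum_list_0)
    have "c * (ln (real n) ^ e / real n) powr (real r / 2) \<le> b * (\<Prod>i\<in>UNIV. real (k i)) powr (- real r / 2)"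
    proof -
      define pk where "pk = (\<Prod>i\<in>UNIV. real (k i))"
      have pk1: "pk > 0" unfolding pk_def by (rule prod_pos) (use k1 in \<open>auto simp: Suc_le_eq\<close>)
      have pk: "pk \<le> 2 ^ m * 2 ^ CARD('d)"
        using dyadic_block_prod_le[OF k(2)] k(1) by (simp add: pk_def power_add)
      have l0: "ln (real n) > 0" using n by simp
      have lnm: "ln (real n) \<le> D * real m"
      proof -
        have "real n \<le> 2 ^ m * (real m + 1) ^ e"
        proof -
          have "((real m + 1) / D) ^ e \<le> (real m + 1) ^ e" 
          proof (rule power_mono)
            have "(real m + 1) / D \<le> (real m + 1) / 1" using D by (intro divide_left_mono) auto
            then show "(real m + 1) / D \<le> real m + 1" by simp
          qed (use D in simp)
          then have "P m \<le> 2 ^ m * (real m + 1) ^ e" unfolding P_def by (intro mult_left_mono) auto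
          then show ?thesis using Pm by linarith
        qed
        then have "ln (real n) \<le> ln (2 ^ m * (real m + 1) ^ e)" using n by (intro ln_mono) auto
        also have "\<dots> = real m * ln 2 + real e * ln (real m + 1)" by (simp add: ln_mult ln_realpow)
        \<comment> \<open>Crude bounds suffice here: ln 2 \<le> 1 and ln(m + 1) \<le> m, with
          \<open>1 + e = D\<close>.\<close>
        also have "\<dots> \<le> real m * 1 + real e * real m"
          using ln_2_less_1 ln_add_one_self_le_self[of "real m"]
          by (intro add_mono mult_left_mono) (auto simp: add.commute)
        also have "\<dots> = D * real m" unfolding D_def e(1) by (simp add: distrib_right)
        finally show ?thesis .
      qed
      have "pk * ln (real n) ^ e \<le> (2 ^ m * 2 ^ CARD('d)) * (D * real m) ^ e"
        using pk pk1 lnm l0 by (intro mult_mono power_mono) auto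
      also have "\<dots> = 2 ^ CARD('d) * (D ^ e * D ^ e) * (2 ^ m * (real m / D) ^ e)"
        using D by (simp add: power_mult_distrib power_divide)
      also have "\<dots> \<le> 2 ^ CARD('d) * (D ^ e * D ^ e) * (2 * real n)"
        using le D by (intro mult_left_mono) auto
      finally have "pk * ln (real n) ^ e \<le> A * real n" by (simp add: A_def)
      then have "ln (real n) ^ e / real n \<le> A / pk" using n pk1 by (simp add: field_simps)
      then have "(ln (real n) ^ e / real n) powr (real r / 2) \<le> (A / pk) powr (real r / 2)"
        using l0 by (intro powr_mono2) auto
      also have "\<dots> = A powr (real r / 2) * pk powr (- real r / 2)"
      proof -
        have "pk powr (- real r / 2) = 1 / pk powr (real r / 2)" by (simp add: powr_minus_divide)
        then show ?thesis unfolding powr_divide by simp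
      qed
      finally have "c * (ln (real n) ^ e / real n) powr (real r / 2) \<le> c * (A powr (real r / 2) * pk powr (- real r / 2))"
        using b A by (intro mult_left_mono) (auto simp: c_def)
      also have "\<dots> = b * (A powr (- real r / 2) * A powr (real r / 2)) * pk powr (- real r / 2)" by (simp add: c_def mult_ac)
      also have "A powr (- real r / 2) * A powr (real r / 2) = 1" using A by (simp flip: powr_add)
      finally show ?thesis by (simp add: pk_def)
    qed
    also have "\<dots> \<le> \<bar>(LINT x:cube U|lborel. f x * wvec \<alpha> 0 x) - quad Q f\<bar>" using f(3) quad0 by simp
    finally show ?thesis using f(1) by blast
  qed
  moreover have "c > 0" using b A by (simp add: c_def)
  ultimately show ?thesis unfolding e_def by blast
qed

text \<open>Apply ln z \<le> z to z = x^(1/e) and raise to the power \<open>e\<close>. This bounds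
  the ratio of logarithms to \<open>n\<close> in the final comparison of lower rates.\<close>

lemma ln_power_le:
  fixes x :: real
  assumes "x \<ge> 1" "e \<ge> 1" shows "ln x ^ e \<le> real e ^ e * x"
proof -
  have "ln x = real e * ln (x powr (1 / real e))" using assms by (simp add: ln_powr)
  also have "\<dots> \<le> real e * x powr (1 / real e)"
    using assms ln_le_minus_one[of "x powr (1 / real e)"] by (intro mult_left_mono) auto
  finally have "ln x ^ e \<le> (real e * x powr (1 / real e)) ^ e" using assms by (intro power_mono) auto
  also have "\<dots> = real e ^ e * x"
    using assms by (simp add: power_mult_distrib powr_powr flip: powr_realpow)
  finally show ?thesis .
qed

theorem theorem3p2:
  fixes \<alpha> :: real and r :: nat and U :: "real set"
  assumes "CARD('d::finite) \<ge> 2"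
    and "\<alpha> > -1"
    and "r \<ge> 1"
    and "U = UNIV \<or> U = {0<..}"
  shows "\<exists>C1 C2. C1 > 0 \<and> C2 > 0 \<and>
    (\<forall>n::nat. n \<ge> 2 \<longrightarrow>
      ereal (C1 * real n powr (- 3 * real r / 4) * ln (real n) powr (3 * real r * (real CARD('d) - 1) / 4))
        \<le> Int_n \<alpha> U n (sobolev_ball \<alpha> r U :: (real^'d \<Rightarrow> real) set) \<and>
      Int_n \<alpha> U n (sobolev_ball \<alpha> r U :: (real^'d \<Rightarrow> real) set)
        \<le> ereal (C2 * real n powr (- real r / 2) * ln (real n) powr ((real r / 2 + 1) * (real CARD('d) - 1))))"
proof -
  define F where "F = (sobolev_ball \<alpha> r U :: (real^'d \<Rightarrow> real) set)"
  obtain \<kappa> C where fam: "sampling_family \<alpha> r U (diff_coef r) \<kappa> (diff_nodes r U) C ((1 / sqrt 2) ^ r)"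
    using sampling_family_exists[OF assms(3,2,4)] by blast
  obtain C2 where C2: "C2 > 0" and up: "\<And>n::nat. n \<ge> 2 \<Longrightarrow> (\<exists>Q :: (real \<times> (real^'d)) list. length Q \<le> n \<and> (\<forall>p\<in>set Q. snd p \<in> cube U) \<and>
    (\<forall>f\<in>F. \<bar>(LINT x:cube U|lborel. f x * wvec \<alpha> 0 x) - quad Q f\<bar> \<le>
      C2 * real n powr (- real r / 2) * ln (real n) powr ((real r / 2 + 1) * (real CARD('d) - 1))))"
    using sampling_family.sparse_quadrature_rate[OF fam assms(1) refl] unfolding F_def by blast
  define e where "e = CARD('d) - 1"
  have e: "e \<ge> 1" "real e = real CARD('d) - 1" using assms(1) by (auto simp: e_def)
  obtain c where c: "c > 0" and low: "\<And>n Q. n \<ge> 2 \<Longrightarrow> length Q \<le> n \<Longrightarrow>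
    (\<exists>f\<in>F. c * (ln (real n) ^ e / real n) powr (real r / 2)
      \<le> \<bar>(LINT x:cube U|lborel. f x * wvec \<alpha> 0 x) - quad Q f\<bar>)"
    using quadrature_lower_rate[OF assms(1,2,4), where r = r] unfolding F_def e_def by blast
  define X where "X = real e ^ e"
  have X: "X > 0" using e by (simp add: X_def)
  \<comment> \<open>\<open>X\<close> bounds \<open>y = (ln n)^e / n\<close>, so y^(3*r/4) = y^(r/2)
    * y^(r/4) is at most y^(r/2) * X^(r/4).\<close>
  define C1 where "C1 = c / X powr (real r / 4)"
  have C1: "C1 > 0" using c X by (simp add: C1_def)
  have lower: "ereal (C1 * real n powr (- 3 * real r / 4) * ln (real n) powr (3 * real r * (real CARD('d) - 1) / 4)) \<le> Int_n \<alpha> U n F"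
    if n: "n \<ge> 2" for n :: nat
  proof -
    define y where "y = ln (real n) ^ e / real n"
    have l0: "ln (real n) > 0" using n by simp
    have y: "0 < y" "y \<le> X"
      using n l0 ln_power_le[of "real n" e] e(1) by (auto simp: y_def X_def divide_le_eq)
    have "real n powr (- 3 * real r / 4) * ln (real n) powr (3 * real r * (real CARD('d) - 1) / 4) = y powr (3 * real r / 4)"
    proof -
      have "y powr (3 * real r / 4) = (ln (real n) powr real e) powr (3 * real r / 4) / real n powr (3 * real r / 4)"
        unfolding y_def powr_realpow[OF l0] by (rule powr_divide)
      moreover have "(ln (real n) powr real e) powr (3 * real r / 4) = ln (real n) powr (3 * real r * (real CARD('d) - 1) / 4)"
        by (simp add: powr_powr e(2) mult_ac)
      moreover have "real n powr (- 3 * real r / 4) = 1 / real n powr (3 * real r / 4)"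
        by (simp add: powr_minus_divide)
      ultimately show ?thesis by simp
    qed
    also have "\<dots> = y powr (real r / 2) * y powr (real r / 4)" by (simp flip: powr_add)
    also have "\<dots> \<le> y powr (real r / 2) * X powr (real r / 4)"
      using y by (intro mult_left_mono powr_mono2) auto
    finally have "C1 * (real n powr (- 3 * real r / 4) * ln (real n) powr (3 * real r * (real CARD('d) - 1) / 4))
      \<le> C1 * (y powr (real r / 2) * X powr (real r / 4))" using C1 by (intro mult_left_mono) auto
    also have "\<dots> = c * y powr (real r / 2)" using X by (simp add: C1_def)
    finally have le: "C1 * real n powr (- 3 * real r / 4) * ln (real n) powr (3 * real r * (real CARD('d) - 1) / 4)
      \<le> c * y powr (real r / 2)" by (simp add: mult.assoc)
    show ?thesis unfolding Int_n_def
    proof (rule INF_greatest)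
      fix Q :: "(real \<times> (real^'d)) list" assume "Q \<in> {Q. length Q \<le> n \<and> (\<forall>p\<in>set Q. snd p \<in> cube U)}"
      then have "length Q \<le> n" by simp
      from low[OF n this] obtain f where f: "f \<in> F" "c * y powr (real r / 2) \<le> \<bar>(LINT x:cube U|lborel. f x * wvec \<alpha> 0 x) - quad Q f\<bar>"
        unfolding y_def by blast
      show "ereal (C1 * real n powr (- 3 * real r / 4) * ln (real n) powr (3 * real r * (real CARD('d) - 1) / 4))
        \<le> (SUP f\<in>F. ereal \<bar>(LINT x:cube U|lborel. f x * wvec \<alpha> 0 x) - quad Q f\<bar>)"
        by (rule SUP_upper2[OF f(1)]) (use le f(2) in simp)
    qed
  qed
  have upper: "Int_n \<alpha> U n F \<le> ereal (C2 * real n powr (- real r / 2) * ln (real n) powr ((real r / 2 + 1) * (real CARD('d) - 1)))"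
    if n: "n \<ge> 2" for n :: nat
  proof -
    obtain Q :: "(real \<times> (real^'d)) list" where Q: "length Q \<le> n" "\<forall>p\<in>set Q. snd p \<in> cube U"
      "\<And>f. f \<in> F \<Longrightarrow> \<bar>(LINT x:cube U|lborel. f x * wvec \<alpha> 0 x) - quad Q f\<bar> \<le>
        C2 * real n powr (- real r / 2) * ln (real n) powr ((real r / 2 + 1) * (real CARD('d) - 1))"
      using up[OF n] by blast
    show ?thesis unfolding Int_n_def
      by (rule INF_lower2[of Q]) (use Q in \<open>auto intro!: SUP_least\<close>)
  qed
  show ?thesis unfolding F_def[symmetric] using C1 C2 lower upper by blast
qed

end
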